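(* Let $n,p\ge 1$, let $\boldsymbol{x}_1,\dots,\boldsymbol{x}_n\in\mathbb{R}^p$ be known covariate vectors, let $\boldsymbol{X}$ be the $n\times p$ matrix with $i$th row $\boldsymbol{x}_i^T$, and let $\boldsymbol{y}=(y_1,\dots,y_n)^T\in\{0,1\}^n$ be the observed binary responses. Suppose that the posterior density of $\boldsymbol{\beta}\in\mathbb{R}^p$ in the Bayesian logistic regression model with flat prior $\pi(\boldsymbol{\beta})\propto 1$ is proper, that is, $$c(\boldsymbol{y})=\int_{\mathbb{R}^{p}}\prod_{i=1}^{n}\frac{\left[\exp(\boldsymbol{x}_{i}^{T}\boldsymbol{\beta})\right]^{y_{i}}}{1+\exp(\boldsymbol{x}_{i}^{T}\boldsymbol{\beta})}\,d\boldsymbol{\beta}<\infty .$$ Let $\boldsymbol{\Psi}=\{\boldsymbol{\omega}^{(m)}\}_{m=0}^{\infty}$ be the Markov chain on $\mathbb{R}_+^n$ with transition density $k(\boldsymbol{\omega}\mid\boldsymbol{\omega}')$ given by the Pólya-Gamma Gibbs sampler (defined in the context). Then $\boldsymbol{\Psi}$ is geometrically ergodic: there exist a constant $0<t<1$ and a function $H:\mathbb{R}_+^n\to[0,\infty)$ such that for every $\boldsymbol{\omega}\in\mathbb{R}_+^n$ and every integer $m\ge 1$, $$\sup_{A\in\mathscr{B}}\left|K^m(\boldsymbol{\omega},A)-\Pi(A\mid\boldsymbol{y})\right|\le H(\boldsymbol{\omega})\,t^m .$$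
   Context: Write $\mathbb{R}_+=(0,\infty)$ and let $\mathscr{B}$ be the Borel $\sigma$-algebra of $\mathbb{R}_+^n$. Pólya-Gamma distribution: for $b\ge 0$, $PG(1,b)$ is the probability distribution on $(0,\infty)$ with density $$f(w\mid 1,b)=\cosh(b/2)\sum_{j=0}^{\infty}(-1)^j\frac{2j+1}{\sqrt{2\pi w^3}}\exp\left(-\frac{(2j+1)^2}{8w}-\frac{b^2}{2}w\right),\quad w>0.$$ Let $\boldsymbol{\kappa}=(\kappa_1,\dots,\kappa_n)^T$ with $\kappa_i=y_i-1/2$. For $\boldsymbol{\omega}=(\omega_1,\dots,\omega_n)^T\in\mathbb{R}_+^n$, let $\boldsymbol{\Omega}$ be the $n\times n$ diagonal matrix with $i$th diagonal element $\omega_i$. Conditional densities: $\pi(\boldsymbol{\omega}\mid\boldsymbol{\beta},\boldsymbol{y})=\prod_{i=1}^n f(\omega_i\mid 1,|\boldsymbol{x}_i^T\boldsymbol{\beta}|)$, i.e. given $\boldsymbol{\beta}$ the $\omega_i$ are independent with $\omega_i\sim PG(1,|\boldsymbol{x}_i^T\boldsymbol{\beta}|)$; and $\pi(\boldsymbol{\beta}\mid\boldsymbol{\omega},\boldsymbol{y})$ is the density of the $p$-dimensional normal distribution $N\left((\boldsymbol{X}^T\boldsymbol{\Omega}\boldsymbol{X})^{-1}\boldsymbol{X}^T\boldsymbol{\kappa},\,(\boldsymbol{X}^T\boldsymbol{\Omega}\boldsymbol{X})^{-1}\right)$. (By a known result of Chen and Shao (2001), $c(\boldsymbol{y})<\infty$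 holds if and only if $\boldsymbol{X}$ has full rank and there is a vector $\boldsymbol{e}\in\mathbb{R}^n$ with strictly positive components such that $\boldsymbol{Z}^T\boldsymbol{e}=\boldsymbol{0}$, where $\boldsymbol{Z}$ is the $n\times p$ matrix with $i$th row $c_i\boldsymbol{x}_i^T$, $c_i=1$ if $y_i=0$ and $c_i=-1$ if $y_i=1$; in particular $\boldsymbol{X}^T\boldsymbol{\Omega}\boldsymbol{X}$ is then invertible.) Transition density and kernel of $\boldsymbol{\Psi}$: $$k(\boldsymbol{\omega}\mid\boldsymbol{\omega}')=\int_{\mathbb{R}^p}\pi(\boldsymbol{\omega}\mid\boldsymbol{\beta},\boldsymbol{y})\,\pi(\boldsymbol{\beta}\mid\boldsymbol{\omega}',\boldsymbol{y})\,d\boldsymbol{\beta},\qquad K(\boldsymbol{\omega}',A)=\int_A k(\boldsymbol{\omega}\mid\boldsymbol{\omega}')\,d\boldsymbol{\omega},\quad A\in\mathscr{B},$$ and $K^m$ denotes the $m$-step Markov transition function. Target distribution: the joint (augmented) posterior density on $\mathbb{R}^p\times\mathbb{R}_+^n$ is $$\pi(\boldsymbol{\beta},\boldsymbol{\omega}\mid\boldsymbol{y})=\frac{1}{c(\boldsymbol{y})}\prod_{i=1}^n\frac{[\exp(\boldsymbol{x}_i^T\boldsymbol{\beta})]^{y_i}}{1+\exp(\boldsymbol{x}_i^T\boldsymbol{\beta})}\prod_{i=1}^n f(\omega_i\mid 1,|\boldsymbol{x}_i^T\boldsymbol{\beta}|),$$ and $\Pi(\cdot\mid\boldsymbol{y})$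 is the probability measure on $\mathbb{R}_+^n$ with density $\pi(\boldsymbol{\omega}\mid\boldsymbol{y})=\int_{\mathbb{R}^p}\pi(\boldsymbol{\beta},\boldsymbol{\omega}\mid\boldsymbol{y})\,d\boldsymbol{\beta}$. *)

theory Defs
  imports "HOL-Probability.Probability"
begin

definition pos_orthant :: "(real ^ 'n) set" where
  "pos_orthant = {w. \<forall>i. 0 < w $ i}"

text \<open>The density of the Polya-Gamma distribution \<open>PG(1, b)\<close>; only its values at \<open>w > 0\<close> are
  meaningful. There the alternating series is nonnegative, so the coercions to \<open>ennreal\<close> below
  truncate nothing.\<close>

definition PG_density :: "real \<Rightarrow> real \<Rightarrow> real" where
  "PG_density b w =
     cosh (b / 2) *
       (\<Sum>j. (-1) ^ j * (real (2 * j + 1) / sqrt (2 * pi * w ^ 3)) *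
             exp (- (real (2 * j + 1))\<^sup>2 / (8 * w) - b\<^sup>2 / 2 * w))"

definition mvn_density :: "real ^ 'p \<Rightarrow> real ^ 'p ^ 'p \<Rightarrow> real ^ 'p \<Rightarrow> real" where
  "mvn_density \<mu> \<Sigma> x =
     exp (- ((x - \<mu>) \<bullet> (matrix_inv \<Sigma> *v (x - \<mu>))) / 2) /
     sqrt ((2 * pi) ^ CARD('p) * det \<Sigma>)"

definition diag_matrix :: "real ^ 'n \<Rightarrow> real ^ 'n ^ 'n" where
  "diag_matrix w = (\<chi> i j. if i = j then w $ i else 0)"

text \<open>The covariate vector \<open>x\<^sub>i\<close> is the row \<open>X $ i\<close> of the design matrix.\<close>

definition logit_likelihood :: "real ^ 'p ^ 'n \<Rightarrow> nat ^ 'n \<Rightarrow> real ^ 'p \<Rightarrow> real" where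
  "logit_likelihood X y \<beta> =
     (\<Prod>i\<in>UNIV. exp (X $ i \<bullet> \<beta>) ^ (y $ i) / (1 + exp (X $ i \<bullet> \<beta>)))"

definition norm_const :: "real ^ 'p ^ 'n \<Rightarrow> nat ^ 'n \<Rightarrow> ennreal" where
  "norm_const X y = (\<integral>\<^sup>+ \<beta>. ennreal (logit_likelihood X y \<beta>) \<partial>lborel)"

definition cond_omega :: "real ^ 'p ^ 'n \<Rightarrow> real ^ 'p \<Rightarrow> real ^ 'n \<Rightarrow> real" where
  "cond_omega X \<beta> \<omega> = (\<Prod>i\<in>UNIV. PG_density \<bar>X $ i \<bullet> \<beta>\<bar> (\<omega> $ i))"

definition cond_beta :: "real ^ 'p ^ 'n \<Rightarrow> nat ^ 'n \<Rightarrow> real ^ 'n \<Rightarrow> real ^ 'p \<Rightarrow> real" where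
  "cond_beta X y \<omega> =
     (let \<Sigma> = matrix_inv (transpose X ** diag_matrix \<omega> ** X);
          \<kappa> = (\<chi> i. real (y $ i) - 1 / 2)
      in mvn_density (\<Sigma> *v (transpose X *v \<kappa>)) \<Sigma>)"

text \<open>Argument order: \<open>PG_trans_density X y \<omega>' \<omega>\<close> is \<open>k(\<omega> | \<omega>')\<close>, the density at \<open>\<omega>\<close> of
  a step from \<open>\<omega>'\<close>.\<close>

definition PG_trans_density ::
    "real ^ 'p ^ 'n \<Rightarrow> nat ^ 'n \<Rightarrow> real ^ 'n \<Rightarrow> real ^ 'n \<Rightarrow> ennreal" where
  "PG_trans_density X y \<omega>' \<omega> =
     (\<integral>\<^sup>+ \<beta>. ennreal (cond_omega X \<beta> \<omega> * cond_beta X y \<omega>' \<beta>) \<partial>lborel)"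

definition PG_kernel ::
    "real ^ 'p ^ 'n \<Rightarrow> nat ^ 'n \<Rightarrow> real ^ 'n \<Rightarrow> (real ^ 'n) measure" where
  "PG_kernel X y \<omega>' = density (restrict_space lborel pos_orthant) (PG_trans_density X y \<omega>')"

primrec kernel_pow :: "('a \<Rightarrow> 'a measure) \<Rightarrow> nat \<Rightarrow> 'a \<Rightarrow> 'a set \<Rightarrow> ennreal" where
  "kernel_pow K 0 x A = indicator A x"
| "kernel_pow K (Suc m) x A = (\<integral>\<^sup>+ z. kernel_pow K m z A \<partial>K x)"

definition joint_posterior_density ::
    "real ^ 'p ^ 'n \<Rightarrow> nat ^ 'n \<Rightarrow> real ^ 'p \<Rightarrow> real ^ 'n \<Rightarrow> ennreal" where
  "joint_posterior_density X y \<beta> \<omega> =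
     ennreal (logit_likelihood X y \<beta> * cond_omega X \<beta> \<omega>) / norm_const X y"

definition omega_posterior :: "real ^ 'p ^ 'n \<Rightarrow> nat ^ 'n \<Rightarrow> (real ^ 'n) measure" where
  "omega_posterior X y =
     density (restrict_space lborel pos_orthant)
       (\<lambda>\<omega>. \<integral>\<^sup>+ \<beta>. joint_posterior_density X y \<beta> \<omega> \<partial>lborel)"

end

theory Submission
  imports Defs "HOL-Real_Asymp.Real_Asymp"
begin

text \<open>
  The function \<open>V \<omega> = (\<Sum>i. 1 / \<omega>\<^sub>i)\<close> is a drift function. Under \<open>PG(1, b)\<close> the mean of \<open>1 / \<omega>\<close> is at most
  \<open>2 b + 10\<close>, so one step from \<open>\<omega>'\<close> gives at most a constant plus the conditional mean of
  \<open>2 (\<Sum>i. \<bar>x\<^sub>i \<bullet> \<beta>\<bar>)\<close>. The conditional mean vector \<open>\<mu>\<close> of \<open>\<beta>\<close> satisfies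
  \<open>(\<Sum>i. \<omega>'\<^sub>i (x\<^sub>i \<bullet> \<mu>)\<^sup>2) = (\<Sum>i. \<kappa>\<^sub>i (x\<^sub>i \<bullet> \<mu>))\<close>; as a proper posterior excludes separation of the data, the
  right-hand side is at most \<open>(1/2 - \<delta>) (\<Sum>i. \<bar>x\<^sub>i \<bullet> \<mu>\<bar>)\<close>, and Cauchy--Schwarz yields
  \<open>2 (\<Sum>i. \<bar>x\<^sub>i \<bullet> \<mu>\<bar>) \<le> (1 - 2 \<delta>) V \<omega>'\<close>. On \<open>{V \<le> R}\<close> the vector \<open>\<beta>\<close> stays in a bounded set with
  probability at least \<open>1/2\<close>, on which the Polya-Gamma densities are bounded below by a multiple
  of \<open>PG(1, r)\<close>; this is a minorization. Drift and minorization give a contraction of a weighted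
  oscillation seminorm, as in the proof of Harris' theorem by Hairer and Mattingly.

  The Polya-Gamma series is nonnegative because it is a multiple of
  \<open>(\<Sum>j. (-1)\<^sup>j (2 j + 1) x\<^bsup>j(j+1)/2\<^esup>) = (\<Prod>k\<ge>1. (1 - x\<^sup>k)\<^sup>3)\<close> at \<open>x = exp (- 1 / \<omega>)\<close>; its terms are
  inverse Gaussian densities, which makes its Laplace transform a geometric series.
\<close>

text \<open>The kernels are built with \<open>ennreal\<close> coercions, which send negative reals
  to 0, so no integral of \<open>PG_density\<close> can be evaluated before its sign is known.
  Positivity is invisible termwise, hence the detour through Jacobi's identity. The sign is needed
  again at \<open>b = 0\<close>: the Laplace series converges absolutely for \<open>b > 0\<close>
  only, and the limit is reached by monotone convergence.

  One Laplace transform suffices because \<open>PG(1, b)\<close> is the tilt of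
  \<open>PG(1, 0)\<close> by \<open>cosh (b / 2) * exp (- b^2 w / 2)\<close>. The transform
  normalises the density, and it gives the mean of \<open>1 / w\<close> once
  \<open>exp (- b^2 w / 2) / w\<close> is written as an integral over larger tilts.

  The drift is tight: bounding each \<open>\<kappa>_i\<close> by 1/2 alone would give the ratio 1
  exactly. The margin supplies \<open>2 \<delta>\<close>; one \<open>\<delta>\<close> pays for the
  Gaussian spread of \<beta> around its mean, the other is the contraction. The margin itself comes
  from compactness of the unit sphere, applied to the positive parts of the signed linear
  predictors.\<close>

section \<open>Nonnegativity of an alternating theta series\<close>

text \<open>\<open>qcoeff x m k\<close> is the signed Gaussian binomial \<open>(-1)\<^sup>k x\<^bsup>k(k-1)/2\<^esup> [m choose k]\<^sub>x\<close>.\<close>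

fun qcoeff :: "real \<Rightarrow> nat \<Rightarrow> nat \<Rightarrow> real" where
  "qcoeff x 0 k = (if k = 0 then 1 else 0)"
| "qcoeff x (Suc m) 0 = 1"
| "qcoeff x (Suc m) (Suc k) = qcoeff x m (Suc k) - x ^ m * qcoeff x m k"

lemma qcoeff_eq_0: "m < k \<Longrightarrow> qcoeff x m k = 0"
  by (induction x m k rule: qcoeff.induct) auto

lemma qcoeff_0 [simp]: "qcoeff x m 0 = 1"
  by (cases m) auto

lemma prod_eq_qcoeff_sum:
  "(\<Prod>k<m. 1 - z * x ^ k) = (\<Sum>k\<le>m. qcoeff x m k * z ^ k)"
proof (induction m)
  case (Suc m)
  have "(\<Prod>k<Suc m. 1 - z * x ^ k) = (\<Sum>k\<le>m. qcoeff x m k * z ^ k) * (1 - z * x ^ m)"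
    using Suc by simp
  also have "\<dots> = (\<Sum>k\<le>Suc m. qcoeff x m k * z ^ k) - (\<Sum>k\<le>m. x ^ m * qcoeff x m k * z ^ Suc k)"
    by (simp add: qcoeff_eq_0 right_diff_distrib sum_distrib_right) (simp add: mult_ac)
  also have "\<dots> = (\<Sum>k\<le>Suc m. qcoeff x (Suc m) k * z ^ k)"
    unfolding sum.atMost_Suc_shift
    by (simp only: qcoeff.simps left_diff_distrib sum_subtractf) simp
  finally show ?case .
qed simp

text \<open>This recurrence in the column \<open>k\<close> is the ratio of neighbouring q-binomial
  coefficients with denominators cleared. In that form it is a polynomial identity, valid for every
  \<open>x\<close>, and follows from the row recurrence by induction on \<open>m\<close>.\<close>

lemma qcoeff_Suc:
  "(1 - x ^ Suc k) * qcoeff x m (Suc k) = - (x ^ k - x ^ m) * qcoeff x m k"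
proof (induction m arbitrary: k)
  case 0
  then show ?case by (cases k) auto
next
  case (Suc m)
  show ?case
  proof (cases k)
    case 0
    have "(1 - x) * qcoeff x m (Suc 0) = - (1 - x ^ m)"
      using Suc[of 0] by simp
    then show ?thesis
      using 0 by (simp add: algebra_simps)
  next
    case (Suc j)
    have IH1: "(1 - x ^ Suc k) * qcoeff x m (Suc k) = - (x ^ k - x ^ m) * qcoeff x m k"
      by (rule Suc.IH)
    have IH2: "(1 - x ^ k) * qcoeff x m k = - (x ^ j - x ^ m) * qcoeff x m j"
      using Suc.IH[of j] Suc by simp
    have "(1 - x ^ Suc k) * qcoeff x (Suc m) (Suc k)
        = (1 - x ^ Suc k) * qcoeff x m (Suc k) - x ^ m * (1 - x ^ Suc k) * qcoeff x m k"
      by (simp add: algebra_simps)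
    also have "\<dots> = - (x ^ k - x ^ Suc m * x ^ k) * qcoeff x m k"
      unfolding IH1 by (simp add: algebra_simps)
    \<comment> \<open>The bracket is split as
      \<open>x^k - x^(m+1) x^k = (x^k - x^(m+1)) + x^(m+1) (1 - x^k)\<close>: the first part is the
      target factor, and \<open>1 - x^k\<close> is where IH2 applies.\<close>
    also have "\<dots> = - (x ^ k - x ^ Suc m) * qcoeff x m k + x ^ Suc m * (1 - x ^ k) * (- 1) * qcoeff x m k"
      by (simp add: algebra_simps)
    also have "\<dots> = - (x ^ k - x ^ Suc m) * qcoeff x m k + x ^ Suc m * (- 1) * ((1 - x ^ k) * qcoeff x m k)"
      by (simp add: algebra_simps)
    also have "\<dots> = - (x ^ k - x ^ Suc m) * qcoeff x m k + x ^ Suc m * (x ^ j - x ^ m) * qcoeff x m j"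
      unfolding IH2 by (simp add: algebra_simps)
    also have "\<dots> = - (x ^ k - x ^ Suc m) * qcoeff x (Suc m) k"
      using Suc by (simp add: algebra_simps)
    finally show ?thesis .
  qed
qed


lemma qcoeff_sign:
  assumes x: "0 < x" "x < 1" and k: "k \<le> m"
  shows "0 < (- 1) ^ k * qcoeff x m k"
  using k
proof (induction k)
  case (Suc k)
  have "(1 - x ^ Suc k) * ((- 1) ^ Suc k * qcoeff x m (Suc k))
      = (- 1) ^ Suc k * ((1 - x ^ Suc k) * qcoeff x m (Suc k))"
    by (simp only: mult_ac)
  also have "\<dots> = (x ^ k - x ^ m) * ((- 1) ^ k * qcoeff x m k)"
    unfolding qcoeff_Suc by (simp add: algebra_simps)
  finally have "(1 - x ^ Suc k) * ((- 1) ^ Suc k * qcoeff x m (Suc k)) = (x ^ k - x ^ m) * ((- 1) ^ k * qcoeff x m k)" .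
  moreover have "0 < (x ^ k - x ^ m) * ((- 1) ^ k * qcoeff x m k)"
    using Suc x power_strict_decreasing[of k m x] by (intro mult_pos_pos[OF _ Suc.IH]) auto
  moreover have "0 < 1 - x ^ Suc k"
    using x power_strict_decreasing[of 0 "Suc k" x] by simp
  ultimately show ?case
    by (metis zero_less_mult_pos)
qed simp

text \<open>The quotient of the Gaussian binomials \<open>[2N choose N+j]\<close> and
  \<open>[2N choose N]\<close>. Beyond \<open>j = N\<close> natural subtraction yields a factor
  \<open>1 - x^0 = 0\<close>, so the bounds hold for all \<open>j\<close>; being at most 1 and
  tending to 1, it disappears in the dominated limit over \<open>N\<close>.\<close>

definition qratio :: "real \<Rightarrow> nat \<Rightarrow> nat \<Rightarrow> real" where
  "qratio x N j = (\<Prod>i<j. (1 - x ^ (N - i)) / (1 - x ^ (N + i + 1)))"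

lemma qratio_bounds:
  assumes x: "0 < x" "x < 1"
  shows "0 \<le> qratio x N j" "qratio x N j \<le> 1"
proof -
  have *: "0 \<le> (1 - x ^ (N - i)) / (1 - x ^ (N + i + 1)) \<and> (1 - x ^ (N - i)) / (1 - x ^ (N + i + 1)) \<le> 1" for i
  proof -
    have "x ^ (N - i) \<le> 1"
      using x by (intro power_le_one) auto
    moreover have "x ^ (N + i + 1) < 1"
      using x power_strict_decreasing[of 0 "N + i + 1" x] by simp
    moreover have "x ^ (N + i + 1) \<le> x ^ (N - i)"
      using x by (intro power_decreasing) auto
    ultimately show ?thesis by simp
  qed
  show "0 \<le> qratio x N j"
    unfolding qratio_def using * by (intro prod_nonneg) auto
  show "qratio x N j \<le> 1"
    unfolding qratio_def using * by (intro prod_le_1) auto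
qed

lemma qratio_tendsto:
  assumes x: "0 < x" "x < 1"
  shows "(\<lambda>N. qratio x N j) \<longlonglongrightarrow> 1"
proof -
  have x0: "(\<lambda>n. x ^ n) \<longlonglongrightarrow> 0"
    using x by (intro LIMSEQ_power_zero) auto
  have "(\<lambda>N. (1 - x ^ (N - i)) / (1 - x ^ (N + i + 1))) \<longlonglongrightarrow> (1 - 0) / (1 - 0)" for i
  proof (intro tendsto_divide tendsto_diff tendsto_const)
    show "(\<lambda>N. x ^ (N - i)) \<longlonglongrightarrow> 0"
      by (rule LIMSEQ_offset[of _ i]) (use x0 in simp)
    show "(\<lambda>N. x ^ (N + i + 1)) \<longlonglongrightarrow> 0"
      using LIMSEQ_ignore_initial_segment[OF x0, of "i + 1"] by (simp add: add.assoc)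
  qed auto
  then have "(\<lambda>N. qratio x N j) \<longlonglongrightarrow> (\<Prod>i<j. (1 - 0) / (1 - 0))"
    unfolding qratio_def by (intro tendsto_prod)
  then show ?thesis by simp
qed

text \<open>The recurrence \<open>qcoeff_Suc\<close> iterated upwards from the centre, with the
  weight that the root \<open>z = x^-N\<close> attaches. The extra \<open>x ^ j\<close> only makes
  the right-hand side equal to that of \<open>qcoeff_below\<close>: the true exponent above the
  centre is \<open>triangle (j - 1)\<close>, below it \<open>triangle j\<close>.\<close>

lemma qcoeff_above:
  assumes x: "0 < x" "x < 1" and j: "j \<le> N"
  shows "x ^ j * (qcoeff x (2 * N) (N + j) / x ^ (N * j))
    = (- 1) ^ j * x ^ triangle j * qratio x N j * qcoeff x (2 * N) N"
  using j
proof (induction j)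
  case 0
  then show ?case by (simp add: qratio_def)
next
  case (Suc j)
  define q where "q = qcoeff x (2 * N) (N + j)"
  define p where "p = qcoeff x (2 * N) (Suc (N + j))"
  have d: "1 - x ^ (N + j + 1) \<noteq> 0"
    using x power_strict_decreasing[of 0 "N + j + 1" x] by simp
  have "x ^ (2 * N) = x ^ (N + j) * x ^ (N - j)"
    using Suc.prems by (simp add: mult_2 flip: power_add)
  then have "(1 - x ^ (N + j + 1)) * p = - (x ^ (N + j) * (1 - x ^ (N - j))) * q"
    using qcoeff_Suc[of x "N + j" "2 * N"] by (simp add: p_def q_def algebra_simps)
  then have p: "p = - (x ^ (N + j) * ((1 - x ^ (N - j)) / (1 - x ^ (N + j + 1)))) * q"
    using d by (simp add: field_simps)
  have IH: "x ^ j * (q / x ^ (N * j)) = (- 1) ^ j * x ^ triangle j * qratio x N j * qcoeff x (2 * N) N"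
    using Suc by (simp add: q_def)
  have "x ^ Suc j * (p / x ^ (N * Suc j))
      = - (x ^ Suc j * ((1 - x ^ (N - j)) / (1 - x ^ (N + j + 1)))) * (x ^ j * (q / x ^ (N * j)))"
    unfolding p using x by (simp add: power_add)
  also have "\<dots> = (- 1) ^ Suc j * x ^ triangle (Suc j) * qratio x N (Suc j) * qcoeff x (2 * N) N"
    unfolding IH by (simp add: qratio_def triangle_Suc power_add)
  finally show ?case by (simp add: p_def)
qed

lemma qcoeff_below:
  assumes x: "0 < x" "x < 1" and j: "j \<le> N"
  shows "qcoeff x (2 * N) (N - j) * x ^ (N * j)
    = (- 1) ^ j * x ^ triangle j * qratio x N j * qcoeff x (2 * N) N"
  using j
proof (induction j)
  case 0
  then show ?case by (simp add: qratio_def)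
next
  case (Suc j)
  define q where "q = qcoeff x (2 * N) (N - j)"
  define p where "p = qcoeff x (2 * N) (N - Suc j)"
  have S: "Suc (N - Suc j) = N - j"
    using Suc.prems by simp
  have d: "1 - x ^ (N + j + 1) \<noteq> 0"
    using x power_strict_decreasing[of 0 "N + j + 1" x] by simp
  have "x ^ (2 * N) = x ^ (N - Suc j) * x ^ (N + j + 1)"
    using Suc.prems by (simp add: mult_2 flip: power_add power_Suc)
  then have "(1 - x ^ (N - j)) * q = - (x ^ (N - Suc j) * (1 - x ^ (N + j + 1))) * p"
    using qcoeff_Suc[of x "N - Suc j" "2 * N"] unfolding S by (simp add: p_def q_def algebra_simps)
  then have p: "p * x ^ (N - Suc j) = - ((1 - x ^ (N - j)) / (1 - x ^ (N + j + 1))) * q"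
    using d by (simp add: field_simps)
  have IH: "q * x ^ (N * j) = (- 1) ^ j * x ^ triangle j * qratio x N j * qcoeff x (2 * N) N"
    using Suc by (simp add: q_def)
  have "x ^ (N * Suc j) = x ^ (N - Suc j) * x ^ Suc j * x ^ (N * j)"
    using Suc.prems by (simp flip: power_add power_Suc)
  then have "p * x ^ (N * Suc j) = (p * x ^ (N - Suc j)) * x ^ Suc j * x ^ (N * j)"
    by simp
  also have "\<dots> = - ((1 - x ^ (N - j)) / (1 - x ^ (N + j + 1))) * x ^ Suc j * (q * x ^ (N * j))"
    unfolding p by simp
  also have "\<dots> = (- 1) ^ Suc j * x ^ triangle (Suc j) * qratio x N (Suc j) * qcoeff x (2 * N) N"
    unfolding IH by (simp add: qratio_def triangle_Suc power_add)
  finally show ?case by (simp add: p_def)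
qed

text \<open>The weight \<open>k - N\<close> is odd about the centre, so the terms at
  \<open>N - j\<close> and \<open>N + j\<close> pair up with opposite signs; their exponents are
  neighbouring triangular numbers, which produces the difference of powers. The centre itself
  contributes 0.\<close>

lemma sum_qcoeff_centered:
  assumes x: "0 < x" "x < 1"
  shows "(\<Sum>k\<le>2 * N. (real k - real N) * qcoeff x (2 * N) k / x ^ (N * k))
    = (\<Sum>i<N. (- 1) ^ Suc i * real (Suc i) * qratio x N (Suc i) * (x ^ triangle i - x ^ triangle (Suc i)))
      * qcoeff x (2 * N) N / x ^ (N * N)"
proof -
  let ?f = "\<lambda>k. (real k - real N) * qcoeff x (2 * N) k / x ^ (N * k)"
  have "{..2 * N} = {..N} \<union> {Suc N..2 * N}"
    by auto
  then have "sum ?f {..2 * N} = sum ?f {..N} + sum ?f {Suc N..2 * N}"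
    by (simp add: sum.union_disjoint)
  also have "sum ?f {..N} = sum ?f {..<N}"
    by (rule sum.mono_neutral_right) (auto simp: not_less)
  also have "sum ?f {..<N} = (\<Sum>i<N. ?f (N - Suc i))"
    by (rule sum.nat_diff_reindex[symmetric])
  also have "sum ?f {Suc N..2 * N} = (\<Sum>i<N. ?f (N + Suc i))"
    by (rule sum.reindex_bij_witness[of _ "\<lambda>i. N + Suc i" "\<lambda>k. k - Suc N"]) auto
  also have "(\<Sum>i<N. ?f (N - Suc i)) + (\<Sum>i<N. ?f (N + Suc i)) = (\<Sum>i<N. ?f (N - Suc i) + ?f (N + Suc i))"
    by (simp add: sum.distrib)
  also have "\<dots> = (\<Sum>i<N. (- 1) ^ Suc i * real (Suc i) * qratio x N (Suc i) *
      (x ^ triangle i - x ^ triangle (Suc i)) * (qcoeff x (2 * N) N / x ^ (N * N)))"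
  proof (rule sum.cong)
    fix i assume "i \<in> {..<N}"
    then have i: "Suc i \<le> N" by simp
    let ?c = "(- 1) ^ Suc i * qratio x N (Suc i) * qcoeff x (2 * N) N"
    have "N * N = N * (N - Suc i) + N * Suc i"
      using i by (metis distrib_left le_add_diff_inverse2)
    then have e1: "x ^ (N * N) = x ^ (N * (N - Suc i)) * x ^ (N * Suc i)"
      by (metis power_add)
    have e2: "x ^ (N * (N + Suc i)) = x ^ (N * N) * x ^ (N * Suc i)"
      by (simp only: distrib_left power_add)
    have "?f (N - Suc i) = - real (Suc i) * (qcoeff x (2 * N) (N - Suc i) * x ^ (N * Suc i)) / x ^ (N * N)"
      unfolding e1 using i x by (simp add: of_nat_diff)
    also have "\<dots> = - real (Suc i) * (x ^ triangle (Suc i) * ?c) / x ^ (N * N)"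
      unfolding qcoeff_below[OF x i] by (simp only: mult_ac)
    finally have f1: "?f (N - Suc i) = - real (Suc i) * (x ^ triangle (Suc i) * ?c) / x ^ (N * N)" .
    have "x ^ Suc i * (qcoeff x (2 * N) (N + Suc i) / x ^ (N * Suc i)) = x ^ Suc i * (x ^ triangle i * ?c)"
      unfolding qcoeff_above[OF x i] by (simp only: triangle_Suc power_add mult_ac)
    then have "qcoeff x (2 * N) (N + Suc i) / x ^ (N * Suc i) = x ^ triangle i * ?c"
      using x by (subst (asm) mult_cancel_left) simp
    moreover have "?f (N + Suc i) = real (Suc i) * (qcoeff x (2 * N) (N + Suc i) / x ^ (N * Suc i)) / x ^ (N * N)"
      unfolding e2 by (simp add: mult.commute)
    ultimately have f2: "?f (N + Suc i) = real (Suc i) * (x ^ triangle i * ?c) / x ^ (N * N)"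
      by simp
    show "?f (N - Suc i) + ?f (N + Suc i) = (- 1) ^ Suc i * real (Suc i) * qratio x N (Suc i) *
        (x ^ triangle i - x ^ triangle (Suc i)) * (qcoeff x (2 * N) N / x ^ (N * N))"
      unfolding f1 f2 by (simp only: ring_distribs diff_divide_distrib times_divide_eq_right mult_ac)
  qed simp
  finally show ?thesis
    by (simp only: sum_distrib_right sum_divide_distrib times_divide_eq_right)
qed


text \<open>Both sides are \<open>z P'(z)\<close> at a root of the product \<open>P\<close>: in the
  product only the vanishing factor is differentiated, in the sum each power contributes its
  exponent. Since \<open>P z = 0\<close>, subtracting a constant \<open>a\<close> from the exponents
  is free; \<open>a = N\<close> will centre the sum.\<close>

lemma sum_deriv_prod_root:
  fixes x :: real and c :: "nat \<Rightarrow> real"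
  assumes P: "\<And>z. (\<Prod>k<m. 1 - z * x ^ k) = (\<Sum>k\<le>m. c k * z ^ k)"
    and N: "N < m" and z: "z * x ^ N = 1"
  shows "(\<Sum>k\<le>m. (real k - a) * c k * z ^ k) = - (\<Prod>k\<in>{..<m} - {N}. 1 - z * x ^ k)"
proof -
  let ?P = "\<lambda>z. \<Prod>k<m. 1 - z * x ^ k"
  let ?Q = "\<lambda>z. \<Prod>k\<in>{..<m} - {N}. 1 - z * x ^ k"
  have PQ: "?P w = (1 - w * x ^ N) * ?Q w" for w
    using N by (intro prod.remove) auto
  have P0: "(\<Sum>k\<le>m. c k * z ^ k) = 0"
    unfolding P[symmetric] PQ using z by simp
  \<comment> \<open>Because \<open>1 - z * x ^ N = 0\<close>, the difference quotient at
    \<open>z\<close> is exactly \<open>- (x ^ N) * ?Q w\<close>, so Caratheodory's criterion asks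
    only for continuity of \<open>?Q\<close>.\<close>
  have "(?P has_real_derivative - (x ^ N) * ?Q z) (at z)"
    unfolding CARAT_DERIV
  proof (intro exI conjI allI)
    show "?P w - ?P z = (- (x ^ N) * ?Q w) * (w - z)" for w
      unfolding PQ using z by (simp add: algebra_simps)
  qed (auto intro!: continuous_intros)
  moreover have "(?P has_real_derivative (\<Sum>k\<le>m. c k * (real k * z ^ (k - 1)))) (at z)"
    unfolding P by (auto intro!: derivative_eq_intros sum.cong)
  ultimately have "- (x ^ N) * ?Q z = (\<Sum>k\<le>m. c k * (real k * z ^ (k - 1)))"
    by (rule DERIV_unique)
  then have "z * (- (x ^ N) * ?Q z) = z * (\<Sum>k\<le>m. c k * (real k * z ^ (k - 1)))"
    by simp
  moreover have "z * (\<Sum>k\<le>m. c k * (real k * z ^ (k - 1))) = (\<Sum>k\<le>m. real k * c k * z ^ k)"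
    unfolding sum_distrib_left
  proof (rule sum.cong)
    fix k show "z * (c k * (real k * z ^ (k - 1))) = real k * c k * z ^ k"
      by (cases k) auto
  qed simp
  moreover have "z * (- (x ^ N) * ?Q z) = - ?Q z"
    using z by (simp add: mult.assoc[symmetric])
  ultimately have "(\<Sum>k\<le>m. real k * c k * z ^ k) = - ?Q z"
    by simp
  moreover have "(\<Sum>k\<le>m. (real k - a) * c k * z ^ k) = (\<Sum>k\<le>m. real k * c k * z ^ k) - a * (\<Sum>k\<le>m. c k * z ^ k)"
    by (simp only: left_diff_distrib sum_subtractf sum_distrib_left mult.assoc)
  ultimately show ?thesis
    using P0 by simp
qed

text \<open>A finite form of Jacobi's identity for the cube of the Euler product: the derivative of the
  \<open>q\<close>-binomial theorem with \<open>m = 2 N\<close> at the root \<open>z = x\<^sup>-\<^sup>N\<close> is a sum on one side and a product of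
  known sign on the other.\<close>

lemma finite_theta_nonneg:
  assumes x: "0 < x" "x < 1"
  shows "0 \<le> (\<Sum>i<N. (- 1) ^ i * real (Suc i) * qratio x N (Suc i) * (x ^ triangle i - x ^ triangle (Suc i)))"
    (is "0 \<le> ?T")
proof (cases "N = 0")
  case False
  define z where "z = 1 / x ^ N"
  have z: "z * x ^ N = 1"
    using x by (simp add: z_def)
  let ?c = "qcoeff x (2 * N) N"
  let ?A = "\<Prod>k<N. 1 - z * x ^ k" and ?B = "\<Prod>k\<in>{N<..<2 * N}. 1 - z * x ^ k"
  have zk: "z ^ k = 1 / x ^ (N * k)" for k
    by (simp add: z_def power_one_over power_mult)
  have "(\<Sum>k\<le>2 * N. (real k - real N) * qcoeff x (2 * N) k * z ^ k)
      = - (\<Prod>k\<in>{..<2 * N} - {N}. 1 - z * x ^ k)"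
    using False z by (intro sum_deriv_prod_root prod_eq_qcoeff_sum) auto
  also have "{..<2 * N} - {N} = {..<N} \<union> {N<..<2 * N}"
    using False by auto
  also have "(\<Prod>k\<in>{..<N} \<union> {N<..<2 * N}. 1 - z * x ^ k) = ?A * ?B"
    by (intro prod.union_disjoint) auto
  finally have "(\<Sum>k\<le>2 * N. (real k - real N) * qcoeff x (2 * N) k / x ^ (N * k)) = - (?A * ?B)"
    by (simp add: zk)
  then have "- (\<Sum>i<N. (- 1) ^ i * real (Suc i) * qratio x N (Suc i) * (x ^ triangle i - x ^ triangle (Suc i))) * ?c / x ^ (N * N) = - (?A * ?B)"
    unfolding sum_qcoeff_centered[OF x] by (simp add: sum_negf)
  then have "?T * ?c / x ^ (N * N) = ?A * ?B"
    by simp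
  then have eq: "?T * ((- 1) ^ N * ?c) = x ^ (N * N) * (((- 1) ^ N * ?A) * ?B)"
    using x by (simp add: field_simps)
  \<comment> \<open>Each of the \<open>N\<close> factors left of the root is at most 0; their common
    sign cancels against that of \<open>?c\<close>, and the factors right of the root are
    nonnegative.\<close>
  have "(- 1) ^ N * ?A = (\<Prod>k<N. z * x ^ k - 1)"
    using prod_uminus[of "\<lambda>k. 1 - z * x ^ k" "{..<N}"] by simp
  also have "0 \<le> \<dots>"
  proof (rule prod_nonneg)
    fix k assume "k \<in> {..<N}"
    then have "x ^ N \<le> x ^ k"
      using x by (intro power_decreasing) auto
    then show "0 \<le> z * x ^ k - 1"
      using x by (simp add: z_def)
  qed
  finally have A: "0 \<le> (- 1) ^ N * ?A" .
  have B: "0 \<le> ?B"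
  proof (rule prod_nonneg)
    fix k assume "k \<in> {N<..<2 * N}"
    then have "x ^ k \<le> x ^ N"
      using x by (intro power_decreasing) auto
    then show "0 \<le> 1 - z * x ^ k"
      using x by (simp add: z_def)
  qed
  have "0 \<le> ?T * ((- 1) ^ N * ?c)"
    unfolding eq by (rule mult_nonneg_nonneg[OF _ mult_nonneg_nonneg[OF A B]]) (use x in simp)
  then show ?thesis
    using qcoeff_sign[OF x, of N "2 * N"] by (simp add: zero_le_mult_iff)
qed simp

section \<open>Passage to the infinite theta series\<close>

lemma triangle_ge: "n \<le> triangle n"
  by (induction n) auto

lemma summable_Suc_power_triangle:
  assumes x: "0 < x" "x < (1::real)"
  shows "summable (\<lambda>i. real (Suc i) * x ^ triangle i)"
proof (rule summable_comparison_test')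
  show "summable (\<lambda>i. real (Suc i) * x ^ i)"
    using x geometric_deriv_sums[of x] by (auto simp: sums_iff mult.commute)
  show "norm (real (Suc i) * x ^ triangle i) \<le> real (Suc i) * x ^ i" if "0 \<le> i" for i
    using x power_decreasing[OF triangle_ge[of i], of x] by (simp add: abs_mult)
qed

text \<open>Tannery's theorem takes \<open>N\<close> to infinity in
  \<open>finite_theta_nonneg\<close>, dominated by \<open>(i + 1) x^triangle i\<close>; the limit is
  the claimed series before summation by parts.\<close>

lemma theta_series_nonneg:
  assumes x: "0 < x" "x < 1"
  shows "0 \<le> (\<Sum>i. (- 1) ^ i * real (2 * i + 1) * x ^ triangle i)"
proof -
  let ?b = "\<lambda>i. (- 1) ^ i * real (Suc i) * (x ^ triangle i - x ^ triangle (Suc i))"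
  let ?f = "\<lambda>i N. if i < N then ?b i * qratio x N (Suc i) else 0"
  have s1: "summable (\<lambda>i. (- 1) ^ i * real (Suc i) * x ^ triangle i)"
    by (rule summable_norm_cancel) (use summable_Suc_power_triangle[OF x] x in \<open>simp add: abs_mult\<close>)
  have s2: "summable (\<lambda>i. (- 1) ^ i * real i * x ^ triangle i)"
  proof (rule summable_comparison_test')
    show "norm ((- 1) ^ i * real i * x ^ triangle i) \<le> real (Suc i) * x ^ triangle i" if "0 \<le> i" for i
      using x by (simp add: abs_mult)
  qed (rule summable_Suc_power_triangle[OF x])
  have "((\<lambda>N. suminf (\<lambda>i. ?f i N)) \<longlongrightarrow> suminf ?b) sequentially"
  proof (rule tannerys_theorem[THEN conjunct2, THEN conjunct2])
    show "((\<lambda>N. ?f i N) \<longlongrightarrow> ?b i) sequentially" for i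
    proof -
      have "(\<lambda>N. ?b i * qratio x N (Suc i)) \<longlonglongrightarrow> ?b i * 1"
        by (intro tendsto_mult tendsto_const qratio_tendsto x)
      moreover have "eventually (\<lambda>N. ?b i * qratio x N (Suc i) = ?f i N) sequentially"
        using eventually_gt_at_top[of i] by eventually_elim simp
      ultimately show ?thesis
        using Lim_transform_eventually by fastforce
    qed
    show "eventually (\<lambda>(i, N). norm (?f i N) \<le> real (Suc i) * x ^ triangle i) (at_top \<times>\<^sub>F sequentially)"
    proof (rule always_eventually, clarify)
      fix i N
      have "x ^ triangle (Suc i) \<le> x ^ triangle i"
        using x by (intro power_decreasing) auto
      then have "\<bar>x ^ triangle i - x ^ triangle (Suc i)\<bar> \<le> x ^ triangle i"
        using x by (auto simp: abs_le_iff)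
      then have "\<bar>x ^ triangle i - x ^ triangle (Suc i)\<bar> * \<bar>qratio x N (Suc i)\<bar> \<le> x ^ triangle i * 1"
        using qratio_bounds[OF x] x by (intro mult_mono) auto
      then have "real (Suc i) * (\<bar>x ^ triangle i - x ^ triangle (Suc i)\<bar> * \<bar>qratio x N (Suc i)\<bar>)
          \<le> real (Suc i) * x ^ triangle i"
        by (intro mult_left_mono) auto
      then show "norm (?f i N) \<le> real (Suc i) * x ^ triangle i"
        using x by (simp add: abs_mult mult.assoc)
    qed
  qed (use summable_Suc_power_triangle[OF x] in auto)
  moreover have "0 \<le> suminf (\<lambda>i. ?f i N)" for N
  proof -
    have "suminf (\<lambda>i. ?f i N) = (\<Sum>i<N. ?f i N)"
      by (rule suminf_finite) auto
    also have "\<dots> = (\<Sum>i<N. (- 1) ^ i * real (Suc i) * qratio x N (Suc i) * (x ^ triangle i - x ^ triangle (Suc i)))"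
      by (intro sum.cong) auto
    finally show ?thesis
      using finite_theta_nonneg[OF x, of N] by simp
  qed
  ultimately have "0 \<le> suminf ?b"
    by (intro tendsto_lowerbound[of _ _ sequentially]) auto
  \<comment> \<open>The subtracted powers form the series \<open>(-1)^i i x^triangle i\<close> with
    its zero first term dropped; adding the coefficients \<open>i + 1\<close> and \<open>i\<close>
    gives \<open>2 i + 1\<close>.\<close>
  also have "suminf ?b = (\<Sum>i. (- 1) ^ i * real (Suc i) * x ^ triangle i + (- 1) ^ Suc i * real (Suc i) * x ^ triangle (Suc i))"
    by (simp only: right_diff_distrib power_Suc) simp
  also have "\<dots> = (\<Sum>i. (- 1) ^ i * real (Suc i) * x ^ triangle i) + (\<Sum>i. (- 1) ^ Suc i * real (Suc i) * x ^ triangle (Suc i))"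
    by (rule suminf_add[symmetric, OF s1]) (use s2 in \<open>subst summable_Suc_iff[where f="\<lambda>i. (- 1) ^ i * real i * x ^ triangle i"]\<close>)
  also have "(\<Sum>i. (- 1) ^ Suc i * real (Suc i) * x ^ triangle (Suc i)) = (\<Sum>i. (- 1) ^ i * real i * x ^ triangle i)"
    using suminf_split_head[OF s2] by simp
  also have "(\<Sum>i. (- 1) ^ i * real (Suc i) * x ^ triangle i) + (\<Sum>i. (- 1) ^ i * real i * x ^ triangle i)
      = (\<Sum>i. (- 1) ^ i * real (2 * i + 1) * x ^ triangle i)"
    unfolding suminf_add[OF s1 s2] by (intro arg_cong[where f=suminf] ext) (simp add: algebra_simps)
  finally show ?thesis .
qed

section \<open>Moments of the Polya-Gamma distribution\<close>

definition Phi :: "real \<Rightarrow> real" where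
  "Phi t = measure std_normal_distribution {..t}"

lemma Phi_limits: "(Phi \<longlongrightarrow> 1) at_top" "(Phi \<longlongrightarrow> 0) at_bot"
proof -
  interpret real_distribution std_normal_distribution
    by (rule real_dist_normal_dist)
  have "Phi = cdf std_normal_distribution"
    by (simp add: fun_eq_iff Phi_def cdf_def)
  then show "(Phi \<longlongrightarrow> 1) at_top" "(Phi \<longlongrightarrow> 0) at_bot"
    using cdf_lim_at_top_prob cdf_lim_at_bot by simp_all
qed

lemma Phi_deriv: "(Phi has_real_derivative std_normal_density t) (at t)"
proof -
  interpret real_distribution std_normal_distribution
    by (rule real_dist_normal_dist)
  \<comment> \<open>The fundamental theorem is applied on a bounded interval; starting it at
    \<open>t - 1\<close> puts \<open>t\<close> in the interior, which makes the derivative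
    two-sided.\<close>
  have Phi_eq: "Phi u = Phi (t - 1) + integral {t - 1..u} std_normal_density" if "t - 1 \<le> u" for u
  proof -
    have "Phi u = Phi (t - 1) + measure std_normal_distribution {t - 1<..u}"
      unfolding Phi_def using that
      by (subst finite_measure_Union[symmetric]) (auto intro!: arg_cong[where f="measure _"])
    also have "measure std_normal_distribution {t - 1<..u} = (LINT x:{t - 1<..u}|lborel. std_normal_density x)"
      by (subst measure_def, subst emeasure_density)
        (auto simp: set_lebesgue_integral_def integral_eq_nn_integral mult_ac intro!: arg_cong[where f=enn2real] nn_integral_cong split: split_indicator)
    also have "\<dots> = (LINT x:{t - 1..u}|lborel. std_normal_density x)"
      unfolding set_lebesgue_integral_def
      by (intro integral_cong_AE) (use AE_lborel_singleton[of "t - 1"] in \<open>auto split: split_indicator elim!: eventually_mono\<close>)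
    also have "\<dots> = integral {t - 1..u} std_normal_density"
      by (intro set_borel_integral_eq_integral) (simp only: set_integrable_def, intro integrable_mult_indicator, simp_all)
    finally show ?thesis .
  qed
  have "((\<lambda>u. integral {t - 1..u} std_normal_density) has_real_derivative std_normal_density t) (at t within {t - 1..t + 1})"
    by (intro integral_has_real_derivative) (auto simp: std_normal_density_def intro!: continuous_intros)
  then have "((\<lambda>u. integral {t - 1..u} std_normal_density) has_real_derivative std_normal_density t) (at t)"
    by (subst (asm) at_within_Icc_at) auto
  then have "((\<lambda>u. Phi (t - 1) + integral {t - 1..u} std_normal_density) has_real_derivative std_normal_density t) (at t)"
    by (auto intro!: derivative_eq_intros)
  moreover have "eventually (\<lambda>u. Phi (t - 1) + integral {t - 1..u} std_normal_density = Phi u) (nhds t)"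
  proof -
    have "eventually (\<lambda>u. u \<in> {t - 1<..}) (nhds t)"
      by (intro eventually_nhds_in_open) auto
    then show ?thesis
      by eventually_elim (rule Phi_eq[symmetric], simp)
  qed
  ultimately show ?thesis
    by (subst DERIV_cong_ev[OF refl _ refl]) (auto elim: eventually_mono)
qed

text \<open>The antiderivative is the distribution function of the inverse Gaussian distribution.\<close>

lemma nn_integral_inverse_gaussian:
  assumes a: "0 < a" and b: "0 < (b::real)"
  shows "(\<integral>\<^sup>+w. ennreal (indicator {0<..} w * (a / sqrt (2 * pi * w ^ 3) * exp (- a\<^sup>2 / (2 * w) - b\<^sup>2 / 2 * w))) \<partial>lborel)
    = ennreal (exp (- (a * b)))"
proof -
  define f where "f w = a / sqrt (2 * pi * w ^ 3) * exp (- a\<^sup>2 / (2 * w) - b\<^sup>2 / 2 * w)" for w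
  define F where "F w = exp (- (a * b)) * Phi ((b * w - a) / sqrt w) + exp (a * b) * Phi (- (b * w + a) / sqrt w)" for w
  have f_nonneg: "0 \<le> f w" if "0 < w" for w
    using that a by (auto simp: f_def)
  have [measurable]: "f \<in> borel_measurable borel"
    unfolding f_def by measurable
  have F_deriv: "(F has_real_derivative f w) (at w)" if w: "0 < w" for w
  proof -
    let ?r = "sqrt w"
    have r: "0 < ?r" "?r\<^sup>2 = w"
      using w by auto
    have d1: "((\<lambda>w. (b * w - a) / sqrt w) has_real_derivative (b * w + a) / (2 * w * ?r)) (at w)"
      using w r by (auto intro!: derivative_eq_intros simp: field_simps power2_eq_square)
    have d2: "((\<lambda>w. - (b * w + a) / sqrt w) has_real_derivative - (b * w - a) / (2 * w * ?r)) (at w)"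
      using w r by (auto intro!: derivative_eq_intros simp: field_simps power2_eq_square)
    have "(F has_real_derivative
        exp (- (a * b)) * (std_normal_density ((b * w - a) / ?r) * ((b * w + a) / (2 * w * ?r)))
        + exp (a * b) * (std_normal_density (- (b * w + a) / ?r) * (- (b * w - a) / (2 * w * ?r)))) (at w)"
      unfolding F_def
      by (intro DERIV_add DERIV_cmult DERIV_chain2[OF Phi_deriv d1] DERIV_chain2[OF Phi_deriv d2])
    \<comment> \<open>The squares \<open>(b w - a)^2 / w\<close> and \<open>(b w + a)^2 / w\<close>
      differ from \<open>a^2 / w + b^2 w\<close> by \<open>2 a b\<close> with opposite signs, which
      the outer exponentials absorb. Both densities thus coincide, and the inner derivatives leave
      \<open>(b w + a) - (b w - a) = 2 a\<close>.\<close>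
    moreover have e1: "exp (- (a * b)) * std_normal_density ((b * w - a) / ?r) = exp (- a\<^sup>2 / (2 * w) - b\<^sup>2 / 2 * w) / sqrt (2 * pi)"
    proof -
      have "- (a * b) + - ((b * w - a) / ?r)\<^sup>2 / 2 = - a\<^sup>2 / (2 * w) - b\<^sup>2 / 2 * w"
        using w by (simp add: power_divide field_simps power2_eq_square)
      then show ?thesis
        unfolding std_normal_density_def by (simp flip: exp_add)
    qed
    moreover have e2: "exp (a * b) * std_normal_density (- (b * w + a) / ?r) = exp (- a\<^sup>2 / (2 * w) - b\<^sup>2 / 2 * w) / sqrt (2 * pi)"
    proof -
      have "a * b + - (- (b * w + a) / ?r)\<^sup>2 / 2 = - a\<^sup>2 / (2 * w) - b\<^sup>2 / 2 * w"
        using w by (simp add: power_divide field_simps power2_eq_square)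
      then show ?thesis
        unfolding std_normal_density_def by (simp flip: exp_add)
    qed
    moreover have "sqrt (2 * pi * w ^ 3) = sqrt (2 * pi) * (w * ?r)"
      using w by (simp add: real_sqrt_mult power3_eq_cube)
    then have "E / sqrt (2 * pi) * ((b * w + a) / (2 * w * ?r)) + E / sqrt (2 * pi) * (- (b * w - a) / (2 * w * ?r)) = a / sqrt (2 * pi * w ^ 3) * E" for E
      using w r by (simp add: divide_simps) (simp add: algebra_simps)
    ultimately show ?thesis
      unfolding f_def by (simp add: mult.assoc[symmetric] e1 e2)
  qed
  have F_top: "(F \<longlongrightarrow> exp (- (a * b))) at_top"
  proof -
    have "filterlim (\<lambda>w. (b * w - a) / sqrt w) at_top at_top" "filterlim (\<lambda>w. - (b * w + a) / sqrt w) at_bot at_top"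
      using a b by real_asymp+
    then have "(F \<longlongrightarrow> exp (- (a * b)) * 1 + exp (a * b) * 0) at_top"
      unfolding F_def by (intro tendsto_add tendsto_mult tendsto_const filterlim_compose[OF Phi_limits(1)] filterlim_compose[OF Phi_limits(2)])
    then show ?thesis by simp
  qed
  have F_0: "(F \<longlongrightarrow> 0) (at_right 0)"
  proof -
    have "filterlim (\<lambda>w. (b * w - a) / sqrt w) at_bot (at_right 0)" "filterlim (\<lambda>w. - (b * w + a) / sqrt w) at_bot (at_right 0)"
      using a b by real_asymp+
    then have "(F \<longlongrightarrow> exp (- (a * b)) * 0 + exp (a * b) * 0) (at_right 0)"
      unfolding F_def by (intro tendsto_add tendsto_mult tendsto_const filterlim_compose[OF Phi_limits(2)])
    then show ?thesis by simp
  qed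
  \<comment> \<open>The antiderivative is available on the open half-line only, so the integral is
    exhausted by the closed half-lines \<open>{e n..}\<close>; \<open>F\<close> tends to 0 at their
    left ends.\<close>
  define e where "e n = 1 / real (Suc n)" for n
  have e: "0 < e n" "decseq e" for n
    by (auto simp: e_def decseq_def field_simps)
  have e_lim: "filterlim e (at_right 0) sequentially"
    unfolding e_def by real_asymp
  have ind: "(\<lambda>n. ennreal (f w) * indicator {e n..} w) \<longlonglongrightarrow> ennreal (indicator {0<..} w * f w)" for w
  proof (cases "0 < w")
    case True
    have "eventually (\<lambda>n. e n < w) sequentially"
      using e_lim True by (auto simp: filterlim_at intro: order_tendstoD)
    then have "eventually (\<lambda>n. ennreal (f w) * indicator {e n..} w = ennreal (indicator {0<..} w * f w)) sequentially"
      by eventually_elim (use True in auto)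
    then show ?thesis by (rule tendsto_eventually)
  next
    case False
    have "indicator {e n..} w = (0 :: ennreal)" for n
      using False e(1)[of n] by auto
    with False show ?thesis by simp
  qed
  have "(\<integral>\<^sup>+w. ennreal (indicator {0<..} w * f w) \<partial>lborel) = (\<integral>\<^sup>+w. (SUP n. ennreal (f w) * indicator {e n..} w) \<partial>lborel)"
  proof (intro nn_integral_cong LIMSEQ_unique[OF ind] LIMSEQ_SUP)
    fix w show "incseq (\<lambda>n. ennreal (f w) * indicator {e n..} w)"
      using e(2) by (auto simp: incseq_def decseq_def split: split_indicator intro: order_trans)
  qed
  also have "\<dots> = (SUP n. \<integral>\<^sup>+w. ennreal (f w) * indicator {e n..} w \<partial>lborel)"
    using e(2) by (intro nn_integral_monotone_convergence_SUP)
      (auto simp: incseq_def decseq_def le_fun_def split: split_indicator intro: order_trans)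
  also have "(\<lambda>n. \<integral>\<^sup>+w. ennreal (f w) * indicator {e n..} w \<partial>lborel) = (\<lambda>n. ennreal (exp (- (a * b)) - F (e n)))"
  proof
    fix n show "(\<integral>\<^sup>+w. ennreal (f w) * indicator {e n..} w \<partial>lborel) = ennreal (exp (- (a * b)) - F (e n))"
      using e(1)[of n] by (intro nn_integral_FTC_atLeast F_deriv f_nonneg F_top) auto
  qed
  also have "(SUP n. ennreal (exp (- (a * b)) - F (e n))) = ennreal (exp (- (a * b)))"
  proof (rule LIMSEQ_unique[OF LIMSEQ_SUP])
    show "incseq (\<lambda>n. ennreal (exp (- (a * b)) - F (e n)))"
    proof (intro monoI ennreal_leI diff_left_mono)
      fix m n :: nat assume "m \<le> n"
      then have "e n \<le> e m" using e(2) by (auto simp: decseq_def)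
      then show "F (e n) \<le> F (e m)"
        using e(1)[of n] by (intro DERIV_nonneg_imp_nondecreasing[of "e n" "e m" F]) (auto intro!: F_deriv f_nonneg exI)
    qed
    have "(\<lambda>n. exp (- (a * b)) - F (e n)) \<longlonglongrightarrow> exp (- (a * b)) - 0"
      by (intro tendsto_diff tendsto_const filterlim_compose[OF F_0 e_lim])
    then show "(\<lambda>n. ennreal (exp (- (a * b)) - F (e n))) \<longlonglongrightarrow> ennreal (exp (- (a * b)))"
      by (intro tendsto_ennrealI) simp
  qed
  finally show ?thesis
    by (simp add: f_def)
qed

section \<open>The Polya-Gamma series as a tilted theta series\<close>

definition PG_term :: "nat \<Rightarrow> real \<Rightarrow> real" where
  "PG_term j w = real (2 * j + 1) / sqrt (2 * pi * w ^ 3) * exp (- (real (2 * j + 1))\<^sup>2 / (8 * w))"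

lemma PG_term_nonneg: "0 < w \<Longrightarrow> 0 \<le> PG_term j w"
  by (auto simp: PG_term_def)

text \<open>The identity \<open>(2 j + 1)^2 = 1 + 8 triangle j\<close> turns the exponents into
  triangular powers of \<open>exp (- 1 / w)\<close>, which is where
  \<open>theta_series_nonneg\<close> applies.\<close>

lemma PG_term_eq:
  assumes w: "0 < w"
  shows "PG_term j w = exp (- 1 / (8 * w)) / sqrt (2 * pi * w ^ 3) * (real (2 * j + 1) * exp (- 1 / w) ^ triangle j)"
proof -
  have "2 * triangle j = j * (j + 1)"
    by (induction j) auto
  then have "2 * real (triangle j) = real j * (real j + 1)"
    by (metis of_nat_1 of_nat_add of_nat_mult of_nat_numeral)
  then have "(real (2 * j + 1))\<^sup>2 = 1 + 8 * real (triangle j)"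
    by (simp add: power2_eq_square algebra_simps)
  then have "- (real (2 * j + 1))\<^sup>2 / (8 * w) = - 1 / (8 * w) + real (triangle j) * (- 1 / w)"
    using w by (simp add: field_simps)
  then have "exp (- (real (2 * j + 1))\<^sup>2 / (8 * w)) = exp (- 1 / (8 * w)) * exp (- 1 / w) ^ triangle j"
    by (simp only: exp_add exp_of_nat_mult)
  then show ?thesis
    unfolding PG_term_def by simp
qed

lemma summable_PG_term:
  assumes w: "0 < w"
  shows "summable (\<lambda>j. PG_term j w)"
proof -
  have "summable (\<lambda>j. real (2 * j + 1) * exp (- 1 / w) ^ triangle j)"
  proof (rule summable_comparison_test')
    show "summable (\<lambda>j. 2 * (real (Suc j) * exp (- 1 / w) ^ triangle j))"
      using w by (intro summable_mult summable_Suc_power_triangle) auto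
    show "norm (real (2 * j + 1) * exp (- 1 / w) ^ triangle j) \<le> 2 * (real (Suc j) * exp (- 1 / w) ^ triangle j)" if "0 \<le> j" for j
      by (simp add: abs_mult mult.assoc[symmetric] mult_right_mono)
  qed
  then show ?thesis
    unfolding PG_term_eq[OF w] by (rule summable_mult)
qed

lemma summable_PG_alternating:
  assumes w: "0 < w"
  shows "summable (\<lambda>j. (- 1) ^ j * PG_term j w)"
  by (rule summable_norm_cancel) (use summable_PG_term[OF w] PG_term_nonneg[OF w] in \<open>simp add: abs_mult\<close>)

lemma exp_diff_mult: "exp (u - c / 2 * w) = exp (- c / 2 * w) * exp (u :: real)"
  by (simp flip: exp_add)

text \<open>The factor \<open>exp (- b^2 w / 2)\<close> does not depend on \<open>j\<close> and
  leaves the series. Sign, total mass and comparison of different \<open>b\<close> thus reduce to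
  \<open>PG(1, 0)\<close>.\<close>

lemma PG_density_eq:
  assumes w: "0 < w"
  shows "PG_density b w = cosh (b / 2) * (exp (- b\<^sup>2 / 2 * w) * PG_density 0 w)"
proof -
  have *: "PG_density b w = cosh (b / 2) * (\<Sum>j. exp (- b\<^sup>2 / 2 * w) * ((- 1) ^ j * PG_term j w))" for b
    unfolding PG_density_def PG_term_def exp_diff_mult by (simp only: mult_ac)
  show ?thesis
    unfolding *[of b] *[of 0] suminf_mult[OF summable_PG_alternating[OF w]]
    by (simp only: zero_power2 minus_zero mult_zero_left exp_zero cosh_0 mult_1_left div_0)
qed

lemma PG_density_0_eq: "PG_density 0 w = (\<Sum>j. (- 1) ^ j * PG_term j w)"
  unfolding PG_density_def PG_term_def exp_diff_mult
  by (simp only: zero_power2 minus_zero mult_zero_left exp_zero cosh_0 mult_1_left div_0 mult.assoc)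

lemma PG_density_0_nonneg:
  assumes w: "0 < w"
  shows "0 \<le> PG_density 0 w"
proof -
  let ?x = "exp (- 1 / w)" and ?C = "exp (- 1 / (8 * w)) / sqrt (2 * pi * w ^ 3)"
  have C: "0 < ?C"
    using w by simp
  have "PG_density 0 w = (\<Sum>j. ?C * ((- 1) ^ j * real (2 * j + 1) * ?x ^ triangle j))"
    unfolding PG_density_0_eq PG_term_eq[OF w] by (simp only: mult_ac)
  moreover have "summable (\<lambda>j. ?C * ((- 1) ^ j * real (2 * j + 1) * ?x ^ triangle j))"
    using summable_PG_alternating[OF w] unfolding PG_term_eq[OF w] by (simp only: mult_ac)
  then have "summable (\<lambda>j. (- 1) ^ j * real (2 * j + 1) * ?x ^ triangle j)"
    using C by (subst (asm) summable_cmult_iff) auto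
  ultimately have "PG_density 0 w = ?C * (\<Sum>j. (- 1) ^ j * real (2 * j + 1) * ?x ^ triangle j)"
    by (simp only: suminf_mult)
  then show ?thesis
    using C theta_series_nonneg[of ?x] w by (simp only:) (intro mult_nonneg_nonneg, auto)
qed

definition PG0 :: "real \<Rightarrow> real" where
  "PG0 w = indicator {0<..} w * PG_density 0 w"

lemma PG0_nonneg: "0 \<le> PG0 w"
  using PG_density_0_nonneg[of w] by (auto simp: PG0_def split: split_indicator)

lemma PG0_measurable [measurable]: "PG0 \<in> borel_measurable borel"
  unfolding PG0_def PG_density_def by measurable

text \<open>Each tilted term is a multiple of an inverse Gaussian density, and its absolute value
  integrates to \<open>2 exp (- (j + 1/2) b)\<close>. These norms are summable because
  \<open>b > 0\<close>, which justifies integrating the alternating series termwise; the signed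
  values form a geometric series of ratio \<open>- exp (- b)\<close>.\<close>

lemma PG0_laplace_pos:
  assumes b: "0 < b"
  shows "(\<integral>\<^sup>+w. ennreal (exp (- b\<^sup>2 / 2 * w) * PG0 w) \<partial>lborel) = ennreal (1 / cosh (b / 2))"
proof -
  \<comment> \<open>Half of \<open>2 j + 1\<close>, so that \<open>a^2 / (2 w)\<close> is the
    exponent \<open>(2 j + 1)^2 / (8 w)\<close> of the series; the prefactor then needs the 2 in
    \<open>f\<close>.\<close>
  define a where "a j = (real j + 1 / 2)" for j :: nat
  define h where "h j w = indicator {0<..} w * (a j / sqrt (2 * pi * w ^ 3) * exp (- (a j)\<^sup>2 / (2 * w) - b\<^sup>2 / 2 * w))" for j w
  define f where "f j w = (- 1) ^ j * (2 * h j w)" for j w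
  have a: "0 < a j" for j
    by (simp add: a_def add_nonneg_pos)
  have h_nonneg: "0 \<le> h j w" for j w
    using a[of j] by (auto simp: h_def split: split_indicator)
  have [measurable]: "h j \<in> borel_measurable lborel" for j
    unfolding h_def by measurable
  have "(\<integral>\<^sup>+w. ennreal (h j w) \<partial>lborel) = ennreal (exp (- (a j * b)))" for j
    unfolding h_def by (rule nn_integral_inverse_gaussian[OF a b])
  then have h: "has_bochner_integral lborel (h j) (exp (- (a j * b)))" for j
    by (intro has_bochner_integral_nn_integral) (auto simp: h_nonneg)
  have f: "has_bochner_integral lborel (f j) ((- 1) ^ j * (2 * exp (- (a j * b))))" for j
    unfolding f_def by (intro has_bochner_integral_mult_right h)
  have nf: "(LINT w|lborel. norm (f j w)) = 2 * exp (- (a j * b))" for j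
    using has_bochner_integral_integral_eq[OF h[of j]] h_nonneg by (simp add: f_def abs_mult)
  have f_eq: "f j w = indicator {0<..} w * exp (- b\<^sup>2 / 2 * w) * ((- 1) ^ j * PG_term j w)" for j w
  proof -
    have "(a j)\<^sup>2 / (2 * w) = (real (2 * j + 1))\<^sup>2 / (8 * w)" "2 * a j = real (2 * j + 1)"
      by (simp_all add: a_def power2_eq_square field_simps)
    moreover have "f j w = indicator {0<..} w * exp (- b\<^sup>2 / 2 * w) *
        ((- 1) ^ j * ((2 * a j) / sqrt (2 * pi * w ^ 3) * exp (- ((a j)\<^sup>2 / (2 * w)))))"
      unfolding f_def h_def exp_diff_mult by (simp only: times_divide_eq_right times_divide_eq_left mult_ac minus_divide_left)
    ultimately show ?thesis
      unfolding PG_term_def by (simp only: minus_divide_left)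
  qed
  have geom: "(- 1) ^ j * (2 * exp (- (a j * b))) = 2 * exp (- b / 2) * (- exp (- b)) ^ j" for j
  proof -
    have "- (a j * b) = - b / 2 + real j * (- b)"
      by (simp add: a_def field_simps)
    then have "exp (- (a j * b)) = exp (- b / 2) * exp (- b) ^ j"
      by (simp only: exp_add exp_of_nat_mult)
    then show ?thesis
      by (simp add: power_minus[of "exp (- b)"])
  qed
  have geom': "2 * exp (- (a j * b)) = 2 * exp (- b / 2) * exp (- b) ^ j" for j
    using geom[of j] by (simp add: power_minus[of "exp (- b)"])
  have i: "integrable lborel (f j)" for j
    using f by (rule integrable.intros)
  have sAE: "AE w in lborel. summable (\<lambda>j. norm (f j w))"
  proof (rule AE_I2)
    fix w :: real
    show "summable (\<lambda>j. norm (f j w))"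
    proof (cases "0 < w")
      case True
      then have "norm (f j w) = exp (- b\<^sup>2 / 2 * w) * PG_term j w" for j
        by (simp add: f_eq abs_mult PG_term_nonneg)
      then show ?thesis
        using summable_PG_term[OF True] by (simp add: summable_mult)
    qed (simp add: f_def h_def)
  qed
  have sN: "summable (\<lambda>j. LINT w|lborel. norm (f j w))"
    unfolding nf geom' using b by (intro summable_mult summable_geometric) auto
  have sum_eq: "(\<Sum>j. f j w) = exp (- b\<^sup>2 / 2 * w) * PG0 w" for w
  proof (cases "0 < w")
    case True
    then show ?thesis
      unfolding f_eq PG0_def PG_density_0_eq
      using suminf_mult[OF summable_PG_alternating[OF True], of "exp (- b\<^sup>2 / 2 * w)"] by simp
  qed (simp add: f_eq PG0_def)
  have "(LINT w|lborel. exp (- b\<^sup>2 / 2 * w) * PG0 w) = (\<Sum>j. LINT w|lborel. f j w)"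
    using integral_suminf[OF i sAE sN] by (simp add: sum_eq)
  also have "\<dots> = (\<Sum>j. 2 * exp (- b / 2) * (- exp (- b)) ^ j)"
    by (intro arg_cong[where f=suminf] ext) (simp only: has_bochner_integral_integral_eq[OF f] geom)
  also have "\<dots> = 2 * exp (- b / 2) * (1 / (1 - (- exp (- b))))"
    using suminf_geometric[of "- exp (- b)"] summable_geometric[of "- exp (- b)"] b
    by (subst suminf_mult) auto
  also have "\<dots> = 1 / cosh (b / 2)"
  proof -
    have "exp (- b) = exp (- b / 2) * exp (- b / 2)" "exp (b / 2) * exp (- b / 2) = 1"
      by (simp_all flip: exp_add)
    then show ?thesis
      by (simp add: cosh_def field_simps add_pos_pos less_imp_neq[THEN not_sym])
  qed
  finally have "(LINT w|lborel. exp (- b\<^sup>2 / 2 * w) * PG0 w) = 1 / cosh (b / 2)" .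
  moreover have "integrable lborel (\<lambda>w. exp (- b\<^sup>2 / 2 * w) * PG0 w)"
    using integrable_suminf[OF i sAE sN] by (simp add: sum_eq)
  ultimately show ?thesis
    by (subst nn_integral_eq_integral) (auto simp: PG0_nonneg)
qed

text \<open>At \<open>b = 0\<close> the norms in the previous argument sum to infinity. Since
  \<open>PG0\<close> is nonnegative, the integrands increase as the tilt \<open>e n\<close>
  decreases to 0, and monotone convergence extends the formula.\<close>

lemma PG0_laplace:
  assumes b: "0 \<le> b"
  shows "(\<integral>\<^sup>+w. ennreal (exp (- b\<^sup>2 / 2 * w) * PG0 w) \<partial>lborel) = ennreal (1 / cosh (b / 2))"
proof (cases "b = 0")
  case True
  define e where "e n = 1 / real (Suc n)" for n
  have e: "0 < e n" for n
    by (simp add: e_def)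
  have e_lim: "e \<longlonglongrightarrow> 0"
    unfolding e_def by real_asymp
  let ?f = "\<lambda>n w. ennreal (exp (- (e n)\<^sup>2 / 2 * w) * PG0 w)"
  have inc: "incseq ?f"
  proof (intro incseq_SucI le_funI ennreal_leI)
    fix n w
    have "(e (Suc n))\<^sup>2 \<le> (e n)\<^sup>2"
      using e[of "Suc n"] by (intro power_mono) (auto simp: e_def field_simps)
    then have "(e (Suc n))\<^sup>2 / 2 * w \<le> (e n)\<^sup>2 / 2 * w" if "0 < w"
      using that by (intro mult_right_mono) auto
    then show "exp (- (e n)\<^sup>2 / 2 * w) * PG0 w \<le> exp (- (e (Suc n))\<^sup>2 / 2 * w) * PG0 w"
      using PG0_nonneg by (cases "0 < w") (auto simp: PG0_def[of w] PG_density_0_nonneg intro!: mult_right_mono)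
  qed
  have "(\<integral>\<^sup>+w. ennreal (exp (- b\<^sup>2 / 2 * w) * PG0 w) \<partial>lborel) = (\<integral>\<^sup>+w. (SUP n. ?f n w) \<partial>lborel)"
  proof (intro nn_integral_cong LIMSEQ_unique[OF _ LIMSEQ_SUP])
    fix w show "incseq (\<lambda>n. ?f n w)"
      using inc by (auto simp: incseq_def le_fun_def)
    have "(\<lambda>n. exp (- (e n)\<^sup>2 / 2 * w) * PG0 w) \<longlonglongrightarrow> exp (- 0\<^sup>2 / 2 * w) * PG0 w"
      by (intro tendsto_intros e_lim) auto
    then show "(\<lambda>n. ?f n w) \<longlonglongrightarrow> ennreal (exp (- b\<^sup>2 / 2 * w) * PG0 w)"
      using True by (intro tendsto_ennrealI) simp
  qed
  also have "\<dots> = (SUP n. \<integral>\<^sup>+w. ?f n w \<partial>lborel)"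
    using inc by (intro nn_integral_monotone_convergence_SUP) auto
  also have "\<dots> = (SUP n. ennreal (1 / cosh (e n / 2)))"
    using PG0_laplace_pos[OF e] by simp
  also have "\<dots> = ennreal 1"
  proof (rule LIMSEQ_unique[OF LIMSEQ_SUP])
    have "incseq (\<lambda>n. \<integral>\<^sup>+w. ?f n w \<partial>lborel)"
      using inc by (auto simp: incseq_def le_fun_def intro!: nn_integral_mono)
    then show "incseq (\<lambda>n. ennreal (1 / cosh (e n / 2)))"
      using PG0_laplace_pos[OF e] by simp
    have "(\<lambda>n. 1 / cosh (e n / 2)) \<longlonglongrightarrow> 1 / cosh (0 / 2)"
      by (intro tendsto_intros e_lim) auto
    then show "(\<lambda>n. ennreal (1 / cosh (e n / 2))) \<longlonglongrightarrow> ennreal 1"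
      by (intro tendsto_ennrealI) simp
  qed
  finally show ?thesis
    using True by simp
qed (use b PG0_laplace_pos in auto)

lemma PG_density_eq_PG0:
  "indicator {0<..} w * PG_density b w = cosh (b / 2) * (exp (- b\<^sup>2 / 2 * w) * PG0 w)"
  by (cases "0 < w") (simp_all add: PG0_def PG_density_eq[of w b])

lemma nn_integral_PG_density:
  assumes b: "0 \<le> b"
  shows "(\<integral>\<^sup>+w. ennreal (indicator {0<..} w * PG_density b w) \<partial>lborel) = 1"
proof -
  have "(\<integral>\<^sup>+w. ennreal (indicator {0<..} w * PG_density b w) \<partial>lborel)
      = ennreal (cosh (b / 2)) * (\<integral>\<^sup>+w. ennreal (exp (- b\<^sup>2 / 2 * w) * PG0 w) \<partial>lborel)"
    unfolding PG_density_eq_PG0 by (subst nn_integral_cmult[symmetric]) (auto simp: ennreal_mult' PG0_nonneg)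
  also have "\<dots> = ennreal (cosh (b / 2) * (1 / cosh (b / 2)))"
    unfolding PG0_laplace[OF b] by (simp only: ennreal_mult' cosh_real_nonneg)
  finally show ?thesis
    by simp
qed

text \<open>\<open>exp (- b^2 w / 2) / w\<close> is the integral of
  \<open>c * exp (- c^2 w / 2)\<close> over \<open>c \<ge> b\<close>. After Tonelli the inner
  integral is the Laplace transform, and \<open>1 / cosh (c / 2) \<le> 2 exp (- c / 2)\<close>
  leaves an elementary tail. The slope 2 matters: it is matched later with twice the absolute sum in
  \<open>post_mean_contraction\<close>.\<close>

lemma nn_integral_inverse_PG:
  assumes b: "0 \<le> b"
  shows "(\<integral>\<^sup>+w. ennreal (indicator {0<..} w * PG_density b w * (1 / w)) \<partial>lborel) \<le> ennreal (2 * b + 10)"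
proof -
  have inner: "ennreal (exp (- b\<^sup>2 / 2 * w) * (1 / w)) = (\<integral>\<^sup>+c. ennreal (c * exp (- c\<^sup>2 / 2 * w)) * indicator {b..} c \<partial>lborel)"
    if w: "0 < w" for w
  proof -
    have "(\<integral>\<^sup>+c. ennreal (c * exp (- c\<^sup>2 / 2 * w)) * indicator {b..} c \<partial>lborel) = ennreal (0 - (- exp (- b\<^sup>2 / 2 * w) / w))"
    proof (rule nn_integral_FTC_atLeast)
      show "((\<lambda>c. - exp (- c\<^sup>2 / 2 * w) / w) has_real_derivative c * exp (- c\<^sup>2 / 2 * w)) (at c)" for c
        using w by (auto intro!: derivative_eq_intros)
      show "((\<lambda>c. - exp (- c\<^sup>2 / 2 * w) / w) \<longlongrightarrow> 0) at_top"
        using w by real_asymp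
    qed (use b in auto)
    then show ?thesis by simp
  qed
  have tail: "(\<integral>\<^sup>+c. ennreal (2 * c * exp (- c / 2)) * indicator {b..} c \<partial>lborel) = ennreal (0 - (- (4 * b + 8) * exp (- b / 2)))"
  proof (rule nn_integral_FTC_atLeast)
    show "((\<lambda>c. - (4 * c + 8) * exp (- c / 2)) has_real_derivative 2 * c * exp (- c / 2)) (at c)" for c
      by (auto intro!: derivative_eq_intros simp: algebra_simps)
    show "((\<lambda>c::real. - (4 * c + 8) * exp (- c / 2)) \<longlongrightarrow> 0) at_top"
      by real_asymp
  qed (use b in auto)
  have "(\<integral>\<^sup>+w. ennreal (indicator {0<..} w * PG_density b w * (1 / w)) \<partial>lborel)
      = (\<integral>\<^sup>+w. ennreal (cosh (b / 2)) * (ennreal (PG0 w) * (\<integral>\<^sup>+c. ennreal (c * exp (- c\<^sup>2 / 2 * w)) * indicator {b..} c \<partial>lborel)) \<partial>lborel)"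
  proof (rule nn_integral_cong)
    fix w :: real
    show "ennreal (indicator {0<..} w * PG_density b w * (1 / w))
        = ennreal (cosh (b / 2)) * (ennreal (PG0 w) * (\<integral>\<^sup>+c. ennreal (c * exp (- c\<^sup>2 / 2 * w)) * indicator {b..} c \<partial>lborel))"
    proof (cases "0 < w")
      case True
      show ?thesis
        unfolding inner[OF True, symmetric] PG_density_eq_PG0 using True
        by (simp add: ennreal_mult'[symmetric] PG0_nonneg mult_ac)
    qed (simp add: PG0_def)
  qed
  also have "\<dots> = ennreal (cosh (b / 2)) * (\<integral>\<^sup>+w. \<integral>\<^sup>+c. ennreal (PG0 w) * (ennreal (c * exp (- c\<^sup>2 / 2 * w)) * indicator {b..} c) \<partial>lborel \<partial>lborel)"
    by (subst nn_integral_cmult) (auto simp: nn_integral_cmult)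
  also have "(\<integral>\<^sup>+w. \<integral>\<^sup>+c. ennreal (PG0 w) * (ennreal (c * exp (- c\<^sup>2 / 2 * w)) * indicator {b..} c) \<partial>lborel \<partial>lborel)
      = (\<integral>\<^sup>+c. \<integral>\<^sup>+w. ennreal (PG0 w) * (ennreal (c * exp (- c\<^sup>2 / 2 * w)) * indicator {b..} c) \<partial>lborel \<partial>lborel)"
    by (rule lborel_pair.Fubini') measurable
  also have "\<dots> \<le> (\<integral>\<^sup>+c. ennreal (2 * c * exp (- c / 2)) * indicator {b..} c \<partial>lborel)"
  proof (rule nn_integral_mono)
    fix c :: real
    show "(\<integral>\<^sup>+w. ennreal (PG0 w) * (ennreal (c * exp (- c\<^sup>2 / 2 * w)) * indicator {b..} c) \<partial>lborel)
        \<le> ennreal (2 * c * exp (- c / 2)) * indicator {b..} c"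
    proof (cases "b \<le> c")
      case True
      then have c: "0 \<le> c" using b by simp
      have "(\<integral>\<^sup>+w. ennreal (PG0 w) * (ennreal (c * exp (- c\<^sup>2 / 2 * w)) * indicator {b..} c) \<partial>lborel)
          = (\<integral>\<^sup>+w. ennreal c * ennreal (exp (- c\<^sup>2 / 2 * w) * PG0 w) \<partial>lborel)"
        using True c by (intro nn_integral_cong) (simp add: ennreal_mult'[symmetric] PG0_nonneg mult_ac)
      also have "\<dots> = ennreal c * (\<integral>\<^sup>+w. ennreal (exp (- c\<^sup>2 / 2 * w) * PG0 w) \<partial>lborel)"
        by (rule nn_integral_cmult) measurable
      also have "\<dots> = ennreal (c * (1 / cosh (c / 2)))"
        unfolding PG0_laplace[OF c] by (rule ennreal_mult'[symmetric, OF c])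
      also have "\<dots> \<le> ennreal (c * (2 * exp (- c / 2)))"
      proof (intro ennreal_leI mult_left_mono c)
        have "1 = exp (c / 2) * exp (- c / 2)"
          by (simp flip: exp_add)
        also have "\<dots> \<le> 2 * cosh (c / 2) * exp (- c / 2)"
          by (intro mult_right_mono) (auto simp: cosh_def)
        finally show "1 / cosh (c / 2) \<le> 2 * exp (- c / 2)"
          by (simp add: field_simps)
      qed
      finally show ?thesis
        using True by (simp add: mult_ac)
    qed simp
  qed
  also have "\<dots> = ennreal ((4 * b + 8) * exp (- b / 2))"
    unfolding tail by (simp add: algebra_simps)
  finally have "(\<integral>\<^sup>+w. ennreal (indicator {0<..} w * PG_density b w * (1 / w)) \<partial>lborel)
      \<le> ennreal (cosh (b / 2)) * ennreal ((4 * b + 8) * exp (- b / 2))"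
    by (simp add: mult_left_mono)
  also have "\<dots> = ennreal (cosh (b / 2) * ((4 * b + 8) * exp (- b / 2)))"
    using b by (simp add: ennreal_mult')
  also have "\<dots> \<le> ennreal (2 * b + 10)"
  proof (rule ennreal_leI)
    \<comment> \<open>The product equals \<open>2 b + 4 + 2 b exp (- b) + 4 exp (- b)\<close>; the
      last two summands are at most 2 and 4, hence the constant 10.\<close>
    have "exp (b / 2) * exp (- b / 2) = 1" "exp (- b / 2) * exp (- b / 2) = exp (- b)"
      by (simp_all flip: exp_add)
    then have "cosh (b / 2) * ((4 * b + 8) * exp (- b / 2)) = (2 * b + 4) * (1 + exp (- b))"
      by (simp add: cosh_def field_simps)
    moreover have "b * exp (- b) \<le> 1"
    proof -
      have "1 + b \<le> exp b"
        by (rule exp_ge_add_one_self)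
      then have "b \<le> exp b"
        by linarith
      then show ?thesis by (simp add: exp_minus field_simps)
    qed
    moreover have "exp (- b) \<le> 1"
      using b by simp
    moreover have "(2 * b + 4) * (1 + exp (- b)) = 2 * b + 4 + 2 * (b * exp (- b)) + 4 * exp (- b)"
      by (simp add: algebra_simps)
    ultimately show "cosh (b / 2) * ((4 * b + 8) * exp (- b / 2)) \<le> 2 * b + 10"
      by linarith
  qed
  finally show ?thesis .
qed

section \<open>Linear substitution and Gaussian integrals\<close>

lemma prod_Basis_cart: "(\<Prod>b\<in>(Basis :: (real ^ 'n) set). h b) = (\<Prod>i\<in>UNIV. h (axis i 1))"
  by (simp add: Basis_vec_def prod.UNION_disjoint axis_eq_axis)

lemma swap_lborel:
  fixes m n :: "'n::finite"
  shows "distr lborel borel (\<lambda>x::real^'n. \<chi> i. x $ Transposition.transpose m n i) = lborel" (is "distr _ _ ?T = _")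
proof (rule lborel_eqI[symmetric])
  fix l u :: "real ^ 'n"
  assume le: "\<And>b. b \<in> Basis \<Longrightarrow> l \<bullet> b \<le> u \<bullet> b"
  let ?t = "Transposition.transpose m n"
  have [measurable]: "?T \<in> borel_measurable borel"
    by (intro borel_measurable_continuous_onI continuous_on_vec_lambda continuous_intros)
  have "?T -` box l u = box (?T l) (?T u)"
  proof (intro set_eqI)
    fix x
    have "(\<forall>i. l $ i < x $ ?t i \<and> x $ ?t i < u $ i) \<longleftrightarrow> (\<forall>i. l $ ?t i < x $ i \<and> x $ i < u $ ?t i)"
      by (metis transpose_involutory)
    then show "x \<in> ?T -` box l u \<longleftrightarrow> x \<in> box (?T l) (?T u)"
      by (simp add: mem_box_cart)
  qed
  then have "emeasure (distr lborel borel ?T) (box l u) = emeasure lborel (box (?T l) (?T u))"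
    by (simp add: emeasure_distr)
  also have "\<dots> = ennreal (\<Prod>i\<in>UNIV. u $ ?t i - l $ ?t i)"
  proof -
    have "l $ i \<le> u $ i" for i
      using le[of "axis i 1"] by (simp add: inner_axis axis_in_Basis_iff)
    then have "\<And>b. b \<in> Basis \<Longrightarrow> ?T l \<bullet> b \<le> ?T u \<bullet> b"
      by (auto simp: Basis_vec_def inner_axis)
    then show ?thesis
      by (subst emeasure_lborel_box) (simp_all add: prod_Basis_cart inner_axis)
  qed
  also have "(\<Prod>i\<in>UNIV. u $ ?t i - l $ ?t i) = (\<Prod>i\<in>UNIV. u $ i - l $ i)"
    by (rule prod.reindex_bij_betw) (simp add: bij_transpose)
  also have "\<dots> = (\<Prod>b\<in>Basis. (u - l) \<bullet> b)"
    by (simp add: prod_Basis_cart inner_axis)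
  finally show "emeasure (distr lborel borel ?T) (box l u) = ennreal (\<Prod>b\<in>Basis. (u - l) \<bullet> b)" .
qed simp

text \<open>Since \<open>\<phi> b = 0\<close>, the shear moves the coordinate along \<open>b\<close>
  by an amount that does not depend on that coordinate. With the other coordinates fixed it is a
  translation of the line.\<close>

lemma shear_lborel:
  fixes f :: "'a::euclidean_space \<Rightarrow> ennreal" and \<phi> :: "'a \<Rightarrow> real"
  assumes b: "b \<in> Basis" and \<phi>: "linear \<phi>" "\<phi> b = 0" and f [measurable]: "f \<in> borel_measurable borel"
  shows "(\<integral>\<^sup>+x. f (x + \<phi> x *\<^sub>R b) \<partial>lborel) = (\<integral>\<^sup>+x. f x \<partial>lborel)"
proof -
  interpret product_sigma_finite "\<lambda>_. lborel :: real measure" ..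
  define B where "B = Basis - {b}"
  have B: "finite B" "b \<notin> B" "Basis = insert b B"
    using b by (auto simp: B_def)
  define S where "S g = (\<Sum>c\<in>Basis. g c *\<^sub>R c)" for g :: "'a \<Rightarrow> real"
  have [measurable]: "\<phi> \<in> borel_measurable borel"
    using \<phi>(1) by (intro borel_measurable_continuous_onI linear_continuous_on linear_conv_bounded_linear[THEN iffD1])
  have S [measurable]: "S \<in> borel_measurable (\<Pi>\<^sub>M c\<in>insert b B. lborel)"
    unfolding S_def[abs_def] B(3)[symmetric] by measurable
  have lb: "(\<integral>\<^sup>+x. h x \<partial>lborel) = (\<integral>\<^sup>+g. \<integral>\<^sup>+t. h (S (g(b := t))) \<partial>lborel \<partial>(\<Pi>\<^sub>M c\<in>B. lborel))"
    if [measurable]: "h \<in> borel_measurable borel" for h :: "'a \<Rightarrow> ennreal"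
  proof -
    have "(\<integral>\<^sup>+x. h x \<partial>lborel) = (\<integral>\<^sup>+g. h (S g) \<partial>(\<Pi>\<^sub>M c\<in>Basis. lborel))"
      by (subst lborel_eq) (simp add: nn_integral_distr S_def)
    also have "\<dots> = (\<integral>\<^sup>+g. \<integral>\<^sup>+t. h (S (g(b := t))) \<partial>lborel \<partial>(\<Pi>\<^sub>M c\<in>B. lborel))"
      unfolding B(3) by (rule product_nn_integral_insert[OF B(1,2)]) measurable
    finally show ?thesis .
  qed
  define r where "r g = (\<Sum>c\<in>B. g c *\<^sub>R c)" for g :: "'a \<Rightarrow> real"
  have S_upd: "S (g(b := t)) = r g + t *\<^sub>R b" for g t
    using B(2) B(1) unfolding S_def r_def B(3) by (simp add: add.commute) (intro sum.cong, auto)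
  have [simp]: "\<phi> (r g + t *\<^sub>R b) = \<phi> (r g)" for g t
    using \<phi> by (simp add: linear_add linear_scale)
  have "(\<integral>\<^sup>+x. f (x + \<phi> x *\<^sub>R b) \<partial>lborel)
      = (\<integral>\<^sup>+g. \<integral>\<^sup>+t. f (r g + (\<phi> (r g) + t) *\<^sub>R b) \<partial>lborel \<partial>(\<Pi>\<^sub>M c\<in>B. lborel))"
    by (subst lb) (auto simp: S_upd algebra_simps)
  also have "\<dots> = (\<integral>\<^sup>+g. \<integral>\<^sup>+t. f (r g + t *\<^sub>R b) \<partial>lborel \<partial>(\<Pi>\<^sub>M c\<in>B. lborel))"
  proof (rule nn_integral_cong)
    fix g
    have "(\<integral>\<^sup>+t. f (r g + t *\<^sub>R b) \<partial>lborel) = (\<integral>\<^sup>+t. f (r g + t *\<^sub>R b) \<partial>distr lborel borel ((+) (\<phi> (r g))))"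
      by (subst lborel_distr_plus) simp
    also have "\<dots> = (\<integral>\<^sup>+t. f (r g + (\<phi> (r g) + t) *\<^sub>R b) \<partial>lborel)"
      by (subst nn_integral_distr) auto
    finally show "(\<integral>\<^sup>+t. f (r g + (\<phi> (r g) + t) *\<^sub>R b) \<partial>lborel) = (\<integral>\<^sup>+t. f (r g + t *\<^sub>R b) \<partial>lborel)"
      by simp
  qed
  also have "\<dots> = (\<integral>\<^sup>+x. f x \<partial>lborel)"
    by (subst lb) (auto simp: S_upd)
  finally show ?thesis .
qed

lemma nn_integral_linear_substitution:
  fixes f :: "real ^ 'n \<Rightarrow> real ^ 'n" and g :: "real ^ 'n \<Rightarrow> ennreal"
  assumes "linear f" "det (matrix f) \<noteq> 0" "g \<in> borel_measurable borel"
  shows "(\<integral>\<^sup>+x. g x \<partial>lborel) = ennreal \<bar>det (matrix f)\<bar> * (\<integral>\<^sup>+x. g (f x) \<partial>lborel)"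
proof -
  \<comment> \<open>The induction over elementary maps also visits singular ones, which the
    determinant premise makes vacuous. The composition step applies the hypothesis for
    \<open>h\<close> to the integrand \<open>g o f\<close>, which is why \<open>g\<close> is
    quantified inside.\<close>
  define P where "P f \<longleftrightarrow> (det (matrix f) \<noteq> 0 \<longrightarrow> (\<forall>g\<in>borel_measurable borel.
    (\<integral>\<^sup>+x. g x \<partial>lborel) = ennreal \<bar>det (matrix f)\<bar> * (\<integral>\<^sup>+x. g (f x) \<partial>lborel)))" for f :: "real ^ 'n \<Rightarrow> real ^ 'n"
  have P_D: "(\<integral>\<^sup>+x. g x \<partial>lborel) = ennreal \<bar>det (matrix f)\<bar> * (\<integral>\<^sup>+x. g (f x) \<partial>lborel)"
    if "P f" "det (matrix f) \<noteq> 0" "g \<in> borel_measurable borel" for f g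
    using that unfolding P_def by blast
  have P_1: "P f" if "\<bar>det (matrix f)\<bar> = 1"
    "\<And>g. g \<in> borel_measurable borel \<Longrightarrow> (\<integral>\<^sup>+x. g x \<partial>lborel) = (\<integral>\<^sup>+x. g (f x) \<partial>lborel)" for f
    unfolding P_def that(1) by (intro impI ballI) (subst that(2), simp_all)
  have "P f"
  proof (rule induct_linear_elementary[OF assms(1)])
    fix f h :: "real ^ 'n \<Rightarrow> real ^ 'n"
    assume lin: "linear f" "linear h" and Pf: "P f" and Ph: "P h"
    have det: "det (matrix (f \<circ> h)) = det (matrix f) * det (matrix h)"
      using lin by (simp add: matrix_compose det_mul)
    show "P (f \<circ> h)"
      unfolding P_def
    proof (intro impI ballI)
      fix g :: "real ^ 'n \<Rightarrow> ennreal"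
      assume nz: "det (matrix (f \<circ> h)) \<noteq> 0" and g [measurable]: "g \<in> borel_measurable borel"
      have [measurable]: "f \<in> borel_measurable borel"
        using lin(1) by (intro borel_measurable_continuous_onI linear_continuous_on linear_conv_bounded_linear[THEN iffD1])
      have "(\<integral>\<^sup>+x. g x \<partial>lborel) = ennreal \<bar>det (matrix f)\<bar> * (\<integral>\<^sup>+x. g (f x) \<partial>lborel)"
        using nz by (intro P_D[OF Pf]) (auto simp: det)
      also have "(\<integral>\<^sup>+x. g (f x) \<partial>lborel) = ennreal \<bar>det (matrix h)\<bar> * (\<integral>\<^sup>+x. g (f (h x)) \<partial>lborel)"
        using nz by (intro P_D[OF Ph]) (auto simp: det)
      finally show "(\<integral>\<^sup>+x. g x \<partial>lborel) = ennreal \<bar>det (matrix (f \<circ> h))\<bar> * (\<integral>\<^sup>+x. g ((f \<circ> h) x) \<partial>lborel)"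
        by (simp add: det abs_mult ennreal_mult' mult.assoc)
    qed
  next
    fix f :: "real ^ 'n \<Rightarrow> real ^ 'n" and i
    assume "\<And>x. f x $ i = 0"
    then have "row i (matrix f) = 0"
      by (simp add: row_def matrix_def vec_eq_iff)
    then show "P f"
      by (simp add: P_def det_zero_row)
  next
    fix c :: "'n \<Rightarrow> real"
    let ?f = "\<lambda>x::real ^ 'n. \<chi> i. c i * x $ i"
    have "det (matrix ?f) = (\<Prod>i\<in>UNIV. matrix ?f $ i $ i)"
      by (rule det_diagonal) (simp add: matrix_def axis_def)
    then have det: "det (matrix ?f) = (\<Prod>i\<in>UNIV. c i)"
      by (simp add: matrix_def)
    show "P ?f"
      unfolding P_def
    proof (intro impI ballI)
      fix g :: "real ^ 'n \<Rightarrow> ennreal"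
      assume nz: "det (matrix ?f) \<noteq> 0" and g [measurable]: "g \<in> borel_measurable borel"
      define d where "d b = (\<chi> i. c i) \<bullet> b" for b :: "real ^ 'n"
      have [measurable]: "?f \<in> borel_measurable borel"
        by (intro borel_measurable_continuous_onI continuous_on_vec_lambda continuous_intros)
      have d_axis: "d (axis i 1) = c i" for i
        by (simp add: d_def inner_axis)
      have f_eq: "0 + (\<Sum>j\<in>Basis. (d j * (x \<bullet> j)) *\<^sub>R j) = ?f x" for x
      proof (rule euclidean_eqI)
        fix b :: "real ^ 'n" assume "b \<in> Basis"
        then show "(0 + (\<Sum>j\<in>Basis. (d j * (x \<bullet> j)) *\<^sub>R j)) \<bullet> b = ?f x \<bullet> b"
          by (auto simp: inner_sum_left inner_Basis if_distrib sum.delta' cong: if_cong)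
            (auto simp: Basis_vec_def d_axis inner_axis)
      qed
      have "lborel = density (distr lborel borel (\<lambda>x. 0 + (\<Sum>j\<in>Basis. (d j * (x \<bullet> j)) *\<^sub>R j))) (\<lambda>_. ennreal (\<Prod>j\<in>Basis. \<bar>d j\<bar>))"
      proof (rule lborel_affine_euclidean)
        show "d j \<noteq> 0" if "j \<in> Basis" for j
          using that nz unfolding det by (auto simp: Basis_vec_def d_axis)
      qed
      then have "lborel = density (distr lborel borel ?f) (\<lambda>_. ennreal (\<Prod>j\<in>Basis. \<bar>d j\<bar>))"
        unfolding f_eq .
      moreover have "(\<Prod>j\<in>Basis. \<bar>d j\<bar>) = \<bar>det (matrix ?f)\<bar>"
        unfolding det by (simp add: prod_Basis_cart abs_prod d_axis)
      ultimately have *: "lborel = density (distr lborel borel ?f) (\<lambda>_. ennreal \<bar>det (matrix ?f)\<bar>)"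
        by simp
      show "(\<integral>\<^sup>+x. g x \<partial>lborel) = ennreal \<bar>det (matrix ?f)\<bar> * (\<integral>\<^sup>+x. g (?f x) \<partial>lborel)"
        by (subst *) (simp add: nn_integral_density nn_integral_distr nn_integral_cmult)
    qed
  next
    fix m n :: 'n
    let ?f = "\<lambda>x::real ^ 'n. \<chi> i. x $ Transposition.transpose m n i"
    have lin: "linear ?f"
      by (rule linearI) (simp_all add: vec_eq_iff)
    \<comment> \<open>A swap is an involution, so its determinant squares to 1.\<close>
    have "matrix ?f ** matrix ?f = matrix (?f \<circ> ?f)"
      by (rule matrix_compose[OF lin lin, symmetric])
    also have "?f \<circ> ?f = id"
      by (simp add: fun_eq_iff vec_eq_iff)
    finally have "matrix ?f ** matrix ?f = mat 1"
      by (simp only: matrix_id_mat_1)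
    then have "(det (matrix ?f))\<^sup>2 = 1"
      unfolding power2_eq_square by (simp flip: det_mul)
    then have det: "\<bar>det (matrix ?f)\<bar> = 1"
      by (simp add: abs_square_eq_1)
    have [measurable]: "?f \<in> borel_measurable borel"
      by (intro borel_measurable_continuous_onI continuous_on_vec_lambda continuous_intros)
    have "(\<integral>\<^sup>+x. g x \<partial>lborel) = (\<integral>\<^sup>+x. g (?f x) \<partial>lborel)" if [measurable]: "g \<in> borel_measurable borel" for g :: "real ^ 'n \<Rightarrow> ennreal"
      by (subst swap_lborel[of m n, symmetric]) (simp add: nn_integral_distr)
    with det show "P ?f"
      by (rule P_1)
  next
    fix m n :: 'n assume mn: "m \<noteq> n"
    let ?f = "\<lambda>x::real ^ 'n. \<chi> i. if i = m then x $ m + x $ n else x $ i"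
    have "matrix ?f = (\<chi> k. if k = m then row m (mat 1) + 1 *s row n (mat 1) else row k (mat 1))"
      by (auto simp: matrix_def vec_eq_iff row_def mat_def axis_def)
    then have "det (matrix ?f) = det (mat 1 :: real ^ 'n ^ 'n)"
      by (simp only: det_row_operation[OF mn])
    then have det: "\<bar>det (matrix ?f)\<bar> = 1"
      by simp
    have "(\<integral>\<^sup>+x. g x \<partial>lborel) = (\<integral>\<^sup>+x. g (?f x) \<partial>lborel)" if g: "g \<in> borel_measurable borel" for g :: "real ^ 'n \<Rightarrow> ennreal"
    proof -
      have f_eq: "x + (x $ n) *\<^sub>R axis m 1 = ?f x" for x
        by (intro iffD2[OF vec_eq_iff] allI) (simp add: axis_def)
      have "linear (\<lambda>x::real ^ 'n. x $ n)"
        by (rule linearI) simp_all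
      moreover have "axis m (1 :: real) $ n = 0"
        using mn by (simp add: axis_def)
      moreover have "axis m (1 :: real) \<in> Basis"
        by (simp add: axis_in_Basis_iff)
      ultimately have "(\<integral>\<^sup>+x. g x \<partial>lborel) = (\<integral>\<^sup>+x. g (x + (x $ n) *\<^sub>R axis m 1) \<partial>lborel)"
        using g by (intro shear_lborel[symmetric])
      then show ?thesis
        unfolding f_eq .
    qed
    with det show "P ?f"
      by (rule P_1)
  qed
  with assms(2,3) show ?thesis
    by (intro P_D)
qed

section \<open>Gaussian integrals with a positive definite form\<close>

lemma nn_integral_std_gaussian:
  "(\<integral>\<^sup>+x. ennreal (exp (- (x \<bullet> x) / 2)) \<partial>(lborel :: 'a::euclidean_space measure)) = ennreal (sqrt ((2 * pi) ^ DIM('a)))"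
proof -
  have one: "(\<integral>\<^sup>+t. ennreal (exp (- t\<^sup>2 / 2)) \<partial>lborel) = ennreal (sqrt (2 * pi))"
  proof -
    have "(\<integral>\<^sup>+t. ennreal (exp (- t\<^sup>2 / 2)) \<partial>lborel) = (\<integral>\<^sup>+t. ennreal (sqrt (2 * pi)) * ennreal (std_normal_density t) \<partial>lborel)"
      by (intro nn_integral_cong) (simp add: std_normal_density_def ennreal_mult'[symmetric])
    also have "\<dots> = ennreal (sqrt (2 * pi)) * (\<integral>\<^sup>+t. ennreal (std_normal_density t) \<partial>lborel)"
      by (rule nn_integral_cmult) measurable
    also have "(\<integral>\<^sup>+t. ennreal (std_normal_density t) \<partial>lborel) = 1"
      by (subst nn_integral_eq_integral) auto
    finally show ?thesis by simp
  qed
  have "ennreal (exp (- (x \<bullet> x) / 2)) = (\<Prod>b\<in>Basis. ennreal (exp (- (x \<bullet> b)\<^sup>2 / 2)))" for x :: 'a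
    by (simp add: prod_ennreal exp_sum[symmetric] sum_negf sum_divide_distrib[symmetric] euclidean_inner[of x x] power2_eq_square)
  then have "(\<integral>\<^sup>+x. ennreal (exp (- (x \<bullet> x) / 2)) \<partial>(lborel :: 'a measure)) = (\<Prod>b\<in>(Basis :: 'a set). ennreal (sqrt (2 * pi)))"
    by (simp only: one) (subst nn_integral_lborel_prod, auto simp only: one, auto)
  also have "\<dots> = ennreal (sqrt ((2 * pi) ^ DIM('a)))"
    by (simp only: prod_constant ennreal_power real_sqrt_power real_sqrt_ge_zero pi_ge_zero mult_nonneg_nonneg zero_le_numeral)
  finally show ?thesis .
qed

text \<open>Gram-Schmidt for the inner product of \<open>A\<close>: fewer than
  \<open>CARD('n)\<close> vectors \<open>A b_i\<close> cannot span, so some nonzero \<open>x\<close>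
  is orthogonal to all of them and is normalised in the \<open>A\<close>-norm. Indexing by subsets
  of \<open>'n\<close> lets the full family be read as a square matrix.\<close>

lemma A_orthonormal_family:
  fixes A :: "real ^ 'n ^ 'n"
  assumes sym: "\<And>x y. x \<bullet> (A *v y) = y \<bullet> (A *v x)" and pos: "\<And>x. x \<noteq> 0 \<Longrightarrow> 0 < x \<bullet> (A *v x)"
  shows "\<exists>b :: 'n \<Rightarrow> real ^ 'n. \<forall>i j. b i \<bullet> (A *v b j) = (if i = j then 1 else 0)"
proof -
  have "\<exists>b :: 'n \<Rightarrow> real ^ 'n. \<forall>i\<in>S. \<forall>j\<in>S. b i \<bullet> (A *v b j) = (if i = j then 1 else 0)" for S :: "'n set"
  proof (induction S rule: finite_induct[OF finite])
    case (2 k S)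
    then obtain b :: "'n \<Rightarrow> real ^ 'n" where b: "\<And>i j. i \<in> S \<Longrightarrow> j \<in> S \<Longrightarrow> b i \<bullet> (A *v b j) = (if i = j then 1 else 0)"
      by blast
    have "dim ((\<lambda>i. A *v b i) ` S) \<le> card ((\<lambda>i. A *v b i) ` S)"
      by (rule dim_le_card') (use 2 in auto)
    also have "\<dots> \<le> card S"
      by (rule card_image_le) (use 2 in auto)
    also have "card S < card (insert k S)"
      using 2 by simp
    also have "\<dots> \<le> DIM(real ^ 'n)"
      using card_mono[of UNIV "insert k S"] by simp
    finally obtain x where x: "x \<noteq> 0" "\<And>y. y \<in> span ((\<lambda>i. A *v b i) ` S) \<Longrightarrow> orthogonal x y"
      by (rule orthogonal_to_subspace_exists) auto
    have x_orth: "x \<bullet> (A *v b i) = 0" if "i \<in> S" for i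
      using x(2)[of "A *v b i"] that by (auto simp: orthogonal_def span_base)
    define s where "s = sqrt (x \<bullet> (A *v x))"
    have s: "0 < s" "s * s = x \<bullet> (A *v x)"
      using pos[OF x(1)] by (auto simp: s_def)
    define c where "c = b(k := (1 / s) *\<^sub>R x)"
    have ck: "c k \<bullet> (A *v c k) = 1"
      using s pos[OF x(1)] by (simp add: c_def matrix_vector_mult_scaleR field_simps)
    have cS: "c i = b i" if "i \<in> S" for i
      using that 2 by (auto simp: c_def)
    have cki: "c k \<bullet> (A *v c i) = 0" "c i \<bullet> (A *v c k) = 0" if "i \<in> S" for i
      using x_orth[OF that] sym[of "c i" "c k"] by (auto simp: cS[OF that]) (auto simp: c_def)
    have "\<forall>i\<in>insert k S. \<forall>j\<in>insert k S. c i \<bullet> (A *v c j) = (if i = j then 1 else 0)"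
      using ck cki b 2 by (auto simp: cS)
    then show ?case by blast
  qed auto
  from this[of UNIV] show ?thesis by simp
qed

lemma congruent_to_identity:
  fixes A :: "real ^ 'n ^ 'n"
  assumes sym: "\<And>x y. x \<bullet> (A *v y) = y \<bullet> (A *v x)" and pos: "\<And>x. x \<noteq> 0 \<Longrightarrow> 0 < x \<bullet> (A *v x)"
  obtains P :: "real ^ 'n ^ 'n" where "transpose P ** A ** P = mat 1"
proof -
  obtain b :: "'n \<Rightarrow> real ^ 'n" where b: "\<And>i j. b i \<bullet> (A *v b j) = (if i = j then 1 else 0)"
    using A_orthonormal_family[OF assms] by blast
  define P :: "real ^ 'n ^ 'n" where "P = (\<chi> i j. b j $ i)"
  have "(transpose P ** (A ** P)) $ i $ j = b i \<bullet> (A *v b j)" for i j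
    by (simp add: P_def matrix_matrix_mult_def matrix_vector_mult_def transpose_def inner_vec_def)
  then have "transpose P ** A ** P = mat 1"
    by (simp add: vec_eq_iff b mat_def matrix_mul_assoc)
  then show ?thesis by (rule that)
qed

context
  fixes A :: "real ^ 'n ^ 'n"
  assumes sym: "\<And>x y. x \<bullet> (A *v y) = y \<bullet> (A *v x)" and pos: "\<And>x. x \<noteq> 0 \<Longrightarrow> 0 < x \<bullet> (A *v x)"
begin

text \<open>The substitution \<open>x = P z\<close> turns the quadratic form of \<open>A\<close>
  into \<open>z \<bullet> z\<close>, and \<open>transpose P ** A ** P = mat 1\<close> forces
  \<open>(det P)^2 * det A = 1\<close>, which gives both the sign of \<open>det A\<close> and the
  Jacobian.\<close>

lemma pos_def_det: "0 < det A"
  and nn_integral_gaussian: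
  "(\<integral>\<^sup>+x. ennreal (exp (- (x \<bullet> (A *v x)) / 2)) \<partial>lborel) = ennreal (sqrt ((2 * pi) ^ CARD('n) / det A))"
proof -
  obtain P :: "real ^ 'n ^ 'n" where P: "transpose P ** A ** P = mat 1"
    using congruent_to_identity[OF sym pos] by blast
  have "det (transpose P ** A ** P) = 1"
    unfolding P by simp
  then have d: "(det P)\<^sup>2 * det A = 1"
    by (simp add: det_mul power2_eq_square mult_ac)
  show dA: "0 < det A"
    using d by (metis zero_less_one zero_less_mult_pos zero_le_power2 zero_less_power2 mult_zero_left zero_neq_one power_zero_numeral)
  have nz: "det P \<noteq> 0"
    using d by auto
  have dP: "\<bar>det P\<bar> = sqrt (1 / det A)"
    using d dA by (metis nonzero_eq_divide_eq less_irrefl real_sqrt_abs)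
  have q: "(P *v z) \<bullet> (A *v (P *v z)) = z \<bullet> z" for z
  proof -
    have "(P *v z) \<bullet> (A *v (P *v z)) = z \<bullet> ((transpose P ** A ** P) *v z)"
      by (simp add: matrix_vector_mul_assoc[symmetric] dot_lmul_matrix[symmetric] inner_commute)
        (metis dot_lmul_matrix inner_commute transpose_matrix_vector)
    then show ?thesis unfolding P by simp
  qed
  have [measurable]: "(\<lambda>x. A *v x) \<in> borel_measurable borel"
    by (intro borel_measurable_continuous_onI linear_continuous_on linear_conv_bounded_linear[THEN iffD1]) simp
  have "(\<integral>\<^sup>+x. ennreal (exp (- (x \<bullet> (A *v x)) / 2)) \<partial>lborel)
      = ennreal \<bar>det P\<bar> * (\<integral>\<^sup>+z. ennreal (exp (- ((P *v z) \<bullet> (A *v (P *v z))) / 2)) \<partial>lborel)"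
    using nz by (subst nn_integral_linear_substitution[of "(*v) P"]) auto
  also have "\<dots> = ennreal (\<bar>det P\<bar> * sqrt ((2 * pi) ^ CARD('n)))"
    unfolding q nn_integral_std_gaussian by (simp add: ennreal_mult')
  also have "\<dots> = ennreal (sqrt ((2 * pi) ^ CARD('n) / det A))"
    unfolding dP by (simp add: real_sqrt_mult[symmetric] del: real_sqrt_mult)
  finally show "(\<integral>\<^sup>+x. ennreal (exp (- (x \<bullet> (A *v x)) / 2)) \<partial>lborel) = ennreal (sqrt ((2 * pi) ^ CARD('n) / det A))" .
qed

text \<open>\<open>mvn_density\<close> is parametrised by the covariance, whereas the sampler
  supplies the precision matrix \<open>A\<close>; inverting twice passes to a form in which no
  inverse is left.\<close>

lemma mvn_density_precision:
  "mvn_density \<mu> (matrix_inv A) x = exp (- ((x - \<mu>) \<bullet> (A *v (x - \<mu>))) / 2) / sqrt ((2 * pi) ^ CARD('n) / det A)"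
proof -
  have inv: "invertible A"
    using pos_def_det by (simp add: invertible_det_nz)
  have 1: "A ** matrix_inv A = mat 1" "matrix_inv A ** A = mat 1"
    using someI_ex[OF inv[unfolded invertible_def]] unfolding matrix_inv_def by auto
  then have "invertible (matrix_inv A)"
    by (auto simp: invertible_def)
  then have "matrix_inv A ** matrix_inv (matrix_inv A) = mat 1"
    using someI_ex[of "\<lambda>B. matrix_inv A ** B = mat 1 \<and> B ** matrix_inv A = mat 1"] unfolding invertible_def matrix_inv_def[of "matrix_inv A"] by auto
  then have inv_inv: "matrix_inv (matrix_inv A) = A"
    using 1 by (metis matrix_mul_assoc matrix_mul_lid matrix_mul_rid)
  have "det A * det (matrix_inv A) = 1"
    using 1 by (metis det_I det_mul)
  then have "det (matrix_inv A) = 1 / det A"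
    using pos_def_det by (simp add: field_simps)
  then show ?thesis
    unfolding mvn_density_def inv_inv by simp
qed

lemma nn_integral_mvn_density:
  assumes f: "f \<in> borel_measurable borel"
  shows "(\<integral>\<^sup>+x. ennreal (mvn_density \<mu> (matrix_inv A) x) * f (x - \<mu>) \<partial>lborel)
    = ennreal (1 / sqrt ((2 * pi) ^ CARD('n) / det A)) * (\<integral>\<^sup>+x. ennreal (exp (- (x \<bullet> (A *v x)) / 2)) * f x \<partial>lborel)"
proof -
  note f [measurable]
  have [measurable]: "(\<lambda>x. A *v x) \<in> borel_measurable borel"
    by (intro borel_measurable_continuous_onI linear_continuous_on linear_conv_bounded_linear[THEN iffD1]) simp
  have "(\<integral>\<^sup>+x. ennreal (mvn_density \<mu> (matrix_inv A) x) * f (x - \<mu>) \<partial>lborel)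
    = (\<integral>\<^sup>+x. ennreal (mvn_density \<mu> (matrix_inv A) x) * f (x - \<mu>) \<partial>distr lborel borel ((+) \<mu>))"
    by (subst lborel_distr_plus) simp
  also have "\<dots> = (\<integral>\<^sup>+x. ennreal (1 / sqrt ((2 * pi) ^ CARD('n) / det A)) * (ennreal (exp (- (x \<bullet> (A *v x)) / 2)) * f x) \<partial>lborel)"
    unfolding mvn_density_precision using pos_def_det
    by (subst nn_integral_distr) (auto intro!: nn_integral_cong simp: ennreal_mult'[symmetric] mult.assoc[symmetric])
  also have "\<dots> = ennreal (1 / sqrt ((2 * pi) ^ CARD('n) / det A)) * (\<integral>\<^sup>+x. ennreal (exp (- (x \<bullet> (A *v x)) / 2)) * f x \<partial>lborel)"
    by (rule nn_integral_cmult) measurable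
  finally show ?thesis .
qed

lemma nn_integral_mvn_density_1:
  "(\<integral>\<^sup>+x. ennreal (mvn_density \<mu> (matrix_inv A) x) \<partial>lborel) = 1"
proof -
  have p: "0 < sqrt ((2 * pi) ^ CARD('n) / det A)"
    using pos_def_det by simp
  have "(\<integral>\<^sup>+x. ennreal (mvn_density \<mu> (matrix_inv A) x) \<partial>lborel)
      = ennreal (1 / sqrt ((2 * pi) ^ CARD('n) / det A)) * ennreal (sqrt ((2 * pi) ^ CARD('n) / det A))"
    using nn_integral_mvn_density[of "\<lambda>_. 1" \<mu>] unfolding mult_1_right nn_integral_gaussian by simp
  also have "\<dots> = ennreal (1 / sqrt ((2 * pi) ^ CARD('n) / det A) * sqrt ((2 * pi) ^ CARD('n) / det A))"
    using p by (intro ennreal_mult'[symmetric]) simp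
  also have "1 / sqrt ((2 * pi) ^ CARD('n) / det A) * sqrt ((2 * pi) ^ CARD('n) / det A) = 1"
    using less_imp_neq[OF p] by (metis nonzero_divide_eq_eq)
  finally show ?thesis
    by simp
qed

text \<open>With \<open>q\<close> the quadratic form of \<open>A\<close>, \<open>q e\<^sup>-\<^sup>q\<^sup>/\<^sup>2 \<le> 4 e\<^sup>-\<^sup>q\<^sup>/\<^sup>4\<close>, and the right-hand side is a dilated Gaussian.\<close>

lemma nn_integral_mvn_quadratic:
  "(\<integral>\<^sup>+x. ennreal (mvn_density \<mu> (matrix_inv A) x) * ennreal ((x - \<mu>) \<bullet> (A *v (x - \<mu>))) \<partial>lborel)
    \<le> ennreal (4 * sqrt 2 ^ CARD('n))"
proof -
  let ?Z = "sqrt ((2 * pi) ^ CARD('n) / det A)"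
  have p: "0 < ?Z"
    using pos_def_det by simp
  have [measurable]: "(\<lambda>x. A *v x) \<in> borel_measurable borel"
    by (intro borel_measurable_continuous_onI linear_continuous_on linear_conv_bounded_linear[THEN iffD1]) simp
  have nn: "0 \<le> x \<bullet> (A *v x)" for x
    using pos[of x] by (cases "x = 0") auto
  have "(\<integral>\<^sup>+x. ennreal (exp (- (x \<bullet> (A *v x)) / 2)) * ennreal (x \<bullet> (A *v x)) \<partial>lborel)
      \<le> (\<integral>\<^sup>+x. ennreal 4 * ennreal (exp (- (x \<bullet> (A *v x)) / 4)) \<partial>lborel)"
  proof (rule nn_integral_mono)
    fix x
    let ?q = "x \<bullet> (A *v x)"
    have "1 + ?q / 4 \<le> exp (?q / 4)"
      by (rule exp_ge_add_one_self)
    then have "?q \<le> 4 * exp (?q / 4)"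
      by linarith
    then have "exp (- ?q / 2) * ?q \<le> exp (- ?q / 2) * (4 * exp (?q / 4))"
      by (intro mult_left_mono) auto
    also have "\<dots> = 4 * exp (- ?q / 4)"
      by (simp flip: exp_add)
    finally have "ennreal (exp (- ?q / 2) * ?q) \<le> ennreal (4 * exp (- ?q / 4))"
      by (rule ennreal_leI)
    then show "ennreal (exp (- ?q / 2)) * ennreal ?q \<le> ennreal 4 * ennreal (exp (- ?q / 4))"
      using nn[of x] by (simp only: ennreal_mult'[symmetric] exp_ge_zero zero_le_numeral)
  qed
  also have "\<dots> = ennreal 4 * (\<integral>\<^sup>+x. ennreal (exp (- (x \<bullet> (A *v x)) / 4)) \<partial>lborel)"
    by (rule nn_integral_cmult) measurable
  also have "(\<integral>\<^sup>+x. ennreal (exp (- (x \<bullet> (A *v x)) / 4)) \<partial>lborel)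
      = ennreal (sqrt 2 ^ CARD('n)) * (\<integral>\<^sup>+x. ennreal (exp (- (x \<bullet> (A *v x)) / 2)) \<partial>lborel)"
  proof -
    have "lborel = density (distr lborel borel (\<lambda>x :: real ^ 'n. 0 + sqrt 2 *\<^sub>R x)) (\<lambda>_. \<bar>sqrt 2\<bar> ^ DIM(real ^ 'n))"
      by (rule lborel_affine) simp
    then have l: "lborel = density (distr lborel borel (\<lambda>x :: real ^ 'n. sqrt 2 *\<^sub>R x)) (\<lambda>_. ennreal (sqrt 2 ^ CARD('n)))"
      by simp
    have [simp]: "sqrt 2 * (sqrt 2 * t) = 2 * t" for t
      by (simp add: mult.assoc[symmetric])
    show ?thesis
      by (subst l) (simp add: nn_integral_density nn_integral_distr nn_integral_cmult matrix_vector_mult_scaleR)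
  qed
  also have "\<dots> = ennreal (sqrt 2 ^ CARD('n)) * ennreal ?Z"
    unfolding nn_integral_gaussian ..
  finally have "(\<integral>\<^sup>+x. ennreal (exp (- (x \<bullet> (A *v x)) / 2)) * ennreal (x \<bullet> (A *v x)) \<partial>lborel)
      \<le> ennreal 4 * (ennreal (sqrt 2 ^ CARD('n)) * ennreal ?Z)" .
  then have "(\<integral>\<^sup>+x. ennreal (mvn_density \<mu> (matrix_inv A) x) * ennreal ((x - \<mu>) \<bullet> (A *v (x - \<mu>))) \<partial>lborel)
      \<le> ennreal (1 / ?Z) * (ennreal 4 * (ennreal (sqrt 2 ^ CARD('n)) * ennreal ?Z))"
    by (subst nn_integral_mvn_density[of "\<lambda>x. ennreal (x \<bullet> (A *v x))"]) (auto intro!: mult_left_mono)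
  also have "\<dots> = ennreal (1 / ?Z * (4 * (sqrt 2 ^ CARD('n) * ?Z)))"
    using p by (simp only: ennreal_mult'[symmetric] zero_le_power real_sqrt_ge_zero zero_le_numeral less_imp_le zero_le_divide_1_iff)
  also have "1 / z * (4 * (c * z)) = 4 * c" if "0 < z" for c z :: real
    using that by simp
  note this[OF p]
  finally show ?thesis .
qed

end

section \<open>Harris' theorem\<close>

text \<open>Drift is stated with the nonnegative integral, so that integrability of \<open>V\<close>
  is a consequence. The condition \<open>2 * L < (1 - \<gamma>) * R\<close> makes the minorized
  sublevel set so large that pairs with \<open>V x + V y > R\<close> contract by drift
  alone.\<close>

locale harris_kernel =
  fixes M N :: "'a measure" and K :: "'a \<Rightarrow> 'a measure" and V :: "'a \<Rightarrow> real"
    and \<gamma> L R \<alpha> :: real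
  assumes kernel: "K \<in> M \<rightarrow>\<^sub>M prob_algebra M"
    and V_measurable: "V \<in> borel_measurable M"
    and V_nonneg: "x \<in> space M \<Longrightarrow> 0 \<le> V x"
    and const: "0 \<le> \<gamma>" "\<gamma> < 1" "0 < L" "0 < \<alpha>" "2 * L < (1 - \<gamma>) * R"
    and drift: "x \<in> space M \<Longrightarrow> (\<integral>\<^sup>+z. ennreal (V z) \<partial>K x) \<le> ennreal (\<gamma> * V x + L)"
    and N: "N \<in> space (prob_algebra M)"
    and minor: "x \<in> space M \<Longrightarrow> V x \<le> R \<Longrightarrow> A \<in> sets M \<Longrightarrow>
      ennreal \<alpha> * emeasure N A \<le> emeasure (K x) A"
begin

declare V_measurable [measurable]

lemma R_pos: "0 < R"
  using const by (smt (verit) zero_less_mult_iff)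

lemma kernel_D:
  assumes "x \<in> space M"
  shows "prob_space (K x)" "sets (K x) = sets M" "space (K x) = space M"
proof -
  have "K x \<in> space (prob_algebra M)"
    using kernel assms by (rule measurable_space)
  then show "prob_space (K x)" and s: "sets (K x) = sets M"
    by (auto simp: space_prob_algebra)
  show "space (K x) = space M"
    using s by (rule sets_eq_imp_space_eq)
qed

lemma borel_measurable_kernel_iff [simp]:
  "x \<in> space M \<Longrightarrow> borel_measurable (K x) = borel_measurable M"
  by (rule measurable_cong_sets) (simp_all add: kernel_D)

lemma N_D: "prob_space N" "sets N = sets M" "space N = space M"
  using N sets_eq_imp_space_eq[of N M] by (auto simp: space_prob_algebra)

lemma borel_measurable_N_iff [simp]: "borel_measurable N = borel_measurable M"
  by (rule measurable_cong_sets) (simp_all add: N_D)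

lemma V_integrable:
  assumes "x \<in> space M"
  shows "integrable (K x) V" and "(\<integral>z. V z \<partial>K x) \<le> \<gamma> * V x + L"
proof -
  have ae: "AE z in K x. 0 \<le> V z"
    by (rule AE_I2) (simp add: kernel_D assms V_nonneg)
  have fin: "(\<integral>\<^sup>+z. ennreal (V z) \<partial>K x) < \<infinity>"
    using drift[OF assms] by (rule le_less_trans) simp
  show int: "integrable (K x) V"
    using fin ae assms by (intro integrableI_nonneg) auto
  have "ennreal (\<integral>z. V z \<partial>K x) \<le> ennreal (\<gamma> * V x + L)"
    using nn_integral_eq_integral[OF int ae] drift[OF assms] by simp
  then show "(\<integral>z. V z \<partial>K x) \<le> \<gamma> * V x + L"
    using const V_nonneg[OF assms] by (subst (asm) ennreal_le_iff) auto
qed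

text \<open>Minorization on sets is an inequality of measures, \<open>\<alpha> N \<le> K x\<close>,
  and so passes to nonnegative functions; it also transfers integrability from \<open>K x\<close> to
  \<open>N\<close>.\<close>

lemma minor_integral:
  assumes x: "x \<in> space M" "V x \<le> R"
    and f: "integrable (K x) f" and nn: "\<And>z. z \<in> space M \<Longrightarrow> 0 \<le> f z"
  shows "integrable N f" and "\<alpha> * (\<integral>z. f z \<partial>N) \<le> (\<integral>z. f z \<partial>K x)"
proof -
  have fm [measurable]: "f \<in> borel_measurable M"
    using f x by auto
  have le: "scale_measure (ennreal \<alpha>) N \<le> K x"
    using x minor by (subst le_measure) (auto simp: N_D kernel_D)
  have "ennreal \<alpha> * (\<integral>\<^sup>+z. ennreal (f z) \<partial>N) = (\<integral>\<^sup>+z. ennreal (f z) \<partial>scale_measure (ennreal \<alpha>) N)"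
    by (subst nn_integral_scale_measure) auto
  also have "\<dots> \<le> (\<integral>\<^sup>+z. ennreal (f z) \<partial>K x)"
    by (rule nn_integral_mono_measure[OF _ le]) (simp add: N_D kernel_D x)
  also have "\<dots> = ennreal (\<integral>z. f z \<partial>K x)"
    by (rule nn_integral_eq_integral[OF f]) (rule AE_I2, simp add: kernel_D x nn)
  finally have *: "ennreal \<alpha> * (\<integral>\<^sup>+z. ennreal (f z) \<partial>N) \<le> ennreal (\<integral>z. f z \<partial>K x)" .
  have aeN: "AE z in N. 0 \<le> f z"
    by (rule AE_I2) (simp add: N_D nn)
  have "(\<integral>\<^sup>+z. ennreal (f z) \<partial>N) \<noteq> \<infinity>"
  proof
    assume "(\<integral>\<^sup>+z. ennreal (f z) \<partial>N) = \<infinity>"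
    then have "ennreal \<alpha> * (\<integral>\<^sup>+z. ennreal (f z) \<partial>N) = \<infinity>"
      using const by (simp add: ennreal_mult_top)
    then show False using * by (simp add: top_unique)
  qed
  then show int: "integrable N f"
    using aeN by (intro integrableI_nonneg) (auto simp: less_top)
  have "ennreal (\<alpha> * (\<integral>z. f z \<partial>N)) \<le> ennreal (\<integral>z. f z \<partial>K x)"
    using * nn_integral_eq_integral[OF int aeN] const by (simp add: ennreal_mult')
  moreover have "0 \<le> (\<integral>z. f z \<partial>K x)"
    by (rule integral_nonneg_AE) (rule AE_I2, simp add: kernel_D x nn)
  ultimately show "\<alpha> * (\<integral>z. f z \<partial>N) \<le> (\<integral>z. f z \<partial>K x)"
    by (simp add: ennreal_le_iff)
qed

text \<open>Two drift bounds add \<open>2 * wt * L\<close>, minorization removes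
  \<open>2 * \<alpha>\<close>. This weight makes the cost equal to \<open>\<alpha>\<close>, so half
  of the gain survives as the factor \<open>1 - \<alpha> / 2\<close> on the constant 2.\<close>

definition wt :: real where "wt = \<alpha> / (2 * L)"

text \<open>The first entry is the quotient for far pairs at \<open>V x + V y = R\<close>, the
  second bounds the constant part for near pairs, and \<open>\<gamma>\<close> the part linear in
  \<open>V\<close> in both cases.\<close>

definition rate :: real where
  "rate = max ((2 + wt * \<gamma> * R + 2 * wt * L) / (2 + wt * R)) (max (1 - \<alpha> / 2) \<gamma>)"

lemma wt_pos: "0 < wt"
  using const by (simp add: wt_def)

lemma rate_bounds: "0 < rate" "rate < 1"
proof -
  have 1: "0 < 2 + wt * R"
    using wt_pos R_pos by (simp add: add_pos_pos)
  have "0 < (2 + wt * \<gamma> * R + 2 * wt * L) / (2 + wt * R)"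
    using wt_pos R_pos const 1 by (intro divide_pos_pos add_pos_nonneg) auto
  then show "0 < rate"
    by (simp add: rate_def less_max_iff_disj)
  have "wt * (2 * L) < wt * ((1 - \<gamma>) * R)"
    using wt_pos const by (intro mult_strict_left_mono) auto
  then have "(2 + wt * \<gamma> * R + 2 * wt * L) / (2 + wt * R) < 1"
    using 1 by (simp add: field_simps)
  then show "rate < 1"
    using const by (simp add: rate_def)
qed

lemma rate_far:
  assumes "R \<le> S"
  shows "2 + wt * \<gamma> * S + 2 * wt * L \<le> rate * (2 + wt * S)"
proof -
  have 1: "0 < 2 + wt * R"
    using wt_pos R_pos by (simp add: add_pos_pos)
  have "(2 + wt * \<gamma> * R + 2 * wt * L) / (2 + wt * R) \<le> rate"
    by (simp add: rate_def)
  then have "2 + wt * \<gamma> * R + 2 * wt * L \<le> rate * (2 + wt * R)"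
    using 1 by (simp add: field_simps)
  moreover have "(wt * \<gamma>) * (S - R) \<le> (rate * wt) * (S - R)"
    using assms wt_pos by (intro mult_right_mono) (auto simp: rate_def)
  ultimately show ?thesis
    by (simp add: algebra_simps)
qed

lemma rate_near:
  assumes "0 \<le> S"
  shows "2 * (1 - \<alpha>) + wt * \<gamma> * S + 2 * wt * L \<le> rate * (2 + wt * S)"
proof -
  have "2 * wt * L = \<alpha>"
    using const by (simp add: wt_def)
  moreover have "1 - \<alpha> / 2 \<le> rate"
    by (simp add: rate_def)
  moreover have "\<gamma> * (wt * S) \<le> rate * (wt * S)"
    using assms wt_pos by (intro mult_right_mono) (auto simp: rate_def)
  ultimately show ?thesis
    by (simp add: algebra_simps)
qed

text \<open>After shifting \<open>f\<close> by a constant, a bound on its weighted oscillation becomes a bound on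
  its weighted absolute value.\<close>

lemma weighted_oscillation_contracts:
  assumes f [measurable]: "f \<in> borel_measurable M"
    and bdd: "\<And>x. x \<in> space M \<Longrightarrow> \<bar>f x\<bar> \<le> B"
    and s: "0 \<le> s"
    and osc: "\<And>x y. x \<in> space M \<Longrightarrow> y \<in> space M \<Longrightarrow> f x - f y \<le> s * (2 + wt * V x + wt * V y)"
    and xy: "x \<in> space M" "y \<in> space M"
  shows "(\<integral>z. f z \<partial>K x) - (\<integral>z. f z \<partial>K y) \<le> rate * s * (2 + wt * V x + wt * V y)"
proof -
  define W where "W z = s * (1 + wt * V z)" for z
  \<comment> \<open>The largest constant for which \<open>f + c \<le> W\<close>; the oscillation
    bound is precisely what makes \<open>- W \<le> f + c\<close> hold as well.\<close>
  define c where "c = (INF z\<in>space M. W z - f z)"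
  define g where "g z = f z + c" for z
  have ne: "space M \<noteq> {}"
    using xy by auto
  have W_nonneg: "0 \<le> W z" if "z \<in> space M" for z
    using s wt_pos V_nonneg[OF that] by (auto simp: W_def)
  have osc': "f u - W u \<le> W v + f v" "f u - f v \<le> W u + W v"
    if "u \<in> space M" "v \<in> space M" for u v
    using osc[OF that] by (auto simp: W_def algebra_simps)
  have bb: "bdd_below ((\<lambda>z. W z - f z) ` space M)"
    using bdd W_nonneg by (intro bdd_belowI2[of _ "-B"]) (smt (verit))
  have upper: "g z \<le> W z" if "z \<in> space M" for z
    using cINF_lower[OF bb that] by (simp add: g_def c_def)
  have lower: "- W z \<le> g z" if z: "z \<in> space M" for z
  proof -
    have "- f z - W z \<le> c"
      unfolding c_def using ne osc'(2)[OF _ z] osc'(2)[OF z] by (intro cINF_greatest) (auto simp: algebra_simps)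
    then show ?thesis
      by (simp add: g_def)
  qed
  have int_f: "integrable (K z) f" if "z \<in> space M" for z
  proof -
    interpret prob_space "K z"
      using that by (rule kernel_D)
    show ?thesis
      using that bdd by (intro integrable_const_bound[of _ B]) (auto simp: kernel_D)
  qed
  have int_W: "integrable (K z) W" and W_le: "(\<integral>u. W u \<partial>K z) \<le> s * (1 + wt * (\<gamma> * V z + L))"
    if z: "z \<in> space M" for z
  proof -
    interpret prob_space "K z"
      using that by (rule kernel_D)
    show "integrable (K z) W"
      unfolding W_def using V_integrable(1)[OF z] by auto
    have "(\<integral>u. W u \<partial>K z) = s * (1 + wt * (\<integral>u. V u \<partial>K z))"
      unfolding W_def using V_integrable(1)[OF z] by (simp add: prob_space)
    also have "\<dots> \<le> s * (1 + wt * (\<gamma> * V z + L))"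
      using V_integrable(2)[OF z] s wt_pos by (intro mult_left_mono add_left_mono) auto
    finally show "(\<integral>u. W u \<partial>K z) \<le> s * (1 + wt * (\<gamma> * V z + L))" .
  qed
  have int_g: "integrable (K z) g" and g_eq: "(\<integral>u. g u \<partial>K z) = (\<integral>u. f u \<partial>K z) + c"
    if z: "z \<in> space M" for z
  proof -
    interpret prob_space "K z"
      using that by (rule kernel_D)
    show "integrable (K z) g"
      unfolding g_def using int_f[OF z] by auto
    show "(\<integral>u. g u \<partial>K z) = (\<integral>u. f u \<partial>K z) + c"
      unfolding g_def using int_f[OF z] by (simp add: prob_space)
  qed
  have up: "(\<integral>u. g u \<partial>K z) \<le> (\<integral>u. W u \<partial>K z)" if z: "z \<in> space M" for z
    using int_g[OF z] int_W[OF z] upper z by (intro integral_mono) (auto simp: kernel_D)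
  have lo: "- (\<integral>u. W u \<partial>K z) \<le> (\<integral>u. g u \<partial>K z)" if z: "z \<in> space M" for z
  proof -
    have "(\<integral>u. - W u \<partial>K z) \<le> (\<integral>u. g u \<partial>K z)"
      using int_g[OF z] int_W[OF z] lower z by (intro integral_mono) (auto simp: kernel_D)
    then show ?thesis by simp
  qed
  have diff: "(\<integral>z. f z \<partial>K x) - (\<integral>z. f z \<partial>K y) = (\<integral>u. g u \<partial>K x) - (\<integral>u. g u \<partial>K y)"
    using xy by (simp add: g_eq)
  show ?thesis
  proof (cases "V x + V y \<le> R")
    case False
    have "(\<integral>u. g u \<partial>K x) - (\<integral>u. g u \<partial>K y) \<le> s * (1 + wt * (\<gamma> * V x + L)) + s * (1 + wt * (\<gamma> * V y + L))"
      using up[OF xy(1)] lo[OF xy(2)] W_le[OF xy(1)] W_le[OF xy(2)] by linarith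
    also have "\<dots> = s * (2 + wt * \<gamma> * (V x + V y) + 2 * wt * L)"
      by (simp add: algebra_simps)
    also have "\<dots> \<le> s * (rate * (2 + wt * (V x + V y)))"
      using False s by (intro mult_left_mono rate_far) auto
    finally show ?thesis
      unfolding diff by (simp add: algebra_simps)
  next
    case True
    then have R: "V x \<le> R" "V y \<le> R"
      using V_nonneg[OF xy(1)] V_nonneg[OF xy(2)] by auto
    \<comment> \<open>Minorization applies to nonnegative functions, so it is used for
      \<open>W - g\<close> at \<open>x\<close> and for \<open>W + g\<close> at \<open>y\<close>. On
      adding the two, the integrals of \<open>g\<close> under \<open>N\<close> cancel, and twice
      \<open>\<alpha>\<close> times the integral of \<open>W\<close> under \<open>N\<close> is
      gained, which is at least \<open>2 * \<alpha> * s\<close>.\<close>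
    note minW = minor_integral[of x "\<lambda>z. W z - g z", OF xy(1) R(1)
        Bochner_Integration.integrable_diff[OF int_W[OF xy(1)] int_g[OF xy(1)]]]
    have minW: "integrable N (\<lambda>z. W z - g z)" "\<alpha> * (\<integral>u. W u - g u \<partial>N) \<le> (\<integral>u. W u - g u \<partial>K x)"
      using upper by (auto intro!: minW simp del: Bochner_Integration.integral_diff)
    note minW' = minor_integral[of y "\<lambda>z. W z + g z", OF xy(2) R(2)
        Bochner_Integration.integrable_add[OF int_W[OF xy(2)] int_g[OF xy(2)]]]
    have "0 \<le> W z + g z" if "z \<in> space M" for z
      using lower[OF that] by simp
    then have minW': "integrable N (\<lambda>z. W z + g z)" "\<alpha> * (\<integral>u. W u + g u \<partial>N) \<le> (\<integral>u. W u + g u \<partial>K y)"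
      by (auto intro!: minW' simp del: Bochner_Integration.integral_add)
    interpret N: prob_space N
      by (rule N_D)
    have "integrable N (\<lambda>z. (1/2) * ((W z - g z) + (W z + g z)))"
      by (intro integrable_mult_right Bochner_Integration.integrable_add minW(1) minW'(1))
    then have NW: "integrable N W"
      by simp
    have "integrable N (\<lambda>z. W z - (W z - g z))"
      by (intro Bochner_Integration.integrable_diff NW minW(1))
    then have Ng: "integrable N g"
      by simp
    have N_ge: "s \<le> (\<integral>u. W u \<partial>N)"
    proof -
      have "s \<le> W z" if "z \<in> space M" for z
        using V_nonneg[OF that] wt_pos s by (auto simp: W_def algebra_simps)
      then have "(\<integral>u. s \<partial>N) \<le> (\<integral>u. W u \<partial>N)"
        using NW by (intro integral_mono) (auto simp: N_D)
      then show ?thesis by (simp add: N.prob_space)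
    qed
    have "(\<integral>u. g u \<partial>K x) - \<alpha> * (\<integral>u. g u \<partial>N) \<le> (\<integral>u. W u \<partial>K x) - \<alpha> * (\<integral>u. W u \<partial>N)"
      using minW(2) NW Ng int_g[OF xy(1)] int_W[OF xy(1)] by (simp add: algebra_simps)
    moreover have "- (\<integral>u. g u \<partial>K y) + \<alpha> * (\<integral>u. g u \<partial>N) \<le> (\<integral>u. W u \<partial>K y) - \<alpha> * (\<integral>u. W u \<partial>N)"
      using minW'(2) NW Ng int_g[OF xy(2)] int_W[OF xy(2)] by (simp add: algebra_simps)
    moreover have "\<alpha> * s \<le> \<alpha> * (\<integral>u. W u \<partial>N)"
      using N_ge const by (intro mult_left_mono) auto
    ultimately have "(\<integral>u. g u \<partial>K x) - (\<integral>u. g u \<partial>K y)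
        \<le> s * (1 + wt * (\<gamma> * V x + L)) + s * (1 + wt * (\<gamma> * V y + L)) - 2 * (\<alpha> * s)"
      using W_le[OF xy(1)] W_le[OF xy(2)] by linarith
    also have "\<dots> = s * (2 * (1 - \<alpha>) + wt * \<gamma> * (V x + V y) + 2 * wt * L)"
      by (simp add: algebra_simps)
    also have "\<dots> \<le> s * (rate * (2 + wt * (V x + V y)))"
      using s V_nonneg xy by (intro mult_left_mono rate_near) auto
    finally show ?thesis
      unfolding diff by (simp add: algebra_simps)
  qed
qed


section \<open>Powers of the kernel and their limit\<close>

lemma kernel_pow_properties:
  assumes A: "A \<in> sets M"
  shows "(\<lambda>x. kernel_pow K m x A) \<in> borel_measurable M"
    and "x \<in> space M \<Longrightarrow> kernel_pow K m x A \<le> 1"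
proof (induction m arbitrary: x)
  case 0
  {
    case 1
    show ?case using A by simp
  next
    case 2
    show ?case by (simp add: indicator_def)
  }
next
  case (Suc m)
  {
    case 1
    have "(\<lambda>x. \<integral>\<^sup>+z. kernel_pow K m z A \<partial>K x) \<in> borel_measurable M"
      using Suc.IH(1) kernel by (intro nn_integral_measurable_subprob_algebra2[where N=M])
        (auto simp: measurable_prob_algebraD)
    then show ?case by simp
  next
    case 2
    then interpret prob_space "K x"
      by (rule kernel_D)
    have "(\<integral>\<^sup>+z. kernel_pow K m z A \<partial>K x) \<le> (\<integral>\<^sup>+z. 1 \<partial>K x)"
      using Suc.IH(2) 2 by (intro nn_integral_mono) (auto simp: kernel_D)
    then show ?case by (simp add: emeasure_space_1)
  }
qed

lemma kernel_pow_Suc_integral: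
  assumes A: "A \<in> sets M" and x: "x \<in> space M"
  shows "enn2real (kernel_pow K (Suc m) x A) = (\<integral>z. enn2real (kernel_pow K m z A) \<partial>K x)"
proof -
  have "(\<integral>z. enn2real (kernel_pow K m z A) \<partial>K x)
      = enn2real (\<integral>\<^sup>+z. ennreal (enn2real (kernel_pow K m z A)) \<partial>K x)"
    using kernel_pow_properties(1)[OF A, of m] x by (intro integral_eq_nn_integral) auto
  also have "(\<integral>\<^sup>+z. ennreal (enn2real (kernel_pow K m z A)) \<partial>K x) = (\<integral>\<^sup>+z. kernel_pow K m z A \<partial>K x)"
    using kernel_pow_properties(2)[OF A, of _ m] x
    by (intro nn_integral_cong) (auto simp: kernel_D intro!: ennreal_enn2real le_less_trans[OF _ ennreal_one_less_top])
  finally show ?thesis by simp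
qed

text \<open>\<open>kernel_pow\<close> splits off the first step, so raising the power applies
  \<open>K\<close> once to the function \<open>kernel_pow K m _ A\<close>, and each step contributes
  one factor \<open>rate\<close>. An indicator oscillates by at most 1, below the initial 2. The
  bound is uniform in \<open>A\<close>, as the final supremum requires.\<close>

lemma kernel_pow_oscillation:
  assumes A: "A \<in> sets M" and xy: "x \<in> space M" "y \<in> space M"
  shows "enn2real (kernel_pow K m x A) - enn2real (kernel_pow K m y A)
    \<le> rate ^ m * (2 + wt * V x + wt * V y)"
  using xy
proof (induction m arbitrary: x y)
  case 0
  have "0 \<le> wt * V x" "0 \<le> wt * V y"
    using wt_pos V_nonneg 0 by auto
  then have "(indicator A x :: real) - indicator A y \<le> 2 + wt * V x + wt * V y"
    by (simp add: indicator_def)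
  then show ?case
    by (auto simp: indicator_def)
next
  case (Suc m)
  have "\<bar>enn2real (kernel_pow K m z A)\<bar> \<le> 1" if "z \<in> space M" for z
    using enn2real_mono[OF kernel_pow_properties(2)[OF A that, of m]] by simp
  then show ?case
    unfolding kernel_pow_Suc_integral[OF A Suc.prems(1)] kernel_pow_Suc_integral[OF A Suc.prems(2)]
    using weighted_oscillation_contracts[OF _ _ _ Suc.IH Suc.prems(1) Suc.prems(2), of 1]
      kernel_pow_properties(1)[OF A, of m] rate_bounds
    by simp
qed

text \<open>Truncating at height \<open>c\<close> keeps all integrals finite before the integrability of \<open>V\<close> is known:
  \<open>\<integral> min (V, c) \<le> \<integral> min (\<gamma> V + L, c)\<close> by invariance and Jensen, so \<open>(1 - \<gamma>) \<integral> V 1{V \<le> c} \<le> L\<close>.\<close>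

lemma invariant_integral_V:
  assumes P: "P \<in> space (prob_algebra M)" and inv: "P \<bind> K = P"
  shows "(\<integral>\<^sup>+x. ennreal (V x) \<partial>P) \<le> ennreal (L / (1 - \<gamma>))"
proof -
  interpret P: prob_space P
    using P by (simp add: space_prob_algebra)
  have sP: "sets P = sets M" "space P = space M"
    using P sets_eq_imp_space_eq[of P M] by (auto simp: space_prob_algebra)
  have mP [simp]: "borel_measurable P = borel_measurable M"
    by (rule measurable_cong_sets) (simp_all add: sP)
  have K: "K \<in> P \<rightarrow>\<^sub>M subprob_algebra M"
    using measurable_prob_algebraD[OF kernel] by (simp cong: measurable_cong_sets add: sP)
  have trunc: "(\<integral>\<^sup>+x. ennreal (V x * indicator {x. V x \<le> real c} x) \<partial>P) \<le> ennreal (L / (1 - \<gamma>))" for c :: nat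
  proof -
    let ?I = "\<lambda>x. V x * indicator {x. V x \<le> real c} x"
    have bounded: "integrable P f" if "f \<in> borel_measurable M" "\<And>x. x \<in> space M \<Longrightarrow> 0 \<le> f x \<and> f x \<le> real c" for f
      using that by (intro P.integrable_const_bound[of _ "real c"]) (auto simp: sP)
    have i1: "integrable P (\<lambda>x. min (V x) c)"
      using V_nonneg by (intro bounded) auto
    have i2: "integrable P (\<lambda>x. min (\<gamma> * V x + L) c)"
      using V_nonneg const by (intro bounded) (auto intro!: add_nonneg_nonneg)
    have i3: "integrable P ?I"
      using V_nonneg by (intro bounded) (auto split: split_indicator)
    have "(\<integral>\<^sup>+x. ennreal (min (V x) c) \<partial>P) = (\<integral>\<^sup>+x. \<integral>\<^sup>+z. ennreal (min (V z) c) \<partial>K x \<partial>P)"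
      using nn_integral_bind[OF _ K, of "\<lambda>x. ennreal (min (V x) c)"] inv by simp
    also have "\<dots> \<le> (\<integral>\<^sup>+x. ennreal (min (\<gamma> * V x + L) c) \<partial>P)"
    proof (rule nn_integral_mono)
      fix x assume "x \<in> space P"
      then have x: "x \<in> space M" by (simp add: sP)
      interpret Kx: prob_space "K x"
        using x by (rule kernel_D)
      have "(\<integral>\<^sup>+z. ennreal (min (V z) c) \<partial>K x) \<le> (\<integral>\<^sup>+z. ennreal (V z) \<partial>K x)"
        by (intro nn_integral_mono ennreal_leI) auto
      then have 1: "(\<integral>\<^sup>+z. ennreal (min (V z) c) \<partial>K x) \<le> ennreal (\<gamma> * V x + L)"
        using drift[OF x] by (rule order_trans)
      have "(\<integral>\<^sup>+z. ennreal (min (V z) c) \<partial>K x) \<le> (\<integral>\<^sup>+z. ennreal c \<partial>K x)"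
        by (intro nn_integral_mono ennreal_leI) auto
      then have "(\<integral>\<^sup>+z. ennreal (min (V z) c) \<partial>K x) \<le> ennreal c"
        by (simp add: Kx.emeasure_space_1)
      with 1 show "(\<integral>\<^sup>+z. ennreal (min (V z) c) \<partial>K x) \<le> ennreal (min (\<gamma> * V x + L) c)"
        by (simp add: min_def)
    qed
    finally have "(\<integral>x. min (V x) c \<partial>P) \<le> (\<integral>x. min (\<gamma> * V x + L) c \<partial>P)"
      using i1 i2 V_nonneg const by (subst (asm) (1 2) nn_integral_eq_integral)
        (auto simp: sP intro!: AE_I2 add_nonneg_nonneg integral_nonneg_AE elim!: ennreal_le_iff[THEN iffD1, rotated])
    \<comment> \<open>On \<open>V \<le> c\<close> the truncated difference is at least
      \<open>(1 - \<gamma>) * V - L\<close>; elsewhere it is nonnegative while the left side is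
      \<open>- L\<close>.\<close>
    moreover have "(\<integral>x. (1 - \<gamma>) * ?I x - L \<partial>P) \<le> (\<integral>x. min (V x) c - min (\<gamma> * V x + L) c \<partial>P)"
    proof (rule integral_mono)
      fix x assume "x \<in> space P"
      then have "0 \<le> V x" by (simp add: sP V_nonneg)
      then show "(1 - \<gamma>) * ?I x - L \<le> min (V x) c - min (\<gamma> * V x + L) c"
        using const by (auto split: split_indicator simp: algebra_simps min_def)
    qed (use i1 i2 i3 in auto)
    ultimately have "(1 - \<gamma>) * (\<integral>x. ?I x \<partial>P) \<le> L"
      using i1 i2 i3 by (simp add: P.prob_space)
    then have "(\<integral>x. ?I x \<partial>P) \<le> L / (1 - \<gamma>)"
      using const by (simp add: field_simps)
    then show ?thesis
      using i3 V_nonneg by (subst nn_integral_eq_integral) (auto simp: sP intro!: AE_I2 ennreal_leI)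
  qed
  have "ennreal (V x) = (SUP c. ennreal (V x * indicator {x. V x \<le> real c} x))" for x
  proof (rule antisym)
    obtain c :: nat where "V x \<le> real c"
      using real_arch_simple by blast
    then show "ennreal (V x) \<le> (SUP c. ennreal (V x * indicator {x. V x \<le> real c} x))"
      by (intro SUP_upper2[of c]) auto
  qed (auto intro!: SUP_least ennreal_leI split: split_indicator simp: ennreal_neg)
  then have "(\<integral>\<^sup>+x. ennreal (V x) \<partial>P) = (\<integral>\<^sup>+x. (SUP c. ennreal (V x * indicator {x. V x \<le> real c} x)) \<partial>P)"
    by simp
  also have "\<dots> = (SUP c. \<integral>\<^sup>+x. ennreal (V x * indicator {x. V x \<le> real c} x) \<partial>P)"
    using V_nonneg by (intro nn_integral_monotone_convergence_SUP_AE)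
      (auto intro!: AE_I2 ennreal_leI split: split_indicator simp: sP)
  also have "\<dots> \<le> ennreal (L / (1 - \<gamma>))"
    by (intro SUP_least trunc)
  finally show ?thesis .
qed

lemma invariant_kernel_pow:
  assumes P: "P \<in> space (prob_algebra M)" and inv: "P \<bind> K = P" and A: "A \<in> sets M"
  shows "(\<integral>\<^sup>+x. kernel_pow K m x A \<partial>P) = emeasure P A"
proof -
  have sP: "sets P = sets M"
    using P by (auto simp: space_prob_algebra)
  have K: "K \<in> P \<rightarrow>\<^sub>M subprob_algebra M"
    using measurable_prob_algebraD[OF kernel] by (simp cong: measurable_cong_sets add: sP)
  show ?thesis
  proof (induction m)
    case 0
    then show ?case using A by (simp add: sP)
  next
    case (Suc m)
    then show ?case
      using nn_integral_bind[OF kernel_pow_properties(1)[OF A, of m] K] inv by simp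
  qed
qed

text \<open>By invariance \<open>emeasure P A\<close> is the \<open>P\<close>-average of the
  \<open>m\<close>-step probabilities, so the oscillation bound is averaged over its second point;
  the mean of \<open>V\<close> under \<open>P\<close> enters as
  \<open>L / (1 - \<gamma>)\<close>.\<close>

theorem geometrically_ergodic:
  assumes P: "P \<in> space (prob_algebra M)" and inv: "P \<bind> K = P" and A: "A \<in> sets M"
    and x: "x \<in> space M"
  shows "\<bar>enn2ereal (kernel_pow K m x A) - enn2ereal (emeasure P A)\<bar>
    \<le> ereal ((2 + wt * V x + wt * (L / (1 - \<gamma>))) * rate ^ m)"
proof -
  interpret P: prob_space P
    using P by (simp add: space_prob_algebra)
  have sP: "sets P = sets M" "space P = space M"
    using P sets_eq_imp_space_eq[of P M] by (auto simp: space_prob_algebra)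
  have mP [simp]: "borel_measurable P = borel_measurable M"
    by (rule measurable_cong_sets) (simp_all add: sP)
  let ?f = "\<lambda>x. enn2real (kernel_pow K m x A)"
  have le1: "kernel_pow K m z A \<le> 1" if "z \<in> space M" for z
    using that by (rule kernel_pow_properties[OF A])
  have f_bounds: "0 \<le> ?f z" "?f z \<le> 1" if "z \<in> space M" for z
    using enn2real_mono[OF le1[OF that]] by simp_all
  have f_eq: "kernel_pow K m z A = ennreal (?f z)" if "z \<in> space M" for z
    using le1[OF that] by (auto intro!: ennreal_enn2real[symmetric] le_less_trans[OF _ ennreal_one_less_top])
  have f_int: "integrable P ?f"
    using kernel_pow_properties(1)[OF A, of m] f_bounds
    by (intro P.integrable_const_bound[of _ 1]) (auto simp: sP)
  have "emeasure P A = (\<integral>\<^sup>+x. ennreal (?f x) \<partial>P)"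
    unfolding invariant_kernel_pow[OF P inv A, of m, symmetric]
    using f_eq by (intro nn_integral_cong) (simp add: sP)
  also have "\<dots> = ennreal (\<integral>x. ?f x \<partial>P)"
    using f_int by (intro nn_integral_eq_integral) auto
  finally have PA: "emeasure P A = ennreal (\<integral>x. ?f x \<partial>P)" .
  have VP: "integrable P V" "(\<integral>x. V x \<partial>P) \<le> L / (1 - \<gamma>)"
  proof -
    have ae: "AE x in P. 0 \<le> V x"
      by (rule AE_I2) (simp add: sP V_nonneg)
    show i: "integrable P V"
      using invariant_integral_V[OF P inv] ae
      by (intro integrableI_nonneg) (auto intro: le_less_trans)
    show "(\<integral>x. V x \<partial>P) \<le> L / (1 - \<gamma>)"
      using invariant_integral_V[OF P inv] nn_integral_eq_integral[OF i ae] const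
      by (simp add: ennreal_le_iff)
  qed
  have bound: "(\<integral>y. rate ^ m * (2 + wt * V x + wt * V y) \<partial>P)
      \<le> (2 + wt * V x + wt * (L / (1 - \<gamma>))) * rate ^ m" (is "?L \<le> ?R")
  proof -
    have "?L = rate ^ m * (2 + wt * V x + wt * (\<integral>y. V y \<partial>P))"
      using VP(1) by (simp add: P.prob_space)
    also have "\<dots> \<le> rate ^ m * (2 + wt * V x + wt * (L / (1 - \<gamma>)))"
      using VP(2) wt_pos rate_bounds by (intro mult_left_mono add_left_mono) auto
    finally show ?thesis by (simp add: mult.commute)
  qed
  have i: "integrable P (\<lambda>y. rate ^ m * (2 + wt * V x + wt * V y))"
    using VP(1) by auto
  have "?f x - (\<integral>y. ?f y \<partial>P) = (\<integral>y. ?f x - ?f y \<partial>P)"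
    using f_int by (simp add: P.prob_space)
  also have "\<dots> \<le> (\<integral>y. rate ^ m * (2 + wt * V x + wt * V y) \<partial>P)"
    using f_int i kernel_pow_oscillation[OF A x] by (intro integral_mono) (auto simp: sP)
  finally have 1: "?f x - (\<integral>y. ?f y \<partial>P) \<le> ?R"
    using bound by simp
  have "(\<integral>y. ?f y \<partial>P) - ?f x = (\<integral>y. ?f y - ?f x \<partial>P)"
    using f_int by (simp add: P.prob_space)
  also have "\<dots> \<le> (\<integral>y. rate ^ m * (2 + wt * V x + wt * V y) \<partial>P)"
    using f_int i kernel_pow_oscillation[OF A _ x, of _ m] by (intro integral_mono) (auto simp: sP algebra_simps)
  finally have 2: "(\<integral>y. ?f y \<partial>P) - ?f x \<le> ?R"
    using bound by simp
  have 3: "0 \<le> (\<integral>y. ?f y \<partial>P)"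
    by (rule integral_nonneg_AE) simp
  show ?thesis
    unfolding PA by (subst f_eq[OF x]) (use 1 2 3 in \<open>simp add: abs_le_iff\<close>)
qed

end

section \<open>Drift of the regression coefficients\<close>

lemma diag_matrix_mult: "diag_matrix \<omega> *v w = (\<chi> i. \<omega> $ i * w $ i)"
  by (simp add: matrix_vector_mult_def diag_matrix_def vec_eq_iff if_distrib[of "\<lambda>t. t * _"] cong: if_cong)

lemma weighted_gram:
  fixes X :: "real ^ 'p ^ 'n"
  shows "u \<bullet> ((transpose X ** diag_matrix \<omega> ** X) *v v) = (\<Sum>i\<in>UNIV. \<omega> $ i * (X $ i \<bullet> u) * (X $ i \<bullet> v))"
proof -
  have comp: "(X *v w) $ i = X $ i \<bullet> w" for w i
    by (simp add: matrix_vector_mul_component)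
  have "u \<bullet> ((transpose X ** diag_matrix \<omega> ** X) *v v) = (X *v u) \<bullet> (diag_matrix \<omega> *v (X *v v))"
    by (simp add: matrix_vector_mul_assoc[symmetric])
      (metis dot_lmul_matrix transpose_matrix_vector transpose_transpose)
  also have "(diag_matrix \<omega> *v (X *v v)) = (\<chi> i. \<omega> $ i * (X $ i \<bullet> v))"
    by (simp add: diag_matrix_mult comp)
  finally show ?thesis
    by (simp add: inner_vec_def comp mult_ac)
qed

lemma inner_transpose_mult:
  fixes X :: "real ^ 'p ^ 'n"
  shows "v \<bullet> (transpose X *v \<kappa>) = (\<Sum>i\<in>UNIV. \<kappa> $ i * (X $ i \<bullet> v))"
proof -
  have "v \<bullet> (transpose X *v \<kappa>) = (X *v v) \<bullet> \<kappa>"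
    by (metis dot_lmul_matrix transpose_matrix_vector transpose_transpose)
  then show ?thesis
    by (simp add: inner_vec_def matrix_vector_mul_component mult_ac)
qed

text \<open>The sign \<open>c_i\<close> of the separation condition. It gives both likelihood
  factors the form \<open>1 / (1 + exp (c_i (x_i \<bullet> \<beta>)))\<close>, and
  \<open>\<kappa>_i\<close> is \<open>- 1/2\<close> times it.\<close>

definition resp_sign :: "nat \<Rightarrow> real" where
  "resp_sign k = 1 - 2 * real k"

lemma logit_likelihood_eq:
  assumes binary: "\<And>i. y $ i \<in> {0, 1}"
  shows "logit_likelihood X y \<beta> = (\<Prod>i\<in>UNIV. 1 / (1 + exp (resp_sign (y $ i) * (X $ i \<bullet> \<beta>))))"
  unfolding logit_likelihood_def
proof (rule prod.cong)
  fix i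
  have "exp (X $ i \<bullet> \<beta>) / (1 + exp (X $ i \<bullet> \<beta>)) = 1 / (1 + exp (- (X $ i \<bullet> \<beta>)))"
    by (simp add: exp_minus field_simps add_pos_pos less_imp_neq[THEN not_sym])
  then show "exp (X $ i \<bullet> \<beta>) ^ (y $ i) / (1 + exp (X $ i \<bullet> \<beta>)) = 1 / (1 + exp (resp_sign (y $ i) * (X $ i \<bullet> \<beta>)))"
    using binary[of i] by (auto simp: resp_sign_def)
qed simp

lemma logit_likelihood_pos: "0 < logit_likelihood X y \<beta>"
  unfolding logit_likelihood_def by (intro prod_pos) (simp add: add_pos_pos)

lemma logit_likelihood_measurable [measurable]: "logit_likelihood X y \<in> borel_measurable borel"
  unfolding logit_likelihood_def
  by (intro borel_measurable_continuous_onI continuous_intros) (simp add: add_pos_pos less_imp_neq[THEN not_sym])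

text \<open>Translation by a direction \<open>d\<close> of (quasi-)separation does not decrease the likelihood, so a
  half-space orthogonal to \<open>d\<close> carries no more mass than its translate, and the slab between them
  would have mass zero.\<close>

lemma proper_imp_no_separation:
  fixes X :: "real ^ 'p ^ 'n"
  assumes binary: "\<And>i. y $ i \<in> {0, 1}" and proper: "norm_const X y < \<infinity>" and d: "d \<noteq> 0"
  shows "\<exists>i. 0 < resp_sign (y $ i) * (X $ i \<bullet> d)"
proof (rule ccontr)
  assume "\<not> ?thesis"
  then have sep: "resp_sign (y $ i) * (X $ i \<bullet> d) \<le> 0" for i
    by (simp add: not_less)
  let ?f = "\<lambda>\<beta>. ennreal (logit_likelihood X y \<beta>)"
  have mono: "?f \<beta> \<le> ?f (d + \<beta>)" for \<beta>
    unfolding logit_likelihood_eq[OF binary]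
  proof (intro ennreal_leI prod_mono conjI divide_left_mono)
    fix i
    show "1 + exp (resp_sign (y $ i) * (X $ i \<bullet> (d + \<beta>))) \<le> 1 + exp (resp_sign (y $ i) * (X $ i \<bullet> \<beta>))"
      using sep[of i] by (simp add: inner_add_right distrib_left)
  qed (auto simp: add_pos_pos add_nonneg_nonneg)
  define D where "D = d \<bullet> d"
  have D: "0 < D"
    using d by (simp add: D_def)
  let ?H = "{\<beta>. 0 \<le> d \<bullet> \<beta>}" and ?H' = "{\<beta>. D \<le> d \<bullet> \<beta>}" and ?S = "{\<beta>. 0 \<le> d \<bullet> \<beta> \<and> d \<bullet> \<beta> < D}"
  have [measurable]: "?H \<in> sets borel" "?H' \<in> sets borel" "?S \<in> sets borel"
    by measurable
  have "(\<integral>\<^sup>+\<beta>. ?f \<beta> * indicator ?H \<beta> \<partial>lborel) \<le> (\<integral>\<^sup>+\<beta>. ?f (d + \<beta>) * indicator ?H \<beta> \<partial>lborel)"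
    using mono by (intro nn_integral_mono mult_right_mono) auto
  also have "\<dots> = (\<integral>\<^sup>+\<beta>. ?f (d + \<beta>) * indicator ?H' (d + \<beta>) \<partial>lborel)"
    by (intro nn_integral_cong) (simp add: indicator_def D_def inner_add_right)
  also have "\<dots> = (\<integral>\<^sup>+\<beta>. ?f \<beta> * indicator ?H' \<beta> \<partial>distr lborel borel ((+) d))"
    by (subst nn_integral_distr) auto
  also have "\<dots> = (\<integral>\<^sup>+\<beta>. ?f \<beta> * indicator ?H' \<beta> \<partial>lborel)"
    by (subst lborel_distr_plus) simp
  finally have HH': "(\<integral>\<^sup>+\<beta>. ?f \<beta> * indicator ?H \<beta> \<partial>lborel) \<le> (\<integral>\<^sup>+\<beta>. ?f \<beta> * indicator ?H' \<beta> \<partial>lborel)" .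
  have "(\<integral>\<^sup>+\<beta>. ?f \<beta> * indicator ?H \<beta> \<partial>lborel) = (\<integral>\<^sup>+\<beta>. ?f \<beta> * indicator ?S \<beta> + ?f \<beta> * indicator ?H' \<beta> \<partial>lborel)"
    using D by (intro nn_integral_cong) (auto split: split_indicator)
  also have "\<dots> = (\<integral>\<^sup>+\<beta>. ?f \<beta> * indicator ?S \<beta> \<partial>lborel) + (\<integral>\<^sup>+\<beta>. ?f \<beta> * indicator ?H' \<beta> \<partial>lborel)"
    by (rule nn_integral_add) measurable
  finally have "(\<integral>\<^sup>+\<beta>. ?f \<beta> * indicator ?S \<beta> \<partial>lborel) + (\<integral>\<^sup>+\<beta>. ?f \<beta> * indicator ?H' \<beta> \<partial>lborel)
      \<le> 0 + (\<integral>\<^sup>+\<beta>. ?f \<beta> * indicator ?H' \<beta> \<partial>lborel)"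
    using HH' by simp
  moreover have "(\<integral>\<^sup>+\<beta>. ?f \<beta> * indicator ?H' \<beta> \<partial>lborel) \<le> norm_const X y"
    unfolding norm_const_def by (intro nn_integral_mono) (auto split: split_indicator)
  then have "(\<integral>\<^sup>+\<beta>. ?f \<beta> * indicator ?H' \<beta> \<partial>lborel) \<noteq> \<infinity>"
    using proper by (auto simp: top_unique)
  ultimately have "(\<integral>\<^sup>+\<beta>. ?f \<beta> * indicator ?S \<beta> \<partial>lborel) = 0"
    by (simp add: ennreal_add_left_cancel_le add.commute)
  then have "AE \<beta> in lborel. ?f \<beta> * indicator ?S \<beta> = 0"
    by (subst (asm) nn_integral_0_iff_AE) auto
  then have "AE \<beta> in lborel. \<beta> \<notin> ?S"
    by eventually_elim (auto simp: ennreal_eq_0_iff logit_likelihood_pos[unfolded not_le[symmetric]] split: split_indicator_asm)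
  then have "?S \<in> null_sets lborel"
    by (subst AE_iff_null_sets) auto
  then have "negligible ?S"
    by (simp add: negligible_iff_null_sets null_sets_completionI)
  moreover have "{\<beta>. 0 < d \<bullet> \<beta>} \<inter> {\<beta>. d \<bullet> \<beta> < D} \<subseteq> ?S"
    by auto
  ultimately have "negligible ({\<beta>. 0 < d \<bullet> \<beta>} \<inter> {\<beta>. d \<bullet> \<beta> < D})"
    by (rule negligible_subset)
  moreover have "open ({\<beta>. 0 < d \<bullet> \<beta>} \<inter> {\<beta>. d \<bullet> \<beta> < D})"
    by (intro open_Int open_Collect_less continuous_intros)
  moreover have "(1 / 2) *\<^sub>R d \<in> {\<beta>. 0 < d \<bullet> \<beta>} \<inter> {\<beta>. d \<bullet> \<beta> < D}"
    using D by (simp add: D_def)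
  ultimately show False
    using open_not_negligible by blast
qed

text \<open>Positive parts measure the failure of separation: their sum \<open>g\<close> is
  continuous, positively homogeneous and positive off 0, so its minimum over the sphere makes it
  dominate \<open>\<delta>\<close> times the sum of absolute values. The identity
  \<open>- (s t) = |t| - 2 max 0 (s t)\<close> converts this into the margin.\<close>

lemma no_separation_margin:
  fixes X :: "real ^ 'p ^ 'n" and s :: "'n \<Rightarrow> real"
  assumes s: "\<And>i. \<bar>s i\<bar> = 1" and ns: "\<And>d. d \<noteq> 0 \<Longrightarrow> \<exists>i. 0 < s i * (X $ i \<bullet> d)"
  obtains \<delta> where "0 < \<delta>" "\<delta> < 1 / 2"
    "\<And>v. - (\<Sum>i\<in>UNIV. s i * (X $ i \<bullet> v)) \<le> (1 - 2 * \<delta>) * (\<Sum>i\<in>UNIV. \<bar>X $ i \<bullet> v\<bar>)"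
proof -
  define g where "g v = (\<Sum>i\<in>UNIV. max 0 (s i * (X $ i \<bullet> v)))" for v
  have "\<exists>u\<in>sphere 0 1. \<forall>v\<in>sphere 0 1. g u \<le> g v"
    unfolding g_def by (intro continuous_attains_inf continuous_intros) auto
  then obtain u where u: "norm u = 1" "\<And>v. norm v = 1 \<Longrightarrow> g u \<le> g v"
    by auto
  have "u \<noteq> 0"
    using u(1) by auto
  from ns[OF this] obtain i where "0 < s i * (X $ i \<bullet> u)"
    by blast
  then have g_pos: "0 < g u"
    unfolding g_def by (intro sum_pos2[of UNIV i]) auto
  \<comment> \<open>The summands \<open>2 * g u + 1\<close> beyond the norm bound force
    \<open>g u / B\<close> below 1/2.\<close>
  define B where "B = (\<Sum>i\<in>UNIV. norm (X $ i)) + 2 * g u + 1"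
  have B: "0 < B" "2 * g u < B"
    using g_pos by (auto simp: B_def intro!: add_nonneg_pos sum_nonneg)
       (smt (verit) norm_ge_zero sum_nonneg)
  define \<delta> where "\<delta> = g u / B"
  have \<delta>: "0 < \<delta>" "\<delta> < 1 / 2"
    using B g_pos by (auto simp: \<delta>_def field_simps)
  have scale: "\<delta> * (\<Sum>i\<in>UNIV. \<bar>X $ i \<bullet> v\<bar>) \<le> g v" for v
  proof (cases "v = 0")
    case False
    have "(\<Sum>i\<in>UNIV. \<bar>X $ i \<bullet> v\<bar>) \<le> (\<Sum>i\<in>UNIV. norm (X $ i) * norm v)"
      by (intro sum_mono Cauchy_Schwarz_ineq2)
    also have "\<dots> \<le> B * norm v"
      using g_pos by (simp add: B_def sum_distrib_right[symmetric] mult_right_mono)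
    finally have "\<delta> * (\<Sum>i\<in>UNIV. \<bar>X $ i \<bullet> v\<bar>) \<le> \<delta> * (B * norm v)"
      using \<delta> by (intro mult_left_mono) auto
    also have "\<dots> = norm v * g u"
      using B by (simp add: \<delta>_def)
    also have "\<dots> \<le> norm v * g ((1 / norm v) *\<^sub>R v)"
      using False by (intro mult_left_mono u) auto
    also have "\<dots> = g v"
    proof -
      have "norm v * max 0 (s i * (X $ i \<bullet> ((1 / norm v) *\<^sub>R v))) = max 0 (s i * (X $ i \<bullet> v))" for i
        using False by (simp add: max_mult_distrib_left)
      then show ?thesis
        by (simp only: g_def sum_distrib_left)
    qed
    finally show ?thesis .
  qed (simp add: g_def)
  have "- (\<Sum>i\<in>UNIV. s i * (X $ i \<bullet> v)) \<le> (1 - 2 * \<delta>) * (\<Sum>i\<in>UNIV. \<bar>X $ i \<bullet> v\<bar>)" for v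
  proof -
    have *: "- (s i * t) = \<bar>t\<bar> - 2 * max 0 (s i * t)" for i t
      using s[of i] by (auto simp: abs_if max_def zero_le_mult_iff split: if_splits)
    have "- (\<Sum>i\<in>UNIV. s i * (X $ i \<bullet> v)) = (\<Sum>i\<in>UNIV. \<bar>X $ i \<bullet> v\<bar>) - 2 * g v"
      unfolding g_def sum_negf[symmetric] * sum_subtractf sum_distrib_left ..
    then show ?thesis
      using scale[of v] by (simp add: algebra_simps)
  qed
  with \<delta> show ?thesis
    by (rule that)
qed

lemma two_abs_le:
  fixes t :: real
  assumes "0 < c"
  shows "2 * \<bar>t\<bar> \<le> 1 / c + c * t\<^sup>2"
proof -
  have "0 \<le> (c * \<bar>t\<bar> - 1)\<^sup>2 / c"
    using assms by simp
  also have "\<dots> = 1 / c + c * \<bar>t\<bar>\<^sup>2 - 2 * \<bar>t\<bar>"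
    using assms by (simp add: power2_eq_square field_simps del: abs_mult_self_eq)
  finally show ?thesis by simp
qed

text \<open>What drift and minorization take from a proper posterior: full rank makes the precision
  matrix invertible, the margin drives the drift. The constants of both are built from
  \<open>\<delta>\<close>.\<close>

locale no_separation =
  fixes X :: "real ^ 'p ^ 'n" and y :: "nat ^ 'n" and \<delta> :: real
  assumes \<delta>: "0 < \<delta>" "\<delta> < 1 / 2"
    and full_rank: "\<And>d. d \<noteq> 0 \<Longrightarrow> \<exists>i. X $ i \<bullet> d \<noteq> 0"
    and margin: "\<And>v. - (\<Sum>i\<in>UNIV. resp_sign (y $ i) * (X $ i \<bullet> v)) \<le> (1 - 2 * \<delta>) * (\<Sum>i\<in>UNIV. \<bar>X $ i \<bullet> v\<bar>)"
begin

definition prec :: "real ^ 'n \<Rightarrow> real ^ 'p ^ 'p" where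
  "prec \<omega> = transpose X ** diag_matrix \<omega> ** X"

definition \<kappa> :: "real ^ 'n" where
  "\<kappa> = (\<chi> i. real (y $ i) - 1 / 2)"

definition post_mean :: "real ^ 'n \<Rightarrow> real ^ 'p" where
  "post_mean \<omega> = matrix_inv (prec \<omega>) *v (transpose X *v \<kappa>)"

definition inv_sum :: "real ^ 'n \<Rightarrow> real" where
  "inv_sum \<omega> = (\<Sum>i\<in>UNIV. 1 / \<omega> $ i)"

lemma inv_sum_nonneg: "\<omega> \<in> pos_orthant \<Longrightarrow> 0 \<le> inv_sum \<omega>"
  by (auto simp: inv_sum_def pos_orthant_def less_imp_le intro!: sum_nonneg)

lemma cond_beta_eq: "cond_beta X y \<omega> = mvn_density (post_mean \<omega>) (matrix_inv (prec \<omega>))"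
  by (simp add: cond_beta_def Let_def prec_def \<kappa>_def post_mean_def)

lemma prec_form: "u \<bullet> (prec \<omega> *v v) = (\<Sum>i\<in>UNIV. \<omega> $ i * (X $ i \<bullet> u) * (X $ i \<bullet> v))"
  unfolding prec_def by (rule weighted_gram)

lemma prec_sym: "u \<bullet> (prec \<omega> *v v) = v \<bullet> (prec \<omega> *v u)"
  unfolding prec_form by (simp add: mult_ac)

lemma prec_pos:
  assumes \<omega>: "\<omega> \<in> pos_orthant" and d: "d \<noteq> 0"
  shows "0 < d \<bullet> (prec \<omega> *v d)"
proof -
  obtain i where "X $ i \<bullet> d \<noteq> 0"
    using full_rank[OF d] by blast
  moreover have "\<omega> $ i * (X $ i \<bullet> d) * (X $ i \<bullet> d) = \<omega> $ i * (X $ i \<bullet> d)\<^sup>2" for i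
    by (simp add: power2_eq_square)
  ultimately show ?thesis
    unfolding prec_form using \<omega>
    by (simp only:) (intro sum_pos2[of UNIV i], auto simp: pos_orthant_def less_imp_le)
qed

lemma prec_det: "\<omega> \<in> pos_orthant \<Longrightarrow> 0 < det (prec \<omega>)"
  by (rule pos_def_det[OF prec_sym prec_pos])

lemma cond_beta_precision:
  "\<omega> \<in> pos_orthant \<Longrightarrow> cond_beta X y \<omega> \<beta> =
    exp (- ((\<beta> - post_mean \<omega>) \<bullet> (prec \<omega> *v (\<beta> - post_mean \<omega>))) / 2) / sqrt ((2 * pi) ^ CARD('p) / det (prec \<omega>))"
  unfolding cond_beta_eq by (rule mvn_density_precision[OF prec_sym prec_pos])

lemma prec_post_mean:
  assumes \<omega>: "\<omega> \<in> pos_orthant"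
  shows "prec \<omega> *v post_mean \<omega> = transpose X *v \<kappa>"
proof -
  have "invertible (prec \<omega>)"
    using prec_det[OF \<omega>] by (simp add: invertible_det_nz)
  from someI_ex[OF this[unfolded invertible_def]]
  have "prec \<omega> ** matrix_inv (prec \<omega>) = mat 1"
    unfolding matrix_inv_def by auto
  then show ?thesis
    unfolding post_mean_def by (simp add: matrix_vector_mul_assoc)
qed

text \<open>The posterior mean is a weighted least-squares projection of the vector with entries
  \<open>\<kappa>\<^sub>i / \<omega>\<^sub>i\<close>; the margin makes the projection a strict contraction in the \<open>\<ell>\<^sub>1\<close> norm.\<close>

lemma post_mean_contraction:
  assumes \<omega>: "\<omega> \<in> pos_orthant"
  shows "2 * (\<Sum>i\<in>UNIV. \<bar>X $ i \<bullet> post_mean \<omega>\<bar>) \<le> (1 - 2 * \<delta>) * inv_sum \<omega>"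
proof -
  define u where "u i = X $ i \<bullet> post_mean \<omega>" for i
  define T where "T = (\<Sum>i\<in>UNIV. \<bar>u i\<bar>)"
  define Q where "Q = (\<Sum>i\<in>UNIV. \<omega> $ i * (u i)\<^sup>2)"
  have \<omega>_pos: "0 < \<omega> $ i" for i
    using \<omega> by (simp add: pos_orthant_def)
  have T: "0 \<le> T"
    by (simp add: T_def sum_nonneg)
  have "Q = post_mean \<omega> \<bullet> (prec \<omega> *v post_mean \<omega>)"
    unfolding prec_form Q_def u_def by (simp add: power2_eq_square mult.assoc)
  also have "\<dots> = (\<Sum>i\<in>UNIV. \<kappa> $ i * u i)"
    unfolding prec_post_mean[OF \<omega>] inner_transpose_mult u_def ..
  also have "\<dots> = (1 / 2) * (- (\<Sum>i\<in>UNIV. resp_sign (y $ i) * u i))"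
    by (simp add: \<kappa>_def resp_sign_def sum_distrib_left algebra_simps flip: sum_negf)
  finally have Q: "2 * Q \<le> (1 - 2 * \<delta>) * T"
    using margin[of "post_mean \<omega>"] by (simp add: u_def T_def)
  have "T\<^sup>2 = (\<Sum>i\<in>UNIV. (sqrt (\<omega> $ i) * \<bar>u i\<bar>) * (1 / sqrt (\<omega> $ i)))\<^sup>2"
    unfolding T_def using \<omega>_pos by (intro arg_cong[where f="\<lambda>t. t\<^sup>2"] sum.cong) (auto simp: less_imp_neq[THEN not_sym])
  also have "\<dots> \<le> (\<Sum>i\<in>UNIV. (sqrt (\<omega> $ i) * \<bar>u i\<bar>)\<^sup>2) * (\<Sum>i\<in>UNIV. (1 / sqrt (\<omega> $ i))\<^sup>2)"
    by (rule Cauchy_Schwarz_ineq_sum)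
  also have "\<dots> = Q * inv_sum \<omega>"
    using \<omega>_pos by (simp add: Q_def inv_sum_def power_mult_distrib power_divide less_imp_le)
  finally have "2 * T\<^sup>2 \<le> (2 * Q) * inv_sum \<omega>"
    by simp
  also have "\<dots> \<le> ((1 - 2 * \<delta>) * T) * inv_sum \<omega>"
    using Q inv_sum_nonneg[OF \<omega>] by (rule mult_right_mono)
  finally have "T * (2 * T) \<le> T * ((1 - 2 * \<delta>) * inv_sum \<omega>)"
    by (simp add: power2_eq_square mult_ac)
  then have "2 * T \<le> (1 - 2 * \<delta>) * inv_sum \<omega>"
    using T \<delta> inv_sum_nonneg[OF \<omega>] by (cases "T = 0") auto
  then show ?thesis
    by (simp add: T_def u_def)
qed

lemma cond_beta_nonneg:
  assumes "\<omega> \<in> pos_orthant"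
  shows "0 \<le> cond_beta X y \<omega> \<beta>"
  unfolding cond_beta_precision[OF assms] using prec_det[OF assms] by simp

lemma nn_integral_cond_beta:
  assumes "\<omega> \<in> pos_orthant"
  shows "(\<integral>\<^sup>+\<beta>. ennreal (cond_beta X y \<omega> \<beta>) \<partial>lborel) = 1"
  unfolding cond_beta_eq by (rule nn_integral_mvn_density_1[OF prec_sym prec_pos[OF assms]])

lemma cond_beta_measurable1:
  assumes "\<omega> \<in> pos_orthant"
  shows "cond_beta X y \<omega> \<in> borel_measurable borel"
  unfolding cond_beta_precision[OF assms, abs_def]
  by (intro borel_measurable_continuous_onI continuous_intros linear_continuous_on_compose[OF _ matrix_vector_mul_linear])
    (use prec_det[OF assms] in simp_all)

definition dev :: real where
  "dev = 4 * sqrt 2 ^ CARD('p) / \<delta>"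

lemma dev_pos: "0 < dev"
  using \<delta> by (simp add: dev_def)

text \<open>With weight \<open>\<omega>_i / \<delta>\<close>, \<open>two_abs_le\<close> bounds the
  deviation from the mean by \<open>\<delta> / \<omega>_i\<close> plus a share of the quadratic form
  over \<open>\<delta>\<close>. Summed, this spends \<open>\<delta>\<close> of the
  \<open>2 * \<delta>\<close> gained in \<open>post_mean_contraction\<close>; the expected quadratic
  form is bounded independently of \<open>\<omega>\<close> and becomes \<open>dev\<close>.\<close>

lemma nn_integral_cond_beta_abs:
  assumes \<omega>: "\<omega> \<in> pos_orthant"
  shows "(\<integral>\<^sup>+\<beta>. ennreal (cond_beta X y \<omega> \<beta>) * ennreal (2 * (\<Sum>i\<in>UNIV. \<bar>X $ i \<bullet> \<beta>\<bar>)) \<partial>lborel)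
    \<le> ennreal ((1 - \<delta>) * inv_sum \<omega> + dev)"
proof -
  note [measurable] = cond_beta_measurable1[OF \<omega>]
  let ?q = "\<lambda>\<beta>. (\<beta> - post_mean \<omega>) \<bullet> (prec \<omega> *v (\<beta> - post_mean \<omega>))"
  let ?c = "(1 - \<delta>) * inv_sum \<omega>"
  have q_nonneg: "0 \<le> ?q \<beta>" for \<beta>
    using prec_pos[OF \<omega>, of "\<beta> - post_mean \<omega>"] by (cases "\<beta> = post_mean \<omega>") auto
  have c: "0 \<le> ?c"
    using inv_sum_nonneg[OF \<omega>] \<delta> by simp
  have [measurable]: "?q \<in> borel_measurable borel"
    by (intro borel_measurable_continuous_onI continuous_intros linear_continuous_on_compose[OF _ matrix_vector_mul_linear])
  have pw: "2 * (\<Sum>i\<in>UNIV. \<bar>X $ i \<bullet> \<beta>\<bar>) \<le> ?c + ?q \<beta> / \<delta>" for \<beta>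
  proof -
    have "2 * \<bar>X $ i \<bullet> \<beta>\<bar> \<le> 2 * \<bar>X $ i \<bullet> post_mean \<omega>\<bar> + (\<delta> / \<omega> $ i + \<omega> $ i * (X $ i \<bullet> (\<beta> - post_mean \<omega>))\<^sup>2 / \<delta>)" for i
    proof -
      have "2 * \<bar>X $ i \<bullet> (\<beta> - post_mean \<omega>)\<bar> \<le> \<delta> / \<omega> $ i + \<omega> $ i * (X $ i \<bullet> (\<beta> - post_mean \<omega>))\<^sup>2 / \<delta>"
        using two_abs_le[of "\<omega> $ i / \<delta>" "X $ i \<bullet> (\<beta> - post_mean \<omega>)"] \<omega> \<delta> by (simp add: pos_orthant_def)
      moreover have "X $ i \<bullet> \<beta> = X $ i \<bullet> post_mean \<omega> + X $ i \<bullet> (\<beta> - post_mean \<omega>)"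
        by (simp add: inner_diff_right)
      ultimately show ?thesis by linarith
    qed
    then have "(\<Sum>i\<in>UNIV. 2 * \<bar>X $ i \<bullet> \<beta>\<bar>) \<le> (\<Sum>i\<in>UNIV. 2 * \<bar>X $ i \<bullet> post_mean \<omega>\<bar> + (\<delta> / \<omega> $ i + \<omega> $ i * (X $ i \<bullet> (\<beta> - post_mean \<omega>))\<^sup>2 / \<delta>))"
      by (intro sum_mono)
    also have "\<dots> = 2 * (\<Sum>i\<in>UNIV. \<bar>X $ i \<bullet> post_mean \<omega>\<bar>) + \<delta> * inv_sum \<omega> + ?q \<beta> / \<delta>"
      unfolding prec_form inv_sum_def
      by (simp add: sum.distrib sum_distrib_left sum_divide_distrib power2_eq_square mult.assoc)
    finally show ?thesis
      using post_mean_contraction[OF \<omega>] by (simp add: sum_distrib_left algebra_simps)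
  qed
  have "(\<integral>\<^sup>+\<beta>. ennreal (cond_beta X y \<omega> \<beta>) * ennreal (2 * (\<Sum>i\<in>UNIV. \<bar>X $ i \<bullet> \<beta>\<bar>)) \<partial>lborel)
      \<le> (\<integral>\<^sup>+\<beta>. ennreal (cond_beta X y \<omega> \<beta>) * ennreal ?c + ennreal (1 / \<delta>) * (ennreal (cond_beta X y \<omega> \<beta>) * ennreal (?q \<beta>)) \<partial>lborel)"
  proof (rule nn_integral_mono)
    fix \<beta>
    have "ennreal (cond_beta X y \<omega> \<beta>) * ennreal (2 * (\<Sum>i\<in>UNIV. \<bar>X $ i \<bullet> \<beta>\<bar>)) \<le> ennreal (cond_beta X y \<omega> \<beta>) * ennreal (?c + ?q \<beta> / \<delta>)"
      by (intro mult_left_mono ennreal_leI pw) simp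
    also have "ennreal (?c + ?q \<beta> / \<delta>) = ennreal ?c + ennreal (1 / \<delta>) * ennreal (?q \<beta>)"
      using c q_nonneg[of \<beta>] \<delta> by (simp add: ennreal_plus ennreal_mult'[symmetric])
    finally show "ennreal (cond_beta X y \<omega> \<beta>) * ennreal (2 * (\<Sum>i\<in>UNIV. \<bar>X $ i \<bullet> \<beta>\<bar>))
      \<le> ennreal (cond_beta X y \<omega> \<beta>) * ennreal ?c + ennreal (1 / \<delta>) * (ennreal (cond_beta X y \<omega> \<beta>) * ennreal (?q \<beta>))"
      by (simp add: distrib_left mult_ac)
  qed
  also have "\<dots> = (\<integral>\<^sup>+\<beta>. ennreal (cond_beta X y \<omega> \<beta>) \<partial>lborel) * ennreal ?c
      + ennreal (1 / \<delta>) * (\<integral>\<^sup>+\<beta>. ennreal (cond_beta X y \<omega> \<beta>) * ennreal (?q \<beta>) \<partial>lborel)"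
    by (subst nn_integral_add, measurable, subst nn_integral_multc, measurable, subst nn_integral_cmult, measurable)
  also have "\<dots> \<le> 1 * ennreal ?c + ennreal (1 / \<delta>) * ennreal (4 * sqrt 2 ^ CARD('p))"
    unfolding nn_integral_cond_beta[OF \<omega>] unfolding cond_beta_eq
    by (intro add_mono mult_left_mono nn_integral_mvn_quadratic[OF prec_sym prec_pos[OF \<omega>]]) auto
  also have "\<dots> = ennreal (?c + dev)"
    using c \<delta> by (simp add: dev_def ennreal_plus ennreal_mult'[symmetric])
  finally show ?thesis .
qed

end

section \<open>The Gibbs sampler\<close>

lemma vec_nth_measurable [measurable]: "(\<lambda>x :: real ^ 'n. x $ i) \<in> borel_measurable borel"
  by (intro borel_measurable_continuous_onI continuous_intros)

lemma cosh_measurable [measurable]: "(cosh :: real \<Rightarrow> real) \<in> borel_measurable borel"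
  by (intro borel_measurable_continuous_onI continuous_intros)

lemma nn_integral_lborel_prod_cart:
  fixes f :: "'n::finite \<Rightarrow> real \<Rightarrow> ennreal"
  assumes f: "\<And>i. f i \<in> borel_measurable borel"
  shows "(\<integral>\<^sup>+x. (\<Prod>i\<in>UNIV. f i (x $ i)) \<partial>(lborel :: (real ^ 'n) measure)) = (\<Prod>i\<in>UNIV. \<integral>\<^sup>+t. f i t \<partial>lborel)"
proof -
  \<comment> \<open>Recovers the coordinate from a basis vector, so that the product over
    \<open>Basis\<close> becomes a product over coordinates.\<close>
  define idx where "idx b = (THE i. axis i 1 = b)" for b :: "real ^ 'n"
  have idx: "idx (axis i 1) = i" for i
    unfolding idx_def by (rule the_equality) (auto simp: axis_eq_axis)
  have "(\<integral>\<^sup>+x. (\<Prod>b\<in>Basis. f (idx b) (x \<bullet> b)) \<partial>(lborel :: (real ^ 'n) measure)) = (\<Prod>b\<in>(Basis :: (real ^ 'n) set). \<integral>\<^sup>+t. f (idx b) t \<partial>lborel)"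
    by (rule nn_integral_lborel_prod) (use f in auto)
  then show ?thesis
    by (simp add: prod_Basis_cart idx inner_axis)
qed

lemma pos_orthant_borel [measurable]: "(pos_orthant :: (real ^ 'n) set) \<in> sets borel"
proof -
  have eq: "pos_orthant = (\<Inter>i. {w :: real ^ 'n. 0 < w $ i})"
    by (auto simp: pos_orthant_def)
  have "{w :: real ^ 'n. 0 < w $ i} \<in> sets borel" for i
    by measurable
  then show ?thesis
    unfolding eq by (intro sets.finite_INT) auto
qed

abbreviation orthant_measure :: "(real ^ 'n) measure" where
  "orthant_measure \<equiv> restrict_space lborel pos_orthant"

lemma space_orthant_measure: "space orthant_measure = pos_orthant"
  by (simp add: space_restrict_space)

lemma sets_orthant_measure:
  "A \<in> sets orthant_measure \<longleftrightarrow> A \<in> sets borel \<and> A \<subseteq> pos_orthant"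
  by (subst sets_restrict_space_iff) auto

lemma borel_imp_orthant_measurable: "f \<in> borel_measurable borel \<Longrightarrow> f \<in> borel_measurable orthant_measure"
  by (rule measurable_restrict_space1) simp

lemma nn_integral_orthant_measure:
  "(\<integral>\<^sup>+w. f w \<partial>orthant_measure) = (\<integral>\<^sup>+w. f w * indicator pos_orthant w \<partial>lborel)"
  by (subst nn_integral_restrict_space) simp_all

text \<open>The density extended by 0 to the whole line. Products over the coordinates vanish off
  the orthant, so integrals over the orthant become integrals over \<open>lborel\<close>, where
  product formulas and Tonelli apply directly.\<close>

definition PG_pos :: "real \<Rightarrow> real \<Rightarrow> real" where
  "PG_pos b w = cosh (b / 2) * (exp (- b\<^sup>2 / 2 * w) * PG0 w)"

lemma PG_pos_eq: "0 < w \<Longrightarrow> PG_pos b w = PG_density b w"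
  using PG_density_eq_PG0[of w b] by (simp add: PG_pos_def)

lemma PG_pos_nonpos: "w \<le> 0 \<Longrightarrow> PG_pos b w = 0"
  by (simp add: PG_pos_def PG0_def)

lemma PG_pos_nonneg: "0 \<le> PG_pos b w"
  by (simp add: PG_pos_def PG0_nonneg)

lemma PG_pos_measurable [measurable]: "PG_pos b \<in> borel_measurable borel"
  unfolding PG_pos_def by measurable

lemma nn_integral_PG_pos: "0 \<le> b \<Longrightarrow> (\<integral>\<^sup>+w. ennreal (PG_pos b w) \<partial>lborel) = 1"
  using nn_integral_PG_density[of b] unfolding PG_density_eq_PG0 PG_pos_def .

lemma nn_integral_PG_pos_inverse:
  "0 \<le> b \<Longrightarrow> (\<integral>\<^sup>+w. ennreal (PG_pos b w) * ennreal (1 / w) \<partial>lborel) \<le> ennreal (2 * b + 10)"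
  using nn_integral_inverse_PG[of b] PG_pos_nonneg[of b] unfolding PG_density_eq_PG0 PG_pos_def
  by (simp add: ennreal_mult'[symmetric])

text \<open>The tilt \<open>exp (- b^2 w / 2)\<close> decreases in \<open>b\<close> and
  \<open>cosh (b / 2) \<ge> 1\<close>, so only the normaliser of the larger parameter
  \<open>r\<close> has to be divided out.\<close>

lemma PG_pos_lower:
  assumes b: "0 \<le> b" "b \<le> r"
  shows "PG_pos r w / cosh (r / 2) \<le> PG_pos b w"
proof (cases "0 < w")
  case True
  have "b\<^sup>2 \<le> r\<^sup>2"
    using b by (intro power_mono) auto
  then have "exp (- r\<^sup>2 / 2 * w) \<le> exp (- b\<^sup>2 / 2 * w)"
    using True by simp
  then have "exp (- r\<^sup>2 / 2 * w) * PG0 w \<le> exp (- b\<^sup>2 / 2 * w) * PG0 w"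
    using PG0_nonneg by (rule mult_right_mono)
  also have "\<dots> \<le> cosh (b / 2) * (exp (- b\<^sup>2 / 2 * w) * PG0 w)"
    using mult_right_mono[OF cosh_real_ge_1[of "b / 2"], of "exp (- b\<^sup>2 / 2 * w) * PG0 w"] PG0_nonneg[of w] by simp
  finally show ?thesis
    by (simp add: PG_pos_def)
qed (simp add: PG_pos_nonpos)

definition omega_density :: "real ^ 'p ^ 'n \<Rightarrow> real ^ 'p \<Rightarrow> real ^ 'n \<Rightarrow> real" where
  "omega_density X \<beta> w = (\<Prod>i\<in>UNIV. PG_pos \<bar>X $ i \<bullet> \<beta>\<bar> (w $ i))"

lemma omega_density_eq: "w \<in> pos_orthant \<Longrightarrow> omega_density X \<beta> w = cond_omega X \<beta> w"
  by (simp add: omega_density_def cond_omega_def pos_orthant_def PG_pos_eq)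

lemma omega_density_outside: "w \<notin> pos_orthant \<Longrightarrow> omega_density X \<beta> w = 0"
  by (auto simp: omega_density_def pos_orthant_def not_less intro!: prod_zero PG_pos_nonpos)

lemma omega_density_nonneg: "0 \<le> omega_density X \<beta> w"
  by (simp add: omega_density_def prod_nonneg PG_pos_nonneg)

lemma omega_density_measurable [measurable]:
  fixes X :: "real ^ 'p ^ 'n"
  assumes [measurable]: "f \<in> borel_measurable M" "g \<in> borel_measurable M"
  shows "(\<lambda>z. omega_density X (f z) (g z)) \<in> borel_measurable M"
  unfolding omega_density_def PG_pos_def by measurable

lemma nn_integral_omega_density: "(\<integral>\<^sup>+w. ennreal (omega_density X \<beta> w) \<partial>lborel) = 1"
proof -
  have "(\<integral>\<^sup>+w. (\<Prod>i\<in>UNIV. ennreal (PG_pos \<bar>X $ i \<bullet> \<beta>\<bar> (w $ i))) \<partial>lborel) = 1"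
    by (subst nn_integral_lborel_prod_cart) (simp_all add: nn_integral_PG_pos)
  then show ?thesis
    by (simp add: omega_density_def prod_ennreal PG_pos_nonneg)
qed

lemma nn_integral_omega_density_inverse:
  fixes X :: "real ^ 'p ^ 'n"
  shows "(\<integral>\<^sup>+w. ennreal (omega_density X \<beta> w) * ennreal (\<Sum>i\<in>UNIV. 1 / w $ i) \<partial>lborel)
    \<le> ennreal (2 * (\<Sum>i\<in>UNIV. \<bar>X $ i \<bullet> \<beta>\<bar>) + 10 * CARD('n))"
proof -
  let ?b = "\<lambda>i. \<bar>X $ i \<bullet> \<beta>\<bar>"
  have one: "(\<integral>\<^sup>+w. ennreal (omega_density X \<beta> w) * ennreal (1 / w $ i) \<partial>lborel) \<le> ennreal (2 * ?b i + 10)" for i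
  proof -
    let ?f = "\<lambda>j t. ennreal (PG_pos (?b j) t) * (if j = i then ennreal (1 / t) else 1)"
    have "(\<integral>\<^sup>+w. ennreal (omega_density X \<beta> w) * ennreal (1 / w $ i) \<partial>lborel) = (\<integral>\<^sup>+w. (\<Prod>j\<in>UNIV. ?f j (w $ j)) \<partial>lborel)"
      by (intro nn_integral_cong) (simp add: omega_density_def prod_ennreal PG_pos_nonneg prod.distrib)
    also have "\<dots> = (\<Prod>j\<in>UNIV. \<integral>\<^sup>+t. ?f j t \<partial>lborel)"
      by (intro nn_integral_lborel_prod_cart) simp
    also have "\<dots> = (\<integral>\<^sup>+t. ?f i t \<partial>lborel) * (\<Prod>j\<in>UNIV - {i}. \<integral>\<^sup>+t. ?f j t \<partial>lborel)"
      by (rule prod.remove) auto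
    also have "(\<Prod>j\<in>UNIV - {i}. \<integral>\<^sup>+t. ?f j t \<partial>lborel) = 1"
      by (intro prod.neutral) (simp add: nn_integral_PG_pos)
    also have "(\<integral>\<^sup>+t. ?f i t \<partial>lborel) \<le> ennreal (2 * ?b i + 10)"
      using nn_integral_PG_pos_inverse[of "?b i"] by simp
    finally show ?thesis by simp
  qed
  have "(\<integral>\<^sup>+w. ennreal (omega_density X \<beta> w) * ennreal (\<Sum>i\<in>UNIV. 1 / w $ i) \<partial>lborel)
      = (\<integral>\<^sup>+w. (\<Sum>i\<in>UNIV. ennreal (omega_density X \<beta> w) * ennreal (1 / w $ i)) \<partial>lborel)"
  proof (rule nn_integral_cong)
    fix w :: "real ^ 'n"
    show "ennreal (omega_density X \<beta> w) * ennreal (\<Sum>i\<in>UNIV. 1 / w $ i) = (\<Sum>i\<in>UNIV. ennreal (omega_density X \<beta> w) * ennreal (1 / w $ i))"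
    \<comment> \<open>\<open>ennreal\<close> is additive on nonnegative summands; off the orthant
      some \<open>1 / w $ i\<close> may be negative, but the density vanishes there.\<close>
    proof (cases "w \<in> pos_orthant")
      case True
      then have "ennreal (\<Sum>i\<in>UNIV. 1 / w $ i) = (\<Sum>i\<in>UNIV. ennreal (1 / w $ i))"
        by (intro sum_ennreal[symmetric]) (simp add: pos_orthant_def less_imp_le)
      then show ?thesis
        by (simp add: sum_distrib_left)
    qed (simp add: omega_density_outside)
  qed
  also have "\<dots> = (\<Sum>i\<in>UNIV. \<integral>\<^sup>+w. ennreal (omega_density X \<beta> w) * ennreal (1 / w $ i) \<partial>lborel)"
    by (rule nn_integral_sum) measurable
  also have "\<dots> \<le> (\<Sum>i\<in>UNIV. ennreal (2 * ?b i + 10))"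
    by (intro sum_mono one)
  also have "\<dots> = ennreal (2 * (\<Sum>i\<in>UNIV. ?b i) + 10 * CARD('n))"
    by (subst sum_ennreal) (auto simp: sum.distrib sum_distrib_left mult.commute)
  finally show ?thesis .
qed

lemma PG_kernel_sets [simp]: "sets (PG_kernel X y w) = sets orthant_measure"
  by (simp add: PG_kernel_def)

text \<open>The Polya-Gamma identity: the normaliser \<open>cosh (t / 2)\<close> cancels the
  logistic denominator and leaves a log-linear term. This is why augmenting by \<omega> makes the
  conditional law of \<beta> Gaussian.\<close>

lemma cosh_logit_factor: "exp t ^ k / (1 + exp t) * cosh (t / 2) = exp ((real k - 1 / 2) * t) / (2 :: real)"
proof -
  have c: "cosh (t / 2) = exp (- t / 2) * (1 + exp t) / 2"
    by (simp add: cosh_def distrib_left flip: exp_add)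
  have e: "exp t ^ k * exp (- t / 2) = exp ((real k - 1 / 2) * t)"
    by (simp add: left_diff_distrib flip: exp_of_nat_mult exp_add)
  have "1 + exp t \<noteq> 0"
    by (smt (verit) exp_gt_zero)
  then have "exp t ^ k / (1 + exp t) * cosh (t / 2) = (exp t ^ k * exp (- t / 2)) / 2"
    unfolding c by simp
  then show ?thesis
    unfolding e .
qed

section \<open>The sampler as a two-stage kernel\<close>

context no_separation
begin

text \<open>The part of the augmented likelihood that depends on \<beta>: an unnormalised Gaussian
  free of inverses and determinants, hence visibly measurable in both arguments jointly.\<close>

definition logit_gauss :: "real ^ 'p \<Rightarrow> real ^ 'n \<Rightarrow> real" where
  "logit_gauss \<beta> \<omega> = exp ((\<Sum>i\<in>UNIV. \<kappa> $ i * (X $ i \<bullet> \<beta>)) - (\<Sum>i\<in>UNIV. \<omega> $ i * (X $ i \<bullet> \<beta>)\<^sup>2) / 2)"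

lemma logit_gauss_measurable [measurable]:
  assumes [measurable]: "f \<in> borel_measurable M" "g \<in> borel_measurable M"
  shows "(\<lambda>z. logit_gauss (f z) (g z)) \<in> borel_measurable M"
  unfolding logit_gauss_def by measurable

definition gauss_mass :: "real ^ 'n \<Rightarrow> ennreal" where
  "gauss_mass \<omega> = (\<integral>\<^sup>+\<beta>. ennreal (logit_gauss \<beta> \<omega>) \<partial>lborel)"

lemma gauss_mass_measurable [measurable]: "gauss_mass \<in> borel_measurable borel"
  unfolding gauss_mass_def by measurable

lemma likelihood_omega_density:
  "logit_likelihood X y \<beta> * omega_density X \<beta> \<omega> = (\<Prod>i\<in>UNIV. PG0 (\<omega> $ i) / 2) * logit_gauss \<beta> \<omega>"
proof -
  have "exp (X $ i \<bullet> \<beta>) ^ (y $ i) / (1 + exp (X $ i \<bullet> \<beta>)) * PG_pos \<bar>X $ i \<bullet> \<beta>\<bar> (\<omega> $ i)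
      = PG0 (\<omega> $ i) / 2 * exp (\<kappa> $ i * (X $ i \<bullet> \<beta>) - \<omega> $ i * (X $ i \<bullet> \<beta>)\<^sup>2 / 2)" for i
  proof -
    let ?t = "X $ i \<bullet> \<beta>"
    have "cosh (\<bar>?t\<bar> / 2) = cosh (?t / 2)"
      using cosh_real_abs[of "?t / 2"] by simp
    then have "exp ?t ^ (y $ i) / (1 + exp ?t) * PG_pos \<bar>?t\<bar> (\<omega> $ i)
        = (exp ?t ^ (y $ i) / (1 + exp ?t) * cosh (?t / 2)) * (exp (- ?t\<^sup>2 / 2 * \<omega> $ i) * PG0 (\<omega> $ i))"
      by (simp add: PG_pos_def)
    also have "\<dots> = PG0 (\<omega> $ i) / 2 * (exp (\<kappa> $ i * ?t) * exp (- ?t\<^sup>2 / 2 * \<omega> $ i))"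
      unfolding cosh_logit_factor by (simp add: \<kappa>_def)
    also have "exp (\<kappa> $ i * ?t) * exp (- ?t\<^sup>2 / 2 * \<omega> $ i) = exp (\<kappa> $ i * ?t - \<omega> $ i * ?t\<^sup>2 / 2)"
      by (simp add: mult.commute flip: exp_add)
    finally show ?thesis .
  qed
  then show ?thesis
    unfolding logit_likelihood_def omega_density_def logit_gauss_def
    by (simp only: prod.distrib[symmetric] exp_sum[symmetric] finite sum_subtractf sum_divide_distrib)
      (simp only: prod.distrib exp_sum finite sum_subtractf[symmetric])
qed

text \<open>Completing the square: \<open>prec_post_mean\<close> rewrites the linear term through
  the mean, so the exponent is the centred quadratic form up to a constant in \<beta>.\<close>

lemma cond_beta_proportional:
  assumes \<omega>: "\<omega> \<in> pos_orthant"
  obtains c where "0 < c" "\<And>\<beta>. logit_gauss \<beta> \<omega> = c * cond_beta X y \<omega> \<beta>"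
proof -
  let ?\<mu> = "post_mean \<omega>" and ?A = "prec \<omega>"
  let ?Z = "sqrt ((2 * pi) ^ CARD('p) / det ?A)"
  have Z: "0 < ?Z"
    using prec_det[OF \<omega>] by simp
  have "logit_gauss \<beta> \<omega> = (exp (?\<mu> \<bullet> (?A *v ?\<mu>) / 2) * ?Z) * cond_beta X y \<omega> \<beta>" for \<beta>
  proof -
    have "(\<Sum>i\<in>UNIV. \<kappa> $ i * (X $ i \<bullet> \<beta>)) = \<beta> \<bullet> (?A *v ?\<mu>)"
      unfolding prec_post_mean[OF \<omega>] by (rule inner_transpose_mult[symmetric])
    moreover have "(\<Sum>i\<in>UNIV. \<omega> $ i * (X $ i \<bullet> \<beta>)\<^sup>2) = \<beta> \<bullet> (?A *v \<beta>)"
      unfolding prec_form by (simp add: power2_eq_square mult.assoc)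
    moreover have "(\<beta> - ?\<mu>) \<bullet> (?A *v (\<beta> - ?\<mu>)) = \<beta> \<bullet> (?A *v \<beta>) - 2 * (\<beta> \<bullet> (?A *v ?\<mu>)) + ?\<mu> \<bullet> (?A *v ?\<mu>)"
      using prec_sym[of ?\<mu> \<omega> \<beta>] by (simp add: matrix_vector_mult_diff_distrib inner_diff_left inner_diff_right)
    ultimately have "logit_gauss \<beta> \<omega> = exp (?\<mu> \<bullet> (?A *v ?\<mu>) / 2 + - ((\<beta> - ?\<mu>) \<bullet> (?A *v (\<beta> - ?\<mu>))) / 2)"
      unfolding logit_gauss_def by (simp add: field_simps)
    moreover have "e1 * e2 = (e1 * z) * (e2 / z)" if "0 < z" for e1 e2 z :: real
      using that by simp
    note this[OF Z]
    ultimately show ?thesis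
      unfolding cond_beta_precision[OF \<omega>] exp_add by simp
  qed
  moreover have "0 < exp (?\<mu> \<bullet> (?A *v ?\<mu>) / 2) * ?Z"
    using Z by simp
  ultimately show ?thesis
    using that by blast
qed

text \<open>Since \<open>cond_beta\<close> has total mass 1, the proportionality constant must be
  \<open>gauss_mass \<omega>\<close>, which is therefore positive and finite, as the quotient form
  needs.\<close>

lemma
  assumes \<omega>: "\<omega> \<in> pos_orthant"
  shows logit_gauss_eq: "ennreal (logit_gauss \<beta> \<omega>) = gauss_mass \<omega> * ennreal (cond_beta X y \<omega> \<beta>)"
    and cond_beta_quotient: "ennreal (cond_beta X y \<omega> \<beta>) = ennreal (logit_gauss \<beta> \<omega>) / gauss_mass \<omega>"
proof -
  note [measurable] = cond_beta_measurable1[OF \<omega>]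
  obtain c where c: "0 < c" "\<And>\<beta>. logit_gauss \<beta> \<omega> = c * cond_beta X y \<omega> \<beta>"
    using cond_beta_proportional[OF \<omega>] by blast
  have eq: "ennreal (logit_gauss \<beta> \<omega>) = ennreal c * ennreal (cond_beta X y \<omega> \<beta>)" for \<beta>
    using c by (simp add: ennreal_mult')
  have "gauss_mass \<omega> = ennreal c * (\<integral>\<^sup>+\<beta>. ennreal (cond_beta X y \<omega> \<beta>) \<partial>lborel)"
    unfolding gauss_mass_def eq by (rule nn_integral_cmult) measurable
  then have m: "gauss_mass \<omega> = ennreal c"
    using nn_integral_cond_beta[OF \<omega>] by simp
  show "ennreal (logit_gauss \<beta> \<omega>) = gauss_mass \<omega> * ennreal (cond_beta X y \<omega> \<beta>)"
    using eq m by simp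
  show "ennreal (cond_beta X y \<omega> \<beta>) = ennreal (logit_gauss \<beta> \<omega>) / gauss_mass \<omega>"
    unfolding m c(2) using c(1) by (simp add: divide_ennreal cond_beta_nonneg[OF \<omega>])
qed

text \<open>Measurability in \<omega> is read off the quotient of \<open>logit_gauss\<close> by
  \<open>gauss_mass\<close> instead of being traced through \<open>matrix_inv\<close> and
  \<open>det\<close>.\<close>

lemma cond_beta_measurable:
  "(\<lambda>\<omega>. \<integral>\<^sup>+\<beta>. ennreal (cond_beta X y \<omega> \<beta>) * h \<beta> \<partial>lborel) \<in> borel_measurable orthant_measure"
  if [measurable]: "h \<in> borel_measurable borel"
proof -
  have "(\<lambda>\<omega>. \<integral>\<^sup>+\<beta>. ennreal (logit_gauss \<beta> \<omega>) / gauss_mass \<omega> * h \<beta> \<partial>lborel) \<in> borel_measurable borel"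
    by measurable
  then show ?thesis
    by (subst measurable_cong[where g = "\<lambda>\<omega>. \<integral>\<^sup>+\<beta>. ennreal (logit_gauss \<beta> \<omega>) / gauss_mass \<omega> * h \<beta> \<partial>lborel"])
      (auto simp: space_orthant_measure cond_beta_quotient intro!: borel_imp_orthant_measurable)
qed

text \<open>Tonelli separates a step into its two draws, \<beta> given the old state and the new
  state given \<beta>, so that later estimates can bound the inner draw first.\<close>

lemma nn_integral_PG_kernel:
  assumes \<omega>: "\<omega> \<in> pos_orthant" and h [measurable]: "h \<in> borel_measurable borel"
  shows "(\<integral>\<^sup>+w. h w \<partial>PG_kernel X y \<omega>)
    = (\<integral>\<^sup>+\<beta>. ennreal (cond_beta X y \<omega> \<beta>) * (\<integral>\<^sup>+w. ennreal (omega_density X \<beta> w) * h w \<partial>lborel) \<partial>lborel)"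
proof -
  note [measurable] = cond_beta_measurable1[OF \<omega>]
  define k where "k w = (\<integral>\<^sup>+\<beta>. ennreal (cond_beta X y \<omega> \<beta>) * ennreal (omega_density X \<beta> w) \<partial>lborel)" for w
  have [measurable]: "k \<in> borel_measurable borel"
    unfolding k_def by measurable
  have k_eq: "PG_trans_density X y \<omega> w = k w" if "w \<in> pos_orthant" for w
    unfolding PG_trans_density_def k_def using cond_beta_nonneg[OF \<omega>] that
    by (intro nn_integral_cong) (simp add: omega_density_eq[symmetric] ennreal_mult omega_density_nonneg mult.commute)
  have [measurable]: "PG_trans_density X y \<omega> \<in> borel_measurable orthant_measure"
    by (subst measurable_cong[where g = k]) (auto simp: space_orthant_measure k_eq intro!: borel_imp_orthant_measurable)
  have k_outside: "k w = 0" if "w \<notin> pos_orthant" for w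
    using that by (simp add: k_def omega_density_outside)
  have "(\<integral>\<^sup>+w. h w \<partial>PG_kernel X y \<omega>) = (\<integral>\<^sup>+w. PG_trans_density X y \<omega> w * h w \<partial>orthant_measure)"
    unfolding PG_kernel_def by (rule nn_integral_density) (simp_all add: borel_imp_orthant_measurable)
  also have "\<dots> = (\<integral>\<^sup>+w. k w * h w \<partial>lborel)"
    unfolding nn_integral_orthant_measure
    by (intro nn_integral_cong) (simp add: k_eq k_outside split: split_indicator)
  also have "\<dots> = (\<integral>\<^sup>+w. \<integral>\<^sup>+\<beta>. ennreal (cond_beta X y \<omega> \<beta>) * (ennreal (omega_density X \<beta> w) * h w) \<partial>lborel \<partial>lborel)"
    unfolding k_def by (subst nn_integral_multc[symmetric]) (simp_all add: mult.assoc)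
  also have "\<dots> = (\<integral>\<^sup>+\<beta>. \<integral>\<^sup>+w. ennreal (cond_beta X y \<omega> \<beta>) * (ennreal (omega_density X \<beta> w) * h w) \<partial>lborel \<partial>lborel)"
    by (rule lborel_pair.Fubini') measurable
  also have "\<dots> = (\<integral>\<^sup>+\<beta>. ennreal (cond_beta X y \<omega> \<beta>) * (\<integral>\<^sup>+w. ennreal (omega_density X \<beta> w) * h w \<partial>lborel) \<partial>lborel)"
    by (intro nn_integral_cong nn_integral_cmult) measurable
  finally show ?thesis .
qed

definition set_prob :: "(real ^ 'n) set \<Rightarrow> real ^ 'p \<Rightarrow> ennreal" where
  "set_prob A \<beta> = (\<integral>\<^sup>+w. ennreal (omega_density X \<beta> w) * indicator A w \<partial>lborel)"

lemma set_prob_measurable [measurable]: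
  assumes [measurable]: "A \<in> sets borel"
  shows "set_prob A \<in> borel_measurable borel"
  unfolding set_prob_def by measurable

lemma set_prob_orthant: "set_prob pos_orthant \<beta> = 1"
proof -
  have "set_prob pos_orthant \<beta> = (\<integral>\<^sup>+w. ennreal (omega_density X \<beta> w) \<partial>lborel)"
    unfolding set_prob_def by (intro nn_integral_cong) (auto simp: omega_density_outside split: split_indicator)
  then show ?thesis
    by (simp add: nn_integral_omega_density)
qed

lemma emeasure_PG_kernel:
  assumes \<omega>: "\<omega> \<in> pos_orthant" and A: "A \<in> sets orthant_measure"
  shows "emeasure (PG_kernel X y \<omega>) A = (\<integral>\<^sup>+\<beta>. ennreal (cond_beta X y \<omega> \<beta>) * set_prob A \<beta> \<partial>lborel)"
proof -
  have [measurable]: "A \<in> sets borel"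
    using A by (simp add: sets_orthant_measure)
  have "emeasure (PG_kernel X y \<omega>) A = (\<integral>\<^sup>+w. indicator A w \<partial>PG_kernel X y \<omega>)"
    using A by (intro nn_integral_indicator[symmetric]) simp
  also have "\<dots> = (\<integral>\<^sup>+\<beta>. ennreal (cond_beta X y \<omega> \<beta>) * set_prob A \<beta> \<partial>lborel)"
    unfolding set_prob_def by (intro nn_integral_PG_kernel[OF \<omega>]) measurable
  finally show ?thesis .
qed

lemma PG_kernel_prob:
  assumes \<omega>: "\<omega> \<in> pos_orthant"
  shows "prob_space (PG_kernel X y \<omega>)"
proof
  have "space (PG_kernel X y \<omega>) = pos_orthant"
    by (simp add: PG_kernel_def space_orthant_measure)
  then show "emeasure (PG_kernel X y \<omega>) (space (PG_kernel X y \<omega>)) = 1"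
    using emeasure_PG_kernel[OF \<omega>, of pos_orthant] nn_integral_cond_beta[OF \<omega>]
    by (simp add: set_prob_orthant sets_orthant_measure)
qed

lemma PG_kernel_measurable: "PG_kernel X y \<in> orthant_measure \<rightarrow>\<^sub>M prob_algebra orthant_measure"
proof (rule measurable_prob_algebraI)
  show "PG_kernel X y \<in> orthant_measure \<rightarrow>\<^sub>M subprob_algebra orthant_measure"
  proof (rule measurable_subprob_algebra)
    fix A :: "(real ^ 'n) set" assume A: "A \<in> sets orthant_measure"
    then have [measurable]: "A \<in> sets borel"
      by (simp add: sets_orthant_measure)
    have "(\<lambda>\<omega>. \<integral>\<^sup>+\<beta>. ennreal (cond_beta X y \<omega> \<beta>) * set_prob A \<beta> \<partial>lborel) \<in> borel_measurable orthant_measure"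
      by (rule cond_beta_measurable) measurable
    then show "(\<lambda>\<omega>. emeasure (PG_kernel X y \<omega>) A) \<in> borel_measurable orthant_measure"
      by (rule measurable_cong[THEN iffD1, rotated]) (simp add: space_orthant_measure emeasure_PG_kernel[OF _ A])
  qed (simp_all add: space_orthant_measure PG_kernel_prob prob_space_imp_subprob_space)
qed (simp add: space_orthant_measure PG_kernel_prob)

section \<open>Drift, minorization and the choice of constants\<close>

definition drift_const :: real where
  "drift_const = dev + 10 * CARD('n)"

lemma PG_kernel_drift:
  assumes \<omega>: "\<omega> \<in> pos_orthant"
  shows "(\<integral>\<^sup>+w. ennreal (inv_sum w) \<partial>PG_kernel X y \<omega>) \<le> ennreal ((1 - \<delta>) * inv_sum \<omega> + drift_const)"
proof -
  note [measurable] = cond_beta_measurable1[OF \<omega>]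
  let ?S = "\<lambda>\<beta>. 2 * (\<Sum>i\<in>UNIV. \<bar>X $ i \<bullet> \<beta>\<bar>)"
  have "(\<integral>\<^sup>+w. ennreal (inv_sum w) \<partial>PG_kernel X y \<omega>)
      = (\<integral>\<^sup>+\<beta>. ennreal (cond_beta X y \<omega> \<beta>) * (\<integral>\<^sup>+w. ennreal (omega_density X \<beta> w) * ennreal (inv_sum w) \<partial>lborel) \<partial>lborel)"
    unfolding inv_sum_def by (rule nn_integral_PG_kernel[OF \<omega>]) measurable
  also have "\<dots> \<le> (\<integral>\<^sup>+\<beta>. ennreal (cond_beta X y \<omega> \<beta>) * ennreal (?S \<beta>) + ennreal (cond_beta X y \<omega> \<beta>) * ennreal (10 * CARD('n)) \<partial>lborel)"
  proof (rule nn_integral_mono)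
    fix \<beta>
    have "ennreal (?S \<beta> + 10 * CARD('n)) = ennreal (?S \<beta>) + ennreal (10 * CARD('n))"
      by (intro ennreal_plus) (auto intro!: sum_nonneg)
    then show "ennreal (cond_beta X y \<omega> \<beta>) * (\<integral>\<^sup>+w. ennreal (omega_density X \<beta> w) * ennreal (inv_sum w) \<partial>lborel)
        \<le> ennreal (cond_beta X y \<omega> \<beta>) * ennreal (?S \<beta>) + ennreal (cond_beta X y \<omega> \<beta>) * ennreal (10 * CARD('n))"
      using nn_integral_omega_density_inverse[of X \<beta>] unfolding inv_sum_def distrib_left[symmetric]
      by (intro mult_left_mono) simp_all
  qed
  also have "\<dots> = (\<integral>\<^sup>+\<beta>. ennreal (cond_beta X y \<omega> \<beta>) * ennreal (?S \<beta>) \<partial>lborel)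
      + (\<integral>\<^sup>+\<beta>. ennreal (cond_beta X y \<omega> \<beta>) \<partial>lborel) * ennreal (10 * CARD('n))"
    by (subst nn_integral_add, measurable, subst nn_integral_multc, measurable)
  also have "\<dots> \<le> ennreal ((1 - \<delta>) * inv_sum \<omega> + dev) + ennreal (10 * CARD('n))"
    unfolding nn_integral_cond_beta[OF \<omega>] using nn_integral_cond_beta_abs[OF \<omega>] by (simp add: add_right_mono)
  also have "\<dots> = ennreal ((1 - \<delta>) * inv_sum \<omega> + drift_const)"
    using inv_sum_nonneg[OF \<omega>] \<delta> dev_pos
    by (subst ennreal_plus[symmetric]) (auto simp: drift_const_def add.assoc)
  finally show ?thesis .
qed

text \<open>With \<open>\<gamma> = 1 - \<delta>\<close> the Harris condition reads
  \<open>level > 2 * drift_const / \<delta>\<close>; the summand 1 makes it strict.\<close>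

definition level :: real where
  "level = 2 * drift_const / \<delta> + 1"

text \<open>On \<open>inv_sum \<omega> \<le> level\<close> this bounds the conditional mean of twice
  the absolute sum, so by Markov's inequality the absolute sum exceeds \<open>radius\<close> with
  probability at most 1/2.\<close>

definition radius :: real where
  "radius = (1 - \<delta>) * level + dev"

definition minor_measure :: "(real ^ 'n) measure" where
  "minor_measure = density orthant_measure (\<lambda>w. ennreal (\<Prod>i\<in>UNIV. PG_pos radius (w $ i)))"

lemma drift_const_pos: "0 < drift_const"
  using dev_pos by (simp add: drift_const_def add_pos_nonneg)

lemma level_pos: "0 < level"
  using drift_const_pos \<delta> by (simp add: level_def add_pos_pos)

lemma radius_pos: "0 < radius"
  using level_pos \<delta> dev_pos by (simp add: radius_def add_nonneg_pos)

lemma emeasure_minor_measure: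
  assumes A: "A \<in> sets orthant_measure"
  shows "emeasure minor_measure A = (\<integral>\<^sup>+w. ennreal (\<Prod>i\<in>UNIV. PG_pos radius (w $ i)) * indicator A w \<partial>lborel)"
proof -
  have "(\<lambda>w :: real ^ 'n. ennreal (\<Prod>i\<in>UNIV. PG_pos radius (w $ i))) \<in> borel_measurable borel"
    by measurable
  from borel_imp_orthant_measurable[OF this]
  have "emeasure minor_measure A = (\<integral>\<^sup>+w. ennreal (\<Prod>i\<in>UNIV. PG_pos radius (w $ i)) * indicator A w \<partial>orthant_measure)"
    unfolding minor_measure_def using A by (rule emeasure_density)
  also have "\<dots> = (\<integral>\<^sup>+w. ennreal (\<Prod>i\<in>UNIV. PG_pos radius (w $ i)) * indicator A w \<partial>lborel)"
    unfolding nn_integral_orthant_measure using A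
    by (intro nn_integral_cong) (auto simp: sets_orthant_measure split: split_indicator)
  finally show ?thesis .
qed

lemma minor_measure_prob: "minor_measure \<in> space (prob_algebra orthant_measure)"
proof -
  have "prob_space minor_measure"
  proof
    have "emeasure minor_measure pos_orthant = (\<integral>\<^sup>+w. ennreal (\<Prod>i\<in>UNIV. PG_pos radius (w $ i)) * indicator pos_orthant w \<partial>(lborel :: (real ^ 'n) measure))"
      by (rule emeasure_minor_measure) (simp add: sets_orthant_measure)
    also have "\<dots> = (\<integral>\<^sup>+w. (\<Prod>i\<in>UNIV. ennreal (PG_pos radius (w $ i))) \<partial>(lborel :: (real ^ 'n) measure))"
    proof (rule nn_integral_cong)
      fix w :: "real ^ 'n"
      show "ennreal (\<Prod>i\<in>UNIV. PG_pos radius (w $ i)) * indicator pos_orthant w = (\<Prod>i\<in>UNIV. ennreal (PG_pos radius (w $ i)))"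
      proof (cases "w \<in> pos_orthant")
        case False
        then obtain i where "w $ i \<le> 0"
          by (auto simp: pos_orthant_def not_less)
        then have "(\<Prod>i\<in>UNIV. ennreal (PG_pos radius (w $ i))) = 0"
          by (intro prod_zero) (auto intro!: exI[of _ i] simp: PG_pos_nonpos)
        then show ?thesis
          using False by simp
      qed (simp add: prod_ennreal PG_pos_nonneg)
    qed
    also have "\<dots> = 1"
      using radius_pos by (subst nn_integral_lborel_prod_cart) (simp_all add: nn_integral_PG_pos)
    finally show "emeasure minor_measure (space minor_measure) = 1"
      by (simp add: minor_measure_def space_orthant_measure)
  qed
  then show ?thesis
    by (simp add: space_prob_algebra minor_measure_def)
qed

definition minor_const :: real where
  "minor_const = (1 / 2) * (1 / cosh (radius / 2)) ^ CARD('n)"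

text \<open>The factor 1/2 in \<open>minor_const\<close> bounds the mass of those \<beta> whose
  absolute sum is at most \<open>radius\<close>. For them every single
  \<open>|x_i \<bullet> \<beta>|\<close> is at most \<open>radius\<close> too, and
  \<open>PG_pos_lower\<close> costs one factor \<open>1 / cosh (radius / 2)\<close> per
  coordinate.\<close>

lemma PG_kernel_minorization:
  assumes \<omega>: "\<omega> \<in> pos_orthant" and V: "inv_sum \<omega> \<le> level" and A: "A \<in> sets orthant_measure"
  shows "ennreal minor_const * emeasure minor_measure A \<le> emeasure (PG_kernel X y \<omega>) A"
proof -
  note [measurable] = cond_beta_measurable1[OF \<omega>]
  have [measurable]: "A \<in> sets borel"
    using A by (simp add: sets_orthant_measure)
  let ?S = "\<lambda>\<beta>. \<Sum>i\<in>UNIV. \<bar>X $ i \<bullet> \<beta>\<bar>"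
  let ?B = "{\<beta>. ?S \<beta> \<le> radius}"
  let ?c = "(1 / cosh (radius / 2)) ^ CARD('n)"
  let ?p = "\<integral>\<^sup>+\<beta>. ennreal (cond_beta X y \<omega> \<beta>) * indicator ?B \<beta> \<partial>lborel"
  have c: "0 \<le> ?c"
    by simp
  have [measurable]: "?B \<in> sets borel"
    by measurable
  have half: "ennreal (1 / 2) \<le> ?p"
  proof -
    \<comment> \<open>Markov's inequality in pointwise form: off \<open>?B\<close> the second
      summand is at least 1.\<close>
    have pw: "1 \<le> indicator ?B \<beta> + ennreal (1 / (2 * radius)) * ennreal (2 * ?S \<beta>)" for \<beta>
    proof (cases "?S \<beta> \<le> radius")
      case False
      have "1 \<le> 1 / (2 * radius) * (2 * ?S \<beta>)"
        using False radius_pos by (simp add: field_simps)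
      then have "ennreal 1 \<le> ennreal (1 / (2 * radius) * (2 * ?S \<beta>))"
        by (rule ennreal_leI)
      also have "\<dots> = ennreal (1 / (2 * radius)) * ennreal (2 * ?S \<beta>)"
        using radius_pos by (intro ennreal_mult') simp
      finally show ?thesis
        using False by simp
    qed simp
    have "1 = (\<integral>\<^sup>+\<beta>. ennreal (cond_beta X y \<omega> \<beta>) * 1 \<partial>lborel)"
      using nn_integral_cond_beta[OF \<omega>] by simp
    also have "\<dots> \<le> (\<integral>\<^sup>+\<beta>. ennreal (cond_beta X y \<omega> \<beta>) * (indicator ?B \<beta> + ennreal (1 / (2 * radius)) * ennreal (2 * ?S \<beta>)) \<partial>lborel)"
      by (intro nn_integral_mono mult_left_mono pw) simp
    also have "\<dots> = (\<integral>\<^sup>+\<beta>. ennreal (cond_beta X y \<omega> \<beta>) * indicator ?B \<beta>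
        + ennreal (1 / (2 * radius)) * (ennreal (cond_beta X y \<omega> \<beta>) * ennreal (2 * ?S \<beta>)) \<partial>lborel)"
      by (intro nn_integral_cong) (simp only: distrib_left mult_ac)
    also have "\<dots> = ?p + ennreal (1 / (2 * radius)) * (\<integral>\<^sup>+\<beta>. ennreal (cond_beta X y \<omega> \<beta>) * ennreal (2 * ?S \<beta>) \<partial>lborel)"
      by (subst nn_integral_add, measurable, subst nn_integral_cmult, measurable)
    also have "\<dots> \<le> ?p + ennreal (1 / (2 * radius)) * ennreal ((1 - \<delta>) * inv_sum \<omega> + dev)"
      by (intro add_left_mono mult_left_mono nn_integral_cond_beta_abs[OF \<omega>]) simp
    also have "\<dots> \<le> ?p + ennreal (1 / (2 * radius)) * ennreal radius"
      using V \<delta> unfolding radius_def by (intro add_left_mono mult_left_mono ennreal_leI add_right_mono) auto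
    also have "ennreal (1 / (2 * radius)) * ennreal radius = ennreal (1 / 2)"
      using radius_pos by (simp add: ennreal_mult'[symmetric])
    finally have "ennreal (1 / 2) + ennreal (1 / 2) \<le> ?p + ennreal (1 / 2)"
      by (subst ennreal_plus[symmetric]) auto
    then show ?thesis
      by (subst (asm) (1 2) add.commute) (simp add: ennreal_add_left_cancel_le)
  qed
  have low: "ennreal ?c * emeasure minor_measure A \<le> set_prob A \<beta>" if \<beta>: "?S \<beta> \<le> radius" for \<beta>
  proof -
    have "\<bar>X $ i \<bullet> \<beta>\<bar> \<le> radius" for i
      using \<beta> member_le_sum[of i UNIV "\<lambda>i. \<bar>X $ i \<bullet> \<beta>\<bar>"] by simp
    then have "(\<Prod>i\<in>UNIV. PG_pos radius (w $ i) / cosh (radius / 2)) \<le> omega_density X \<beta> w" for w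
      unfolding omega_density_def by (intro prod_mono conjI PG_pos_lower) (auto simp: PG_pos_nonneg)
    then have pw: "?c * (\<Prod>i\<in>UNIV. PG_pos radius (w $ i)) \<le> omega_density X \<beta> w" for w
      by (simp add: prod_dividef power_one_over)
    have "ennreal ?c * emeasure minor_measure A = (\<integral>\<^sup>+w. ennreal ?c * (ennreal (\<Prod>i\<in>UNIV. PG_pos radius (w $ i)) * indicator A w) \<partial>lborel)"
      unfolding emeasure_minor_measure[OF A] by (rule nn_integral_cmult[symmetric]) measurable
    also have "\<dots> \<le> set_prob A \<beta>"
      unfolding set_prob_def mult.assoc[symmetric] ennreal_mult'[OF c, symmetric]
      by (intro nn_integral_mono mult_right_mono ennreal_leI pw) simp
    finally show ?thesis .
  qed
  have "ennreal minor_const * emeasure minor_measure A = ennreal (1 / 2) * (ennreal ?c * emeasure minor_measure A)"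
    unfolding minor_const_def by (subst ennreal_mult') (simp_all add: mult.assoc)
  also have "\<dots> \<le> ?p * (ennreal ?c * emeasure minor_measure A)"
    using half by (rule mult_right_mono) simp
  also have "\<dots> = (\<integral>\<^sup>+\<beta>. ennreal (cond_beta X y \<omega> \<beta>) * indicator ?B \<beta> * (ennreal ?c * emeasure minor_measure A) \<partial>lborel)"
    by (rule nn_integral_multc[symmetric]) measurable
  also have "\<dots> \<le> (\<integral>\<^sup>+\<beta>. ennreal (cond_beta X y \<omega> \<beta>) * set_prob A \<beta> \<partial>lborel)"
    using low by (intro nn_integral_mono) (auto split: split_indicator intro!: mult_left_mono)
  also have "\<dots> = emeasure (PG_kernel X y \<omega>) A"
    by (rule emeasure_PG_kernel[OF \<omega> A, symmetric])
  finally show ?thesis .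
qed

sublocale harris_kernel orthant_measure minor_measure "PG_kernel X y" inv_sum "1 - \<delta>" drift_const level minor_const
proof
  show "inv_sum \<in> borel_measurable orthant_measure"
    unfolding inv_sum_def by (intro borel_imp_orthant_measurable) measurable
  have "\<delta> * level = 2 * drift_const + \<delta>"
    using \<delta> by (simp add: level_def field_simps)
  then show "2 * drift_const < (1 - (1 - \<delta>)) * level"
    using \<delta> by simp
  show "(\<integral>\<^sup>+z. ennreal (inv_sum z) \<partial>PG_kernel X y x) \<le> ennreal ((1 - \<delta>) * inv_sum x + drift_const)"
    if "x \<in> space orthant_measure" for x
    using that by (intro PG_kernel_drift) (simp add: space_orthant_measure)
  show "ennreal minor_const * emeasure minor_measure A \<le> emeasure (PG_kernel X y x) A"
    if "x \<in> space orthant_measure" "inv_sum x \<le> level" "A \<in> sets orthant_measure" for x A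
    using that by (intro PG_kernel_minorization) (simp_all add: space_orthant_measure)
  show "0 < minor_const"
    by (simp add: minor_const_def)
qed (use \<delta> drift_const_pos in \<open>auto simp: space_orthant_measure PG_kernel_measurable inv_sum_nonneg minor_measure_prob\<close>)

section \<open>Invariance of the posterior\<close>

lemma norm_const_pos: "0 < norm_const X y"
proof -
  have "norm_const X y \<noteq> 0"
  proof
    assume "norm_const X y = 0"
    then have "AE \<beta> in lborel. ennreal (logit_likelihood X y \<beta>) = 0"
      unfolding norm_const_def by (subst (asm) nn_integral_0_iff_AE) auto
    then have "AE \<beta> in (lborel :: (real ^ 'p) measure). False"
      by eventually_elim (simp add: ennreal_eq_0_iff logit_likelihood_pos[unfolded not_le[symmetric]])
    then show False
      by (simp add: eventually_False ae_filter_eq_bot_iff)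
  qed
  then show ?thesis
    by (simp add: zero_less_iff_neq_zero)
qed

definition joint :: "real ^ 'p \<Rightarrow> real ^ 'n \<Rightarrow> ennreal" where
  "joint \<beta> \<omega> = ennreal (logit_likelihood X y \<beta>) / norm_const X y * ennreal (omega_density X \<beta> \<omega>)"

lemma joint_measurable [measurable]:
  assumes [measurable]: "f \<in> borel_measurable M" "g \<in> borel_measurable M"
  shows "(\<lambda>z. joint (f z) (g z)) \<in> borel_measurable M"
  unfolding joint_def by measurable

lemma joint_posterior_density_eq:
  "\<omega> \<in> pos_orthant \<Longrightarrow> joint_posterior_density X y \<beta> \<omega> = joint \<beta> \<omega>"
  unfolding joint_posterior_density_def joint_def
  by (simp add: omega_density_eq[symmetric] ennreal_mult logit_likelihood_pos less_imp_le omega_density_nonneg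
      divide_ennreal_def mult_ac)

definition marginal :: "real ^ 'n \<Rightarrow> ennreal" where
  "marginal \<omega> = (\<integral>\<^sup>+\<beta>. joint \<beta> \<omega> \<partial>lborel)"

lemma marginal_measurable [measurable]: "marginal \<in> borel_measurable borel"
  unfolding marginal_def by measurable

text \<open>Bayes' rule for the augmented model: by \<open>likelihood_omega_density\<close> the
  joint density depends on \<beta> only through the Gaussian factor, so its conditional law given
  \<omega> is \<open>cond_beta\<close>. This ties the Gaussian step of the sampler to the
  target.\<close>

lemma joint_eq_marginal:
  assumes \<omega>: "\<omega> \<in> pos_orthant"
  shows "joint \<beta> \<omega> = marginal \<omega> * ennreal (cond_beta X y \<omega> \<beta>)"
proof -
  note [measurable] = cond_beta_measurable1[OF \<omega>]
  let ?r = "ennreal (\<Prod>i\<in>UNIV. PG0 (\<omega> $ i) / 2) / norm_const X y * gauss_mass \<omega>"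
  have j: "joint \<beta> \<omega> = ?r * ennreal (cond_beta X y \<omega> \<beta>)" for \<beta>
  proof -
    have "joint \<beta> \<omega> = ennreal (logit_likelihood X y \<beta> * omega_density X \<beta> \<omega>) / norm_const X y"
      by (simp add: joint_def ennreal_mult logit_likelihood_pos less_imp_le omega_density_nonneg divide_ennreal_def mult_ac)
    also have "\<dots> = ennreal (\<Prod>i\<in>UNIV. PG0 (\<omega> $ i) / 2) * ennreal (logit_gauss \<beta> \<omega>) / norm_const X y"
      unfolding likelihood_omega_density by (subst ennreal_mult') (auto intro!: prod_nonneg simp: PG0_nonneg)
    finally show ?thesis
      unfolding logit_gauss_eq[OF \<omega>] by (simp add: divide_ennreal_def mult_ac)
  qed
  have "marginal \<omega> = ?r * (\<integral>\<^sup>+\<beta>. ennreal (cond_beta X y \<omega> \<beta>) \<partial>lborel)"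
    unfolding marginal_def j by (rule nn_integral_cmult) measurable
  then show ?thesis
    using j nn_integral_cond_beta[OF \<omega>] by simp
qed

lemma omega_posterior_eq: "omega_posterior X y = density orthant_measure marginal"
proof -
  have eq: "(\<integral>\<^sup>+\<beta>. joint_posterior_density X y \<beta> \<omega> \<partial>lborel) = marginal \<omega>" if "\<omega> \<in> pos_orthant" for \<omega>
    using that by (simp add: joint_posterior_density_eq marginal_def)
  have "(\<lambda>\<omega>. \<integral>\<^sup>+\<beta>. joint_posterior_density X y \<beta> \<omega> \<partial>lborel) \<in> borel_measurable orthant_measure"
    by (subst measurable_cong[where g = marginal])
      (auto simp: space_orthant_measure eq intro!: borel_imp_orthant_measurable)
  then show ?thesis
    unfolding omega_posterior_def
    by (intro density_cong) (auto simp: space_orthant_measure eq intro!: borel_imp_orthant_measurable AE_I2)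
qed

text \<open>One exchange of integrals serves twice: \<open>h = 1\<close> computes the posterior of a
  set, and \<open>h = set_prob A\<close> over the full orthant computes one kernel step from the
  posterior.\<close>

lemma nn_integral_joint:
  assumes h [measurable]: "h \<in> borel_measurable borel" and A: "A \<in> sets borel"
  shows "(\<integral>\<^sup>+\<omega>. (\<integral>\<^sup>+\<beta>. joint \<beta> \<omega> * h \<beta> \<partial>lborel) * indicator A \<omega> \<partial>lborel)
    = (\<integral>\<^sup>+\<beta>. ennreal (logit_likelihood X y \<beta>) / norm_const X y * h \<beta> * set_prob A \<beta> \<partial>lborel)"
proof -
  note A [measurable]
  let ?l = "\<lambda>\<beta>. ennreal (logit_likelihood X y \<beta>) / norm_const X y * h \<beta>"
  have "(\<integral>\<^sup>+\<omega>. (\<integral>\<^sup>+\<beta>. joint \<beta> \<omega> * h \<beta> \<partial>lborel) * indicator A \<omega> \<partial>lborel)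
      = (\<integral>\<^sup>+\<omega>. \<integral>\<^sup>+\<beta>. ?l \<beta> * (ennreal (omega_density X \<beta> \<omega>) * indicator A \<omega>) \<partial>lborel \<partial>lborel)"
    by (subst nn_integral_multc[symmetric]) (simp_all add: joint_def mult_ac)
  also have "\<dots> = (\<integral>\<^sup>+\<beta>. \<integral>\<^sup>+\<omega>. ?l \<beta> * (ennreal (omega_density X \<beta> \<omega>) * indicator A \<omega>) \<partial>lborel \<partial>lborel)"
    by (rule lborel_pair.Fubini') measurable
  also have "\<dots> = (\<integral>\<^sup>+\<beta>. ?l \<beta> * set_prob A \<beta> \<partial>lborel)"
    unfolding set_prob_def by (intro nn_integral_cong nn_integral_cmult) measurable
  finally show ?thesis .
qed

lemma emeasure_omega_posterior:
  assumes A: "A \<in> sets orthant_measure"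
  shows "emeasure (omega_posterior X y) A = (\<integral>\<^sup>+\<beta>. ennreal (logit_likelihood X y \<beta>) / norm_const X y * set_prob A \<beta> \<partial>lborel)"
proof -
  have "emeasure (omega_posterior X y) A = (\<integral>\<^sup>+\<omega>. marginal \<omega> * indicator A \<omega> \<partial>orthant_measure)"
    unfolding omega_posterior_eq
    by (rule emeasure_density[OF borel_imp_orthant_measurable[OF marginal_measurable] A])
  also have "\<dots> = (\<integral>\<^sup>+\<omega>. (\<integral>\<^sup>+\<beta>. joint \<beta> \<omega> * 1 \<partial>lborel) * indicator A \<omega> \<partial>lborel)"
    unfolding nn_integral_orthant_measure marginal_def using A
    by (intro nn_integral_cong) (auto simp: sets_orthant_measure split: split_indicator)
  also have "\<dots> = (\<integral>\<^sup>+\<beta>. ennreal (logit_likelihood X y \<beta>) / norm_const X y * 1 * set_prob A \<beta> \<partial>lborel)"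
    using A by (intro nn_integral_joint) (auto simp: sets_orthant_measure)
  finally show ?thesis by simp
qed

lemma omega_posterior_prob:
  assumes "norm_const X y < \<infinity>"
  shows "omega_posterior X y \<in> space (prob_algebra orthant_measure)"
proof -
  have "prob_space (omega_posterior X y)"
  proof
    have "emeasure (omega_posterior X y) pos_orthant = (\<integral>\<^sup>+\<beta>. ennreal (logit_likelihood X y \<beta>) / norm_const X y \<partial>lborel)"
      by (subst emeasure_omega_posterior) (simp_all add: sets_orthant_measure set_prob_orthant)
    also have "\<dots> = norm_const X y / norm_const X y"
      by (subst nn_integral_divide) (simp_all add: norm_const_def)
    also have "\<dots> = 1"
      using assms norm_const_pos by (intro ennreal_divide_self) auto
    finally show "emeasure (omega_posterior X y) (space (omega_posterior X y)) = 1"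
      by (simp add: omega_posterior_def space_orthant_measure)
  qed
  then show ?thesis
    by (simp add: space_prob_algebra omega_posterior_def)
qed

text \<open>Two-block Gibbs argument: \<open>marginal\<close> times \<open>cond_beta\<close> is the
  joint density, so integrating out the old state over the whole orthant leaves the posterior of
  \<beta>, from which the new state is drawn.\<close>

lemma omega_posterior_invariant: "omega_posterior X y \<bind> PG_kernel X y = omega_posterior X y"
proof (rule measure_eqI)
  have s: "sets (omega_posterior X y) = sets orthant_measure" "space (omega_posterior X y) = pos_orthant"
    by (simp_all add: omega_posterior_def space_orthant_measure)
  have ne: "(pos_orthant :: (real ^ 'n) set) \<noteq> {}"
    by (auto simp: pos_orthant_def intro!: exI[of _ 1])
  have K: "PG_kernel X y \<in> omega_posterior X y \<rightarrow>\<^sub>M subprob_algebra orthant_measure"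
    using measurable_prob_algebraD[OF PG_kernel_measurable] by (simp cong: measurable_cong_sets add: s)
  show sb: "sets (omega_posterior X y \<bind> PG_kernel X y) = sets (omega_posterior X y)"
    using s ne by (subst sets_bind[where N=orthant_measure]) auto
  fix A assume "A \<in> sets (omega_posterior X y \<bind> PG_kernel X y)"
  then have A: "A \<in> sets orthant_measure"
    unfolding sb s .
  then have [measurable]: "A \<in> sets borel"
    by (simp add: sets_orthant_measure)
  have "emeasure (omega_posterior X y \<bind> PG_kernel X y) A = (\<integral>\<^sup>+\<omega>. emeasure (PG_kernel X y \<omega>) A \<partial>omega_posterior X y)"
    using ne s by (intro emeasure_bind[OF _ K A]) simp
  also have "\<dots> = (\<integral>\<^sup>+\<omega>. marginal \<omega> * emeasure (PG_kernel X y \<omega>) A \<partial>orthant_measure)"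
    unfolding omega_posterior_eq
    by (rule nn_integral_density[OF borel_imp_orthant_measurable[OF marginal_measurable]
          measurable_compose[OF measurable_prob_algebraD[OF PG_kernel_measurable] measurable_emeasure_subprob_algebra[OF A]]])
  also have "\<dots> = (\<integral>\<^sup>+\<omega>. (\<integral>\<^sup>+\<beta>. joint \<beta> \<omega> * set_prob A \<beta> \<partial>lborel) * indicator pos_orthant \<omega> \<partial>lborel)"
    unfolding nn_integral_orthant_measure
  proof (rule nn_integral_cong)
    fix \<omega> :: "real ^ 'n"
    show "marginal \<omega> * emeasure (PG_kernel X y \<omega>) A * indicator pos_orthant \<omega>
        = (\<integral>\<^sup>+\<beta>. joint \<beta> \<omega> * set_prob A \<beta> \<partial>lborel) * indicator pos_orthant \<omega>"
    proof (cases "\<omega> \<in> pos_orthant")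
      case True
      note [measurable] = cond_beta_measurable1[OF True]
      show ?thesis
        unfolding emeasure_PG_kernel[OF True A] joint_eq_marginal[OF True] mult.assoc
        by (subst nn_integral_cmult) (simp_all add: mult_ac)
    qed simp
  qed
  also have "\<dots> = (\<integral>\<^sup>+\<beta>. ennreal (logit_likelihood X y \<beta>) / norm_const X y * set_prob A \<beta> * set_prob pos_orthant \<beta> \<partial>lborel)"
    by (rule nn_integral_joint) measurable
  also have "\<dots> = emeasure (omega_posterior X y) A"
    by (simp add: set_prob_orthant emeasure_omega_posterior[OF A])
  finally show "emeasure (omega_posterior X y \<bind> PG_kernel X y) A = emeasure (omega_posterior X y) A" .
qed

end

theorem theorem1:
  fixes X :: "real ^ 'p ^ 'n" and y :: "nat ^ 'n"
  assumes binary: "\<And>i. y $ i \<in> {0, 1}"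
    and proper: "norm_const X y < \<infinity>"
  shows "\<exists>(t::real) (H :: real ^ 'n \<Rightarrow> real). 0 < t \<and> t < 1 \<and>
           (\<forall>\<omega>\<in>pos_orthant. 0 \<le> H \<omega>) \<and>
           (\<forall>\<omega>\<in>pos_orthant. \<forall>m\<ge>1.
              (SUP A\<in>sets (restrict_space borel (pos_orthant :: (real ^ 'n) set)).
                 \<bar>enn2ereal (kernel_pow (PG_kernel X y) m \<omega> A)
                   - enn2ereal (emeasure (omega_posterior X y) A)\<bar>)
              \<le> ereal (H \<omega> * t ^ m))"
proof -
  have ns: "\<exists>i. 0 < resp_sign (y $ i) * (X $ i \<bullet> d)" if "d \<noteq> 0" for d
    by (rule proper_imp_no_separation[OF binary proper that])
  have "\<bar>resp_sign (y $ i)\<bar> = 1" for i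
    using binary[of i] by (auto simp: resp_sign_def)
  then obtain \<delta> where \<delta>: "0 < \<delta>" "\<delta> < 1 / 2"
    "\<And>v. - (\<Sum>i\<in>UNIV. resp_sign (y $ i) * (X $ i \<bullet> v)) \<le> (1 - 2 * \<delta>) * (\<Sum>i\<in>UNIV. \<bar>X $ i \<bullet> v\<bar>)"
    using no_separation_margin[of "\<lambda>i. resp_sign (y $ i)" X] ns by blast
  \<comment> \<open>Absence of separation also yields full rank: a nonzero direction orthogonal to
    all rows would separate trivially.\<close>
  interpret no_separation X y \<delta>
  proof
    show "\<exists>i. X $ i \<bullet> d \<noteq> 0" if "d \<noteq> 0" for d
      using ns[OF that] by (metis mult_zero_right less_irrefl)
  qed (use \<delta> in auto)
  \<comment> \<open>The constant of \<open>geometrically_ergodic\<close> for the drift factor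
    \<open>1 - \<delta>\<close>; leaving \<open>1 - (1 - \<delta>)\<close> unsimplified keeps it
    syntactically equal to the instantiated bound.\<close>
  define H where "H \<omega> = 2 + wt * inv_sum \<omega> + wt * (drift_const / (1 - (1 - \<delta>)))" for \<omega>
  have sets_eq: "sets (restrict_space borel (pos_orthant :: (real ^ 'n) set)) = sets orthant_measure"
    by (rule sets_restrict_space_cong) simp
  have "0 \<le> H \<omega>" if "\<omega> \<in> pos_orthant" for \<omega>
    unfolding H_def using wt_pos inv_sum_nonneg[OF that] drift_const_pos \<delta>
    by (intro add_nonneg_nonneg mult_nonneg_nonneg divide_nonneg_nonneg) auto
  moreover have "(SUP A\<in>sets (restrict_space borel (pos_orthant :: (real ^ 'n) set)).
                 \<bar>enn2ereal (kernel_pow (PG_kernel X y) m \<omega> A) - enn2ereal (emeasure (omega_posterior X y) A)\<bar>)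
              \<le> ereal (H \<omega> * rate ^ m)" if "\<omega> \<in> pos_orthant" for \<omega> m
    unfolding sets_eq H_def
    using geometrically_ergodic[OF omega_posterior_prob[OF proper] omega_posterior_invariant] that
    by (intro SUP_least) (simp add: space_orthant_measure)
  ultimately show ?thesis
    using rate_bounds by blast
qed

end
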